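(* Let $\mathcal{H}=\{h_1,\dots,h_N\}\subset R_P$ be a subset of $N$ elements with attached nonnegative integers $0\le e_1\le\cdots\le e_N$ such that (i) $h_l\in\mathfrak{m}_P^{p^{e_l}}$ and $(h_l\bmod\mathfrak{m}_P^{p^{e_l}+1})=v_l^{p^{e_l}}$ with $v_l\in\mathfrak{m}_P/\mathfrak{m}_P^2$ for $l=1,\dots,N$; (ii) $v_1,\dots,v_N$ are $N$ distinct and $k$-linearly independent elements of $\mathfrak{m}_P/\mathfrak{m}_P^2$. Let $X=(x_1,\dots,x_d)$ be a regular system of parameters of $R_P$ associated to $H=(h_1,\dots,h_N)$, i.e. $v_l=(x_l\bmod\mathfrak{m}_P^2)$ for $l=1,\dots,N$. Then any element $f\in\widehat{R_P}$ has a power series expansion, with respect to $H$ and $(x_1,\dots,x_d)$, of the form $$(\star)\qquad f=\sum_{B\in(\mathbb{Z}_{\ge0})^N}a_BH^B\quad\text{where}\quad a_B=\sum_{K\in(\mathbb{Z}_{\ge0})^d}b_{B,K}X^K,$$ with each $b_{B,K}$ a power series in $(x_{N+1},\dots,x_d)$, and with $K=(k_1,\dots,k_d)$ varying in the range $$0\le k_l\le p^{e_l}-1\ \text{ for } l=1,\dots,N,\qquad k_l=0\ \text{ for } l=N+1,\dots,d.$$ Moreover, the power series expansion of the form $(\star)$ is unique.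
   Context: $k$ is an algebraically closed field of characteristic $p>0$ or of characteristic $0$; in characteristic $0$ one formally sets $p=\infty$ with $p^0=1$, so that all exponents $e_l$ are $0$. $W$ is a nonsingular variety over $k$ of dimension $d$, $P\in W$ a closed point, $R_P=\mathcal{O}_{W,P}$ with maximal ideal $\mathfrak{m}_P$ and completion $\widehat{R_P}$. Power series have coefficients in $k$. For $B=(b_1,\dots,b_N)$, $H^B=\prod_{l=1}^Nh_l^{b_l}$, and $X^K=\prod_{l=1}^dx_l^{k_l}$. Powers $v_l^{p^{e_l}}$ are taken in $\bigoplus_n\mathfrak{m}_P^n/\mathfrak{m}_P^{n+1}$. *)

theory Defs
  imports "HOL-Analysis.Function_Topology" "HOL-Computational_Algebra.Polynomial"
    "HOL-Algebra.Algebra"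
begin

section \<open>Varieties over an algebraically closed field\<close>

text \<open>
  Varieties are taken in the classical sense, as spaces with functions: a topological space \<open>W\<close>
  (whose points are the closed points) with a sheaf \<open>\<O>\<close> of functions to \<open>k\<close>.  Over an
  algebraically closed field these are equivalent to integral separated schemes of finite type.
  A section over \<open>U\<close> is an extensional function, that is, it is \<open>undefined\<close> outside \<open>U\<close>.  The
  values of \<open>\<O>\<close> on sets that are not open are irrelevant.
\<close>

type_synonym ('w, 'k) fun_sheaf = "'w set \<Rightarrow> ('w \<Rightarrow> 'k) set"

definition space_with_functions :: "'w topology \<Rightarrow> ('w, 'k::field) fun_sheaf \<Rightarrow> bool" where
  "space_with_functions W \<O> \<longleftrightarrow>
     (\<forall>U. openin W U \<longrightarrow>
        \<O> U \<subseteq> extensional U \<and>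
        (\<forall>c. (\<lambda>x\<in>U. c) \<in> \<O> U) \<and>
        (\<forall>f\<in>\<O> U. \<forall>g\<in>\<O> U. (\<lambda>x\<in>U. f x + g x) \<in> \<O> U \<and> (\<lambda>x\<in>U. f x * g x) \<in> \<O> U) \<and>
        (\<forall>f\<in>\<O> U. \<forall>V. openin W V \<and> V \<subseteq> U \<longrightarrow> restrict f V \<in> \<O> V) \<and>
        (\<forall>f\<in>extensional U.
           (\<forall>x\<in>U. \<exists>V. openin W V \<and> x \<in> V \<and> V \<subseteq> U \<and> restrict f V \<in> \<O> V) \<longrightarrow> f \<in> \<O> U))"

definition morphism ::
  "'v topology \<Rightarrow> ('v, 'k::field) fun_sheaf \<Rightarrow> 'w topology \<Rightarrow> ('w, 'k) fun_sheaf \<Rightarrow> ('v \<Rightarrow> 'w) \<Rightarrow> bool"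
  where
  "morphism V \<O>\<^sub>V W \<O>\<^sub>W \<phi> \<longleftrightarrow> continuous_map V W \<phi> \<and>
     (\<forall>U. openin W U \<longrightarrow> (\<forall>g\<in>\<O>\<^sub>W U.
        (\<lambda>x\<in>{x \<in> topspace V. \<phi> x \<in> U}. g (\<phi> x)) \<in> \<O>\<^sub>V {x \<in> topspace V. \<phi> x \<in> U}))"

definition isomorphic_spaces ::
  "'v topology \<Rightarrow> ('v, 'k::field) fun_sheaf \<Rightarrow> 'w topology \<Rightarrow> ('w, 'k) fun_sheaf \<Rightarrow> bool" where
  "isomorphic_spaces V \<O>\<^sub>V W \<O>\<^sub>W \<longleftrightarrow>
     (\<exists>\<phi> \<psi>. homeomorphic_maps V W \<phi> \<psi> \<and> morphism V \<O>\<^sub>V W \<O>\<^sub>W \<phi> \<and> morphism W \<O>\<^sub>W V \<O>\<^sub>V \<psi>)"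

text \<open>Affine \<open>n\<close>-space is \<open>{..<n} \<rightarrow>\<^sub>E UNIV\<close>.\<close>

inductive_set polynomial_funs :: "nat \<Rightarrow> ((nat \<Rightarrow> 'k::field) \<Rightarrow> 'k) set" for n :: nat where
  const: "(\<lambda>x. c) \<in> polynomial_funs n"
| coord: "i < n \<Longrightarrow> (\<lambda>x. x i) \<in> polynomial_funs n"
| add: "F \<in> polynomial_funs n \<Longrightarrow> G \<in> polynomial_funs n \<Longrightarrow> (\<lambda>x. F x + G x) \<in> polynomial_funs n"
| mult: "F \<in> polynomial_funs n \<Longrightarrow> G \<in> polynomial_funs n \<Longrightarrow> (\<lambda>x. F x * G x) \<in> polynomial_funs n"

definition zariski :: "nat \<Rightarrow> (nat \<Rightarrow> 'k::field) topology" where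
  "zariski n = topology_generated_by
     {{x \<in> {..<n} \<rightarrow>\<^sub>E UNIV. F x \<noteq> 0} | F. F \<in> polynomial_funs n}"

text \<open>For \<open>Z\<close> closed in affine space, \<open>regular_funs n Z\<close> is the sheaf of regular functions on \<open>Z\<close>.\<close>

definition regular_funs :: "nat \<Rightarrow> (nat \<Rightarrow> 'k::field) set \<Rightarrow> (nat \<Rightarrow> 'k, 'k) fun_sheaf" where
  "regular_funs n Z U =
     {f \<in> extensional U. \<forall>x\<in>U. \<exists>V. openin (subtopology (zariski n) Z) V \<and> x \<in> V \<and> V \<subseteq> U \<and>
        (\<exists>F\<in>polynomial_funs n. \<exists>G\<in>polynomial_funs n. \<forall>y\<in>V. G y \<noteq> 0 \<and> f y = F y / G y)}"

definition affine_open :: "'w topology \<Rightarrow> ('w, 'k::field) fun_sheaf \<Rightarrow> 'w set \<Rightarrow> bool" where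
  "affine_open W \<O> U \<longleftrightarrow> openin W U \<and>
     (\<exists>n Z. closedin (zariski n) Z \<and>
        isomorphic_spaces (subtopology W U) \<O> (subtopology (zariski n) Z) (regular_funs n Z))"

definition irreducible_in :: "'w topology \<Rightarrow> 'w set \<Rightarrow> bool" where
  "irreducible_in W C \<longleftrightarrow> C \<noteq> {} \<and> C \<subseteq> topspace W \<and>
     (\<forall>A B. closedin W A \<longrightarrow> closedin W B \<longrightarrow> C \<subseteq> A \<union> B \<longrightarrow> C \<subseteq> A \<or> C \<subseteq> B)"

text \<open>
  Separatedness is stated as: the locus where two morphisms to \<open>W\<close> agree is closed.  This property
  is local on the source, so it suffices to test it on affine sources.
\<close>

definition separated :: "'w topology \<Rightarrow> ('w, 'k::field) fun_sheaf \<Rightarrow> bool" where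
  "separated W \<O> \<longleftrightarrow>
     (\<forall>n Z \<phi> \<psi>. closedin (zariski n) Z \<longrightarrow>
        morphism (subtopology (zariski n) Z) (regular_funs n Z) W \<O> \<phi> \<longrightarrow>
        morphism (subtopology (zariski n) Z) (regular_funs n Z) W \<O> \<psi> \<longrightarrow>
        closedin (subtopology (zariski n) Z) {z \<in> Z. \<phi> z = \<psi> z})"

definition variety :: "'w topology \<Rightarrow> ('w, 'k::alg_closed_field) fun_sheaf \<Rightarrow> bool" where
  "variety W \<O> \<longleftrightarrow> space_with_functions W \<O> \<and> irreducible_in W (topspace W) \<and>
     (\<exists>\<U>. finite \<U> \<and> \<Union>\<U> = topspace W \<and> (\<forall>U\<in>\<U>. affine_open W \<O> U)) \<and>
     separated W \<O>"

text \<open>\<open>chain_dim \<S> d\<close>: the supremum of the lengths of strict chains in \<open>\<S>\<close> is \<open>d\<close>.\<close>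

definition has_chain :: "'a set set \<Rightarrow> nat \<Rightarrow> bool" where
  "has_chain \<S> n \<longleftrightarrow> (\<exists>Z. (\<forall>i\<le>n. Z i \<in> \<S>) \<and> (\<forall>i<n. Z i \<subset> Z (Suc i)))"

definition chain_dim :: "'a set set \<Rightarrow> nat \<Rightarrow> bool" where
  "chain_dim \<S> d \<longleftrightarrow> has_chain \<S> d \<and> \<not> has_chain \<S> (Suc d)"

definition variety_dim :: "'w topology \<Rightarrow> nat \<Rightarrow> bool" where
  "variety_dim W d \<longleftrightarrow> chain_dim {C. closedin W C \<and> irreducible_in W C} d"

section \<open>Regular local rings\<close>

definition krull_dim :: "('a, 'm) ring_scheme \<Rightarrow> nat \<Rightarrow> bool" where
  "krull_dim R d \<longleftrightarrow> chain_dim {\<pp>. primeideal \<pp> R} d"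

definition local_ring :: "('a, 'm) ring_scheme \<Rightarrow> bool" where
  "local_ring R \<longleftrightarrow> cring R \<and> (\<exists>!M. maximalideal M R)"

definition max_ideal :: "('a, 'm) ring_scheme \<Rightarrow> 'a set" where
  "max_ideal R = (THE M. maximalideal M R)"

definition regular_local_ring :: "('a, 'm) ring_scheme \<Rightarrow> bool" where
  "regular_local_ring R \<longleftrightarrow> local_ring R \<and> noetherian_ring R \<and>
     (\<exists>d x. krull_dim R d \<and> x ` {1..d} \<subseteq> carrier R \<and> max_ideal R = Idl\<^bsub>R\<^esub> (x ` {1..d}))"

definition regular_system_of_parameters ::
  "('a, 'm) ring_scheme \<Rightarrow> nat \<Rightarrow> (nat \<Rightarrow> 'a) \<Rightarrow> bool" where
  "regular_system_of_parameters R d x \<longleftrightarrow> regular_local_ring R \<and> krull_dim R d \<and>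
     x ` {1..d} \<subseteq> carrier R \<and> max_ideal R = Idl\<^bsub>R\<^esub> (x ` {1..d})"

section \<open>The local ring of a variety at a point\<close>

definition germ ::
  "'w topology \<Rightarrow> ('w, 'k) fun_sheaf \<Rightarrow> 'w \<Rightarrow> 'w set \<Rightarrow> ('w \<Rightarrow> 'k) \<Rightarrow> ('w set \<times> ('w \<Rightarrow> 'k)) set" where
  "germ W \<O> P U f =
     {(V, g). openin W V \<and> P \<in> V \<and> g \<in> \<O> V \<and>
        (\<exists>U'. openin W U' \<and> P \<in> U' \<and> U' \<subseteq> U \<inter> V \<and> (\<forall>y\<in>U'. f y = g y))}"

definition const_germ ::
  "'w topology \<Rightarrow> ('w, 'k) fun_sheaf \<Rightarrow> 'w \<Rightarrow> 'k \<Rightarrow> ('w set \<times> ('w \<Rightarrow> 'k)) set" where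
  "const_germ W \<O> P c = germ W \<O> P (topspace W) (\<lambda>x\<in>topspace W. c)"

definition stalk ::
  "'w topology \<Rightarrow> ('w, 'k::field) fun_sheaf \<Rightarrow> 'w \<Rightarrow> ('w set \<times> ('w \<Rightarrow> 'k)) set ring" where
  "stalk W \<O> P =
     \<lparr>carrier = {germ W \<O> P U f | U f. openin W U \<and> P \<in> U \<and> f \<in> \<O> U},
      monoid.mult = (\<lambda>a b. \<Union>(U, f)\<in>a. \<Union>(V, g)\<in>b. germ W \<O> P (U \<inter> V) (\<lambda>x\<in>U \<inter> V. f x * g x)),
      one = const_germ W \<O> P 1,
      ring.zero = const_germ W \<O> P 0,
      ring.add = (\<lambda>a b. \<Union>(U, f)\<in>a. \<Union>(V, g)\<in>b. germ W \<O> P (U \<inter> V) (\<lambda>x\<in>U \<inter> V. f x + g x))\<rparr>"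

definition nonsingular :: "'w topology \<Rightarrow> ('w, 'k::field) fun_sheaf \<Rightarrow> bool" where
  "nonsingular W \<O> \<longleftrightarrow> (\<forall>P\<in>topspace W. regular_local_ring (stalk W \<O> P))"

section \<open>Ideal powers, associated graded ring and completion\<close>

primrec ideal_pow :: "('a, 'm) ring_scheme \<Rightarrow> 'a set \<Rightarrow> nat \<Rightarrow> 'a set" where
  "ideal_pow R I 0 = carrier R"
| "ideal_pow R I (Suc n) = ideal_prod R (ideal_pow R I n) I"

definition gr_class :: "('a, 'm) ring_scheme \<Rightarrow> 'a set \<Rightarrow> nat \<Rightarrow> 'a \<Rightarrow> 'a set" where
  "gr_class R I n a = ideal_pow R I (Suc n) +>\<^bsub>R\<^esub> a"

definition gr_component :: "('a, 'm) ring_scheme \<Rightarrow> 'a set \<Rightarrow> nat \<Rightarrow> 'a set set" where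
  "gr_component R I n = gr_class R I n ` ideal_pow R I n"

text \<open>
  The multiplication of the associated graded ring, on homogeneous elements of degrees \<open>i\<close> and
  \<open>j\<close>, and the powers of an element of degree 1.
\<close>

definition gr_mult :: "('a, 'm) ring_scheme \<Rightarrow> 'a set \<Rightarrow> nat \<Rightarrow> nat \<Rightarrow> 'a set \<Rightarrow> 'a set \<Rightarrow> 'a set" where
  "gr_mult R I i j u v = rcoset_mult R (ideal_pow R I (Suc (i + j))) u v"

primrec gr_pow :: "('a, 'm) ring_scheme \<Rightarrow> 'a set \<Rightarrow> 'a set \<Rightarrow> nat \<Rightarrow> 'a set" where
  "gr_pow R I v 0 = gr_class R I 0 \<one>\<^bsub>R\<^esub>"
| "gr_pow R I v (Suc n) = gr_mult R I n 1 (gr_pow R I v n) v"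

text \<open>
  The completion is the inverse limit of the rings \<open>R / I\<^sup>n\<close>.  The transition map sends a coset of
  \<open>I\<^sup>n\<^sup>+\<^sup>1\<close> to the coset of \<open>I\<^sup>n\<close> containing it.
\<close>

definition completion :: "('a, 'm) ring_scheme \<Rightarrow> 'a set \<Rightarrow> (nat \<Rightarrow> 'a set) ring" where
  "completion R I =
     \<lparr>carrier = {s. \<forall>n. s n \<in> carrier (R Quot ideal_pow R I n) \<and> s (Suc n) \<subseteq> s n},
      monoid.mult = (\<lambda>s t n. s n \<otimes>\<^bsub>R Quot ideal_pow R I n\<^esub> t n),
      one = (\<lambda>n. \<one>\<^bsub>R Quot ideal_pow R I n\<^esub>),
      ring.zero = (\<lambda>n. \<zero>\<^bsub>R Quot ideal_pow R I n\<^esub>),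
      ring.add = (\<lambda>s t n. s n \<oplus>\<^bsub>R Quot ideal_pow R I n\<^esub> t n)\<rparr>"

definition to_completion :: "('a, 'm) ring_scheme \<Rightarrow> 'a set \<Rightarrow> 'a \<Rightarrow> nat \<Rightarrow> 'a set" where
  "to_completion R I a = (\<lambda>n. ideal_pow R I n +>\<^bsub>R\<^esub> a)"

text \<open>
  Unconditional summability in the completion: the net of finite partial sums converges.  The
  topology is the one of the inverse limit, i.e. a net converges iff its image in each \<open>R / I\<^sup>n\<close> is
  eventually constant; for Noetherian \<open>R\<close> this is the adic topology of the completion.
\<close>

definition completion_has_sum ::
  "('a, 'm) ring_scheme \<Rightarrow> 'a set \<Rightarrow> ('i \<Rightarrow> nat \<Rightarrow> 'a set) \<Rightarrow> 'i set \<Rightarrow> (nat \<Rightarrow> 'a set) \<Rightarrow> bool" where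
  "completion_has_sum R I t A s \<longleftrightarrow>
     t ` A \<subseteq> carrier (completion R I) \<and> s \<in> carrier (completion R I) \<and>
     (\<forall>n. \<exists>F\<^sub>0. finite F\<^sub>0 \<and> F\<^sub>0 \<subseteq> A \<and>
        (\<forall>F. finite F \<and> F\<^sub>0 \<subseteq> F \<and> F \<subseteq> A \<longrightarrow> finsum (completion R I) t F n = s n))"

section \<open>Expansions\<close>

text \<open>
  Multi-exponents in the variables indexed by \<open>J\<close>, and formal power series in these variables,
  given by their coefficient families.
\<close>

definition exponents :: "nat set \<Rightarrow> (nat \<Rightarrow> nat) set" where
  "exponents J = {K. \<forall>l. l \<notin> J \<longrightarrow> K l = 0}"

definition power_series :: "nat set \<Rightarrow> ((nat \<Rightarrow> nat) \<Rightarrow> 'k) set" where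
  "power_series J = exponents J \<rightarrow>\<^sub>E UNIV"

definition monomial :: "('a, 'm) ring_scheme \<Rightarrow> nat set \<Rightarrow> (nat \<Rightarrow> 'a) \<Rightarrow> (nat \<Rightarrow> nat) \<Rightarrow> 'a" where
  "monomial S J y K = (\<Otimes>\<^bsub>S\<^esub>l\<in>J. y l [^]\<^bsub>S\<^esub> K l)"

text \<open>
  The power series \<open>c\<close>, evaluated at elements \<open>x\<^sub>l\<close> of \<open>R\<close>, converges to \<open>s\<close> in the completion;
  \<open>\<iota>\<close> is the structure map of the \<open>k\<close>-algebra \<open>R\<close>.
\<close>

definition power_series_converges ::
  "('a, 'm) ring_scheme \<Rightarrow> 'a set \<Rightarrow> ('k \<Rightarrow> 'a) \<Rightarrow> nat set \<Rightarrow> (nat \<Rightarrow> 'a) \<Rightarrow>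
     ((nat \<Rightarrow> nat) \<Rightarrow> 'k) \<Rightarrow> (nat \<Rightarrow> 'a set) \<Rightarrow> bool" where
  "power_series_converges R I \<iota> J x c s \<longleftrightarrow>
     completion_has_sum R I
       (\<lambda>L. to_completion R I (\<iota> (c L)) \<otimes>\<^bsub>completion R I\<^esub>
            monomial (completion R I) J (\<lambda>l. to_completion R I (x l)) L)
       (exponents J) s"

definition K_range :: "nat \<Rightarrow> nat \<Rightarrow> (nat \<Rightarrow> nat) \<Rightarrow> (nat \<Rightarrow> nat) set" where
  "K_range d N q =
     {K \<in> exponents {1..d}. (\<forall>l\<in>{1..N}. K l \<le> q l - 1) \<and> (\<forall>l\<in>{N+1..d}. K l = 0)}"

text \<open>\<open>b B K\<close> is the power series \<open>b\<^sub>B\<^sub>,\<^sub>K\<close>, and \<open>\<beta> B K\<close> below is its value in the completion.\<close>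

definition coefficient_families ::
  "nat \<Rightarrow> nat \<Rightarrow> (nat \<Rightarrow> nat) \<Rightarrow> ((nat \<Rightarrow> nat) \<Rightarrow> (nat \<Rightarrow> nat) \<Rightarrow> (nat \<Rightarrow> nat) \<Rightarrow> 'k) set" where
  "coefficient_families d N q =
     exponents {1..N} \<rightarrow>\<^sub>E K_range d N q \<rightarrow>\<^sub>E power_series {N+1..d}"

definition is_expansion ::
  "('a, 'm) ring_scheme \<Rightarrow> 'a set \<Rightarrow> ('k \<Rightarrow> 'a) \<Rightarrow> nat \<Rightarrow> nat \<Rightarrow> (nat \<Rightarrow> nat) \<Rightarrow>
     (nat \<Rightarrow> 'a) \<Rightarrow> (nat \<Rightarrow> 'a) \<Rightarrow> (nat \<Rightarrow> 'a set) \<Rightarrow>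
     ((nat \<Rightarrow> nat) \<Rightarrow> (nat \<Rightarrow> nat) \<Rightarrow> (nat \<Rightarrow> nat) \<Rightarrow> 'k) \<Rightarrow> bool" where
  "is_expansion R I \<iota> d N q h x f b \<longleftrightarrow>
     (\<exists>\<beta> a.
        (\<forall>B\<in>exponents {1..N}. \<forall>K\<in>K_range d N q.
           power_series_converges R I \<iota> {N+1..d} x (b B K) (\<beta> B K)) \<and>
        (\<forall>B\<in>exponents {1..N}.
           a B = (\<Oplus>\<^bsub>completion R I\<^esub>K\<in>K_range d N q. \<beta> B K \<otimes>\<^bsub>completion R I\<^esub>
                    monomial (completion R I) {1..d} (\<lambda>l. to_completion R I (x l)) K)) \<and>
        completion_has_sum R I
          (\<lambda>B. a B \<otimes>\<^bsub>completion R I\<^esub>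
               monomial (completion R I) {1..N} (\<lambda>l. to_completion R I (h l)) B)
          (exponents {1..N}) f)"

end

theory Submission
  imports Defs "HOL-Library.Fun_Lexorder"
begin

text \<open>
  Since \<open>h\<^sub>l\<close> and \<open>x\<^sub>l\<^sup>q\<close> with \<open>q = q\<^sub>l\<close> have the same initial form, division of exponents by \<open>q\<^sub>l\<close> turns
  the products \<open>H\<^sup>B X\<^sup>K X\<^sup>L\<close> into a family that is indexed by all exponents \<open>\<alpha> = q B + K + L\<close> and
  agrees with the monomials \<open>X\<^sup>\<alpha>\<close> to leading order.  So everything follows by successive approximation,
  once the monomials of each degree \<open>n\<close> are known to be a basis of \<open>\<mm>\<^sup>n / \<mm>\<^sup>n\<^sup>+\<^sup>1\<close> over \<open>k\<close>.

  For the latter, order the exponents by degree and then lexicographically, and let \<open>lead I\<close> be the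
  set of leading exponents of elements of an ideal \<open>I\<close>.  The number of exponents of degree below \<open>n\<close>
  outside \<open>lead I\<close> is the length of \<open>R / (I + \<mm>\<^sup>n)\<close>.  By the Artin--Rees lemma, a chain of \<open>d + 1\<close>
  primes forces this number to grow at least like \<open>n\<^sup>d\<close> for \<open>I = 0\<close>, but a linear relation between
  monomials of the same degree would force it to be at most of order \<open>n\<^sup>d\<^sup>-\<^sup>1\<close>.
\<close>

section \<open>Exponents\<close>

text \<open>Regularity provides generators \<open>x 1, ..., x d\<close> of \<open>m\<close> and a
  strict chain of primes of length \<open>d\<close>, so the independence of the monomials has to be
  extracted from that chain. Let \<open>P\<close> be a prime of the chain and let \<open>y\<close>
  lie in the next one but not in \<open>P\<close>. Multiplication by \<open>y\<close> is injective
  on \<open>R / P\<close>, but it may shift the \<open>m\<close>-adic filtration; Artin--Rees bounds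
  the shift by a constant \<open>c\<close>, whence
  \<open>hilbert (P + (y)) n + hilbert P (n - c) \<le> hilbert P n\<close>. Using this about
  \<open>n / (2 * c)\<close> times raises the order of growth by one, so each link of the chain
  contributes one factor \<open>n\<close>.

  Leading exponents are the least ones, because in a local ring the terms of high degree are the
  small ones. Division by leading terms therefore need not stop. It is carried out modulo
  \<open>mpow n\<close>, and Krull's intersection theorem removes the error where an exact statement
  is needed. Since the order is total, the ideals of terms above a given exponent form a filtration
  that drops by at most one dimension over \<open>k\<close> at each step.\<close>

definition mdeg :: "nat \<Rightarrow> (nat \<Rightarrow> nat) \<Rightarrow> nat" where
  "mdeg d \<alpha> = (\<Sum>l\<in>{1..d}. \<alpha> l)"

text \<open>The degree comes first so that finitely many exponents precede a given one and every
  sufficiently high power of \<open>m\<close> lies beyond it; the purely lexicographic order would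
  not ensure this.\<close>

definition deglex_less :: "nat \<Rightarrow> (nat \<Rightarrow> nat) \<Rightarrow> (nat \<Rightarrow> nat) \<Rightarrow> bool" where
  "deglex_less d \<alpha> \<beta> \<longleftrightarrow> mdeg d \<alpha> < mdeg d \<beta> \<or> mdeg d \<alpha> = mdeg d \<beta> \<and> less_fun \<alpha> \<beta>"

lemma mdeg_add: "mdeg d (\<lambda>l. \<alpha> l + \<beta> l) = mdeg d \<alpha> + mdeg d \<beta>"
  by (simp add: mdeg_def sum.distrib)

lemma deglex_less_irrefl: "\<not> deglex_less d \<alpha> \<alpha>"
  by (simp add: deglex_less_def less_fun_irrefl)

lemma deglex_less_trans: "deglex_less d \<alpha> \<beta> \<Longrightarrow> deglex_less d \<beta> \<gamma> \<Longrightarrow> deglex_less d \<alpha> \<gamma>"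
  by (auto simp: deglex_less_def intro: less_fun_trans)

lemma deglex_less_mdeg: "deglex_less d \<alpha> \<beta> \<Longrightarrow> mdeg d \<alpha> \<le> mdeg d \<beta>"
  by (auto simp: deglex_less_def)

lemma deglex_less_total:
  assumes "\<alpha> \<in> exponents {1..d}" "\<beta> \<in> exponents {1..d}" "\<alpha> \<noteq> \<beta>"
  shows "deglex_less d \<alpha> \<beta> \<or> deglex_less d \<beta> \<alpha>"
proof -
  have "{k. \<alpha> k \<noteq> \<beta> k} \<subseteq> {1..d}"
    using assms by (force simp: exponents_def)
  then have "finite {k. \<alpha> k \<noteq> \<beta> k}" by (rule finite_subset) simp
  from less_fun_trichotomy[OF this] assms(3) show ?thesis
    by (auto simp: deglex_less_def)
qed

lemma deglex_less_add:
  assumes "deglex_less d \<alpha> \<beta>"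
  shows "deglex_less d (\<lambda>l. \<gamma> l + \<alpha> l) (\<lambda>l. \<gamma> l + \<beta> l)"
  using assms by (auto simp: deglex_less_def mdeg_add less_fun_def)

lemma exponents_add: "\<alpha> \<in> exponents J \<Longrightarrow> \<beta> \<in> exponents J \<Longrightarrow> (\<lambda>l. \<alpha> l + \<beta> l) \<in> exponents J"
  by (simp add: exponents_def)

lemma deglex_min_exists:
  assumes "finite A" "A \<noteq> {}" "A \<subseteq> exponents {1..d}"
  shows "\<exists>\<alpha>\<in>A. \<forall>\<beta>\<in>A. \<beta> \<noteq> \<alpha> \<longrightarrow> deglex_less d \<alpha> \<beta>"
  using assms
proof (induction rule: finite_ne_induct)
  case (singleton \<alpha>)
  then show ?case by simp
next
  case (insert \<gamma> A)
  then obtain \<alpha> where a: "\<alpha> \<in> A" "\<forall>\<beta>\<in>A. \<beta> \<noteq> \<alpha> \<longrightarrow> deglex_less d \<alpha> \<beta>" by auto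
  have "\<gamma> \<noteq> \<alpha>" using insert a by auto
  with deglex_less_total[of \<gamma> d \<alpha>] insert.prems a(1)
  have "deglex_less d \<alpha> \<gamma> \<or> deglex_less d \<gamma> \<alpha>" by blast
  then show ?case
  proof
    assume "deglex_less d \<alpha> \<gamma>"
    then show ?thesis using a by blast
  next
    assume g: "deglex_less d \<gamma> \<alpha>"
    have "deglex_less d \<gamma> \<beta>" if "\<beta> \<in> A" for \<beta>
      using a(2) that g deglex_less_trans[OF g, of \<beta>] by (cases "\<beta> = \<alpha>") auto
    then show ?thesis by blast
  qed
qed

section \<open>Counting exponents\<close>

lemma card_box_le:
  "finite {\<alpha> \<in> exponents {1..d}. \<forall>l\<in>{1..d}. \<alpha> l < u l}"
  "card {\<alpha> \<in> exponents {1..d}. \<forall>l\<in>{1..d}. \<alpha> l < u l} \<le> (\<Prod>l\<in>{1..d}. u l)"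
proof -
  let ?P = "\<Pi>\<^sub>E l\<in>{1..d}. {..<u l}"
  let ?g = "\<lambda>\<alpha> l. if l \<in> {1..d} then \<alpha> l else (0::nat)"
  have sub: "{\<alpha> \<in> exponents {1..d}. \<forall>l\<in>{1..d}. \<alpha> l < u l} \<subseteq> ?g ` ?P"
  proof
    fix \<alpha> assume "\<alpha> \<in> {\<alpha> \<in> exponents {1..d}. \<forall>l\<in>{1..d}. \<alpha> l < u l}"
    then have a: "\<alpha> \<in> exponents {1..d}" "\<forall>l\<in>{1..d}. \<alpha> l < u l" by simp_all
    have "\<alpha> = ?g (restrict \<alpha> {1..d})"
    proof
      fix l show "\<alpha> l = ?g (restrict \<alpha> {1..d}) l"
        using a(1) unfolding exponents_def by (cases "l \<in> {1..d}") (simp_all del: atLeastAtMost_iff)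
    qed
    moreover have "restrict \<alpha> {1..d} \<in> ?P" using a(2) by (simp add: PiE_iff)
    ultimately show "\<alpha> \<in> ?g ` ?P" by (rule image_eqI)
  qed
  have fin: "finite ?P" by (simp add: finite_PiE)
  show "finite {\<alpha> \<in> exponents {1..d}. \<forall>l\<in>{1..d}. \<alpha> l < u l}"
    by (rule finite_surj[OF fin sub])
  have "card {\<alpha> \<in> exponents {1..d}. \<forall>l\<in>{1..d}. \<alpha> l < u l} \<le> card ?P"
    by (rule surj_card_le[OF fin sub])
  then show "card {\<alpha> \<in> exponents {1..d}. \<forall>l\<in>{1..d}. \<alpha> l < u l} \<le> (\<Prod>l\<in>{1..d}. u l)"
    by (simp add: card_PiE)
qed

lemma exponent_le_mdeg: "l \<in> {1..d} \<Longrightarrow> \<alpha> l \<le> mdeg d \<alpha>"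
  unfolding mdeg_def by (rule member_le_sum) auto

lemma finite_mdeg_less: "finite {\<alpha> \<in> exponents {1..d}. mdeg d \<alpha> < n}"
proof (rule finite_subset[OF _ card_box_le(1)[of d "\<lambda>_. n"]])
  show "{\<alpha> \<in> exponents {1..d}. mdeg d \<alpha> < n} \<subseteq> {\<alpha> \<in> exponents {1..d}. \<forall>l\<in>{1..d}. \<alpha> l < n}"
    by (auto intro: le_less_trans[OF exponent_le_mdeg])
qed

text \<open>An exponent that is not above \<gamma> falls short of it in some coordinate
  \<open>l\<close>, which then takes at most \<open>\<gamma> l\<close> values while the other
  \<open>d - 1\<close> coordinates take at most \<open>n\<close> each. The loss of one factor
  \<open>n\<close> is what later contradicts growth of order \<open>n ^ d\<close>.\<close>

lemma card_avoiding_le: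
  assumes "\<gamma> \<in> exponents {1..d}"
  shows "card {\<alpha> \<in> exponents {1..d}. mdeg d \<alpha> < n \<and> (\<exists>l. \<alpha> l < \<gamma> l)} \<le> mdeg d \<gamma> * n ^ (d - 1)"
proof -
  let ?B = "\<lambda>l. {\<alpha> \<in> exponents {1..d}. \<forall>j\<in>{1..d}. \<alpha> j < ((\<lambda>_. n)(l := \<gamma> l)) j}"
  have "{\<alpha> \<in> exponents {1..d}. mdeg d \<alpha> < n \<and> (\<exists>l. \<alpha> l < \<gamma> l)} \<subseteq> (\<Union>l\<in>{1..d}. ?B l)"
  proof
    fix \<alpha> assume A: "\<alpha> \<in> {\<alpha> \<in> exponents {1..d}. mdeg d \<alpha> < n \<and> (\<exists>l. \<alpha> l < \<gamma> l)}"
    then obtain l where l: "\<alpha> l < \<gamma> l" by auto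
    then have "l \<in> {1..d}" using assms by (force simp: exponents_def)
    moreover have "\<alpha> j < n" if "j \<in> {1..d}" for j
      using exponent_le_mdeg[OF that, of \<alpha>] A by auto
    ultimately show "\<alpha> \<in> (\<Union>l\<in>{1..d}. ?B l)"
      using A l by (auto intro!: bexI[of _ l])
  qed
  then have "card {\<alpha> \<in> exponents {1..d}. mdeg d \<alpha> < n \<and> (\<exists>l. \<alpha> l < \<gamma> l)} \<le> card (\<Union>l\<in>{1..d}. ?B l)"
    by (rule card_mono[rotated]) (intro finite_UN_I finite_atLeastAtMost card_box_le)
  also have "\<dots> \<le> (\<Sum>l\<in>{1..d}. card (?B l))" by (rule card_UN_le) simp
  also have "\<dots> \<le> (\<Sum>l\<in>{1..d}. \<gamma> l * n ^ (d - 1))"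
  proof (rule sum_mono)
    fix l assume l: "l \<in> {1..d}"
    have "(\<Prod>j\<in>{1..d}. ((\<lambda>_. n)(l := \<gamma> l)) j) = \<gamma> l * (\<Prod>j\<in>{1..d} - {l}. ((\<lambda>_. n)(l := \<gamma> l)) j)"
      using l by (subst prod.remove[of _ l]) auto
    also have "(\<Prod>j\<in>{1..d} - {l}. ((\<lambda>_. n)(l := \<gamma> l)) j) = (\<Prod>j\<in>{1..d} - {l}. n)"
      by (rule prod.cong) auto
    also have "\<dots> = n ^ (d - 1)" using l by (simp add: card_Diff_singleton)
    finally show "card (?B l) \<le> \<gamma> l * n ^ (d - 1)"
      using card_box_le(2)[of d "(\<lambda>_. n)(l := \<gamma> l)"] by simp
  qed
  also have "\<dots> = mdeg d \<gamma> * n ^ (d - 1)" by (simp add: mdeg_def sum_distrib_right)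
  finally show ?thesis .
qed

text \<open>Induction on the number of variables, by forgetting the last coordinate. A finite set
  dominating the projections lifts to \<open>B0\<close>, which settles all exponents whose last
  coordinate is at least those occurring in \<open>B0\<close>. What remains is a finite number of
  slices with constant last coordinate, each settled by the induction hypothesis.\<close>

theorem dickson:
  assumes "L \<subseteq> exponents {1..d}"
  shows "\<exists>B. finite B \<and> B \<subseteq> L \<and> (\<forall>\<alpha>\<in>L. \<exists>\<beta>\<in>B. \<beta> \<le> \<alpha>)"
  using assms
proof (induction d arbitrary: L)
  case 0
  then have "L \<subseteq> {\<lambda>_. 0}" by (auto simp: exponents_def)
  then have "finite L" by (rule finite_subset) simp
  then show ?case by blast
next
  case (Suc d)
  define cut :: "(nat \<Rightarrow> nat) \<Rightarrow> nat \<Rightarrow> nat" where "cut \<alpha> = \<alpha>(Suc d := 0)" for \<alpha>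
  have cut_in: "cut \<alpha> \<in> exponents {1..d}" if "\<alpha> \<in> L" for \<alpha>
  proof -
    have "cut \<alpha> l = 0" if "l \<notin> {1..d}" for l
    proof (cases "l = Suc d")
      case False
      then have "l \<notin> {1..Suc d}" using that by auto
      then show ?thesis using subsetD[OF Suc.prems \<open>\<alpha> \<in> L\<close>] False
        by (simp add: exponents_def cut_def)
    qed (simp add: cut_def)
    then show ?thesis unfolding exponents_def by blast
  qed
  have cut_le: "\<alpha> \<le> \<beta>" if "cut \<alpha> \<le> cut \<beta>" "\<alpha> (Suc d) \<le> \<beta> (Suc d)" for \<alpha> \<beta>
  proof (rule le_funI)
    fix l
    show "\<alpha> l \<le> \<beta> l"
      using le_funD[OF that(1), of l] that(2) by (cases "l = Suc d") (auto simp: cut_def)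
  qed
  have step: "\<exists>B. finite B \<and> B \<subseteq> L' \<and> (\<forall>\<alpha>\<in>L'. \<exists>\<beta>\<in>B. cut \<beta> \<le> cut \<alpha>)" if "L' \<subseteq> L" for L'
  proof -
    have "cut ` L' \<subseteq> exponents {1..d}" by (intro image_subsetI cut_in subsetD[OF that])
    from Suc.IH[OF this] obtain B' where B': "finite B'" "B' \<subseteq> cut ` L'"
      "\<forall>\<alpha>\<in>cut ` L'. \<exists>\<beta>\<in>B'. \<beta> \<le> \<alpha>" by blast
    from finite_subset_image[OF B'(1,2)]
    obtain B where B: "B \<subseteq> L'" "finite B" "B' = cut ` B" by blast
    have "\<exists>\<beta>\<in>B. cut \<beta> \<le> cut \<alpha>" if "\<alpha> \<in> L'" for \<alpha>
      using bspec[OF B'(3) imageI[OF that]] unfolding B(3) by (rule bexE) (erule imageE, simp, erule bexI)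
    then show ?thesis using B(1,2) by (intro exI[of _ B]) simp
  qed
  obtain B0 where B0: "finite B0" "B0 \<subseteq> L" "\<forall>\<alpha>\<in>L. \<exists>\<beta>\<in>B0. cut \<beta> \<le> cut \<alpha>"
    using step[of L] by blast
  \<comment> \<open>Any bound on the last coordinates of \<open>B0\<close> serves; the sum avoids a
    maximum over a possibly empty set.\<close>
  define m where "m = (\<Sum>\<beta>\<in>B0. \<beta> (Suc d))"
  have m: "\<beta> (Suc d) \<le> m" if "\<beta> \<in> B0" for \<beta>
    unfolding m_def using that B0(1) by (intro member_le_sum) auto
  have "\<forall>i. \<exists>B. finite B \<and> B \<subseteq> {\<alpha>\<in>L. \<alpha> (Suc d) = i} \<and>
          (\<forall>\<alpha>\<in>{\<alpha>\<in>L. \<alpha> (Suc d) = i}. \<exists>\<beta>\<in>B. cut \<beta> \<le> cut \<alpha>)"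
    by (intro allI step) auto
  from choice[OF this] obtain C where C': "\<forall>i. finite (C i) \<and> C i \<subseteq> {\<alpha>\<in>L. \<alpha> (Suc d) = i} \<and>
          (\<forall>\<alpha>\<in>{\<alpha>\<in>L. \<alpha> (Suc d) = i}. \<exists>\<beta>\<in>C i. cut \<beta> \<le> cut \<alpha>)" by (rule exE)
  have C: "finite (C i)" "C i \<subseteq> {\<alpha>\<in>L. \<alpha> (Suc d) = i}"
     "\<forall>\<alpha>\<in>{\<alpha>\<in>L. \<alpha> (Suc d) = i}. \<exists>\<beta>\<in>C i. cut \<beta> \<le> cut \<alpha>" for i
    using spec[OF C', of i] by simp_all
  have D: "\<exists>\<beta>\<in>B0 \<union> (\<Union>i<m. C i). \<beta> \<le> \<alpha>" if a: "\<alpha> \<in> L" for \<alpha>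
  proof (cases "\<alpha> (Suc d) < m")
    case True
    obtain \<beta> where b: "\<beta> \<in> C (\<alpha> (Suc d))" "cut \<beta> \<le> cut \<alpha>"
      using bspec[OF C(3), of \<alpha> "\<alpha> (Suc d)"] a by auto
    have "\<beta> (Suc d) = \<alpha> (Suc d)" using subsetD[OF C(2) b(1)] by simp
    then have "\<beta> \<le> \<alpha>" using b by (intro cut_le[of \<beta> \<alpha>]) simp_all
    moreover have "\<beta> \<in> B0 \<union> (\<Union>i<m. C i)" using UN_I[of "\<alpha> (Suc d)" "{..<m}" \<beta> C] b(1) True by simp
    ultimately show ?thesis by (rule bexI)
  next
    case False
    obtain \<beta> where b: "\<beta> \<in> B0" "cut \<beta> \<le> cut \<alpha>" using bspec[OF B0(3) a] by blast
    then have "\<beta> \<le> \<alpha>" using m[of \<beta>] False by (intro cut_le[of \<beta> \<alpha>]) simp_all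
    then show ?thesis using UnI1[OF b(1)] by (rule bexI)
  qed
  have fin: "finite (B0 \<union> (\<Union>i<m. C i))"
    by (intro finite_UnI finite_UN_I finite_lessThan B0(1) C(1))
  have "C i \<subseteq> L" for i using C(2)[of i] by (rule subset_trans) simp
  then have sub: "B0 \<union> (\<Union>i<m. C i) \<subseteq> L" by (intro Un_least UN_least B0(2))
  show ?case
    by (rule exI[of _ "B0 \<union> (\<Union>i<m. C i)"]) (intro conjI ballI fin sub D)
qed

text \<open>Gaussian elimination: an equation with a nonzero coefficient at \<open>u\<close> is
  solved for the unknown at \<open>u\<close> and substituted into the others, which removes one
  equation and one unknown. In \<open>hilbert_cut\<close> this compares the sizes of a spanning and
  an independent family.\<close>

lemma homogeneous_system_nontrivial_solution:
  fixes a :: "'s \<Rightarrow> 't \<Rightarrow> 'k::field"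
  assumes "finite S" "finite T" "card S < card T"
  shows "\<exists>z. (\<exists>t\<in>T. z t \<noteq> 0) \<and> (\<forall>s\<in>S. (\<Sum>t\<in>T. a s t * z t) = 0)"
  using assms
proof (induction S arbitrary: T a rule: finite_induct)
  case empty
  then have "T \<noteq> {}" by auto
  then show ?case by (intro exI[of _ "\<lambda>_. 1"]) auto
next
  case (insert s S)
  show ?case
  proof (cases "\<forall>t\<in>T. a s t = 0")
    case True
    from insert have "card S < card T" by simp
    then obtain z where "\<exists>t\<in>T. z t \<noteq> 0" "\<forall>s\<in>S. (\<Sum>t\<in>T. a s t * z t) = 0"
      using insert.IH[of T a] insert.prems(1) by blast
    then show ?thesis using True by (intro exI[of _ z]) auto
  next
    case False
    then obtain u where u: "u \<in> T" "a s u \<noteq> 0" by blast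
    define T' where "T' = T - {u}"
    \<comment> \<open>Row \<open>r\<close> after subtracting the multiple of row \<open>s\<close>
      that clears column \<open>u\<close>.\<close>
    define a' where "a' r t = a r t - a r u * a s t / a s u" for r t
    have "card S < card T'" using insert u by (simp add: T'_def card_Diff_singleton)
    then obtain z where z: "\<exists>t\<in>T'. z t \<noteq> 0" "\<forall>s\<in>S. (\<Sum>t\<in>T'. a' s t * z t) = 0"
      using insert.IH[of T' a'] insert.prems by (auto simp: T'_def)
    define w where "w = z(u := - (\<Sum>t\<in>T'. a s t * z t) / a s u)"
    have sum_w: "(\<Sum>t\<in>T. a r t * w t) = a r u * w u + (\<Sum>t\<in>T'. a r t * z t)" for r
    proof -
      have "(\<Sum>t\<in>T'. a r t * w t) = (\<Sum>t\<in>T'. a r t * z t)"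
        by (rule sum.cong) (auto simp: w_def T'_def)
      then show ?thesis using u insert.prems by (simp add: sum.remove[of T u] T'_def)
    qed
    have "(\<Sum>t\<in>T. a r t * w t) = 0" if "r \<in> S" for r
    proof -
      have "0 = (\<Sum>t\<in>T'. a' r t * z t)" using z that by simp
      also have "\<dots> = (\<Sum>t\<in>T'. a r t * z t) - (\<Sum>t\<in>T'. a r u / a s u * (a s t * z t))"
        by (simp add: a'_def algebra_simps sum_subtractf)
      also have "(\<Sum>t\<in>T'. a r u / a s u * (a s t * z t)) = a r u / a s u * (\<Sum>t\<in>T'. a s t * z t)"
        by (simp add: sum_distrib_left)
      finally show ?thesis unfolding sum_w by (simp add: w_def)
    qed
    moreover have "(\<Sum>t\<in>T. a s t * w t) = 0" unfolding sum_w using u by (simp add: w_def)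
    moreover have "\<exists>t\<in>T. w t \<noteq> 0" using z(1) by (auto simp: w_def T'_def)
    ultimately show ?thesis by blast
  qed
qed

section \<open>Ideals\<close>

lemma (in ring) ideal_minus_closed:
  assumes "ideal I R" "a \<in> I" "b \<in> I"
  shows "a \<ominus> b \<in> I"
  using assms additive_subgroup.a_closed additive_subgroup.a_inv_closed ideal.axioms(1)
  unfolding a_minus_def by metis

lemma (in ring) ideal_subset_carrier: "ideal I R \<Longrightarrow> a \<in> I \<Longrightarrow> a \<in> carrier R"
  by (rule ideal.Icarr)

lemma (in ring) ideal_add_closed: "ideal I R \<Longrightarrow> a \<in> I \<Longrightarrow> b \<in> I \<Longrightarrow> a \<oplus> b \<in> I"
  by (rule additive_subgroup.a_closed[OF ideal.axioms(1)])

lemma (in ring) ideal_zero_closed: "ideal I R \<Longrightarrow> \<zero> \<in> I"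
  by (rule additive_subgroup.zero_closed[OF ideal.axioms(1)])

lemma (in ring) ideal_of_diff:
  assumes "ideal I R" "a \<ominus> b \<in> I" "b \<in> I" "a \<in> carrier R"
  shows "a \<in> I"
proof -
  have "b \<in> carrier R" using assms ideal_subset_carrier by blast
  then have "a = (a \<ominus> b) \<oplus> b" using assms(4) by algebra
  then show ?thesis using ideal_add_closed[OF assms(1-3)] by simp
qed

lemma (in ring) ideal_finsum_closed:
  assumes "ideal I R" "\<And>a. a \<in> A \<Longrightarrow> f a \<in> I"
  shows "finsum R f A \<in> I"
  using assms(2)
proof (induction A rule: infinite_finite_induct)
  case (insert a A)
  then have "f \<in> A \<rightarrow> carrier R" "f a \<in> carrier R"
    using ideal_subset_carrier[OF assms(1)] by auto
  then show ?case using insert ideal_add_closed[OF assms(1)] by simp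
qed (use ideal_zero_closed[OF assms(1)] in auto)

lemma (in ring) mem_set_add: "a \<in> I <+>\<^bsub>R\<^esub> J \<longleftrightarrow> (\<exists>i\<in>I. \<exists>j\<in>J. a = i \<oplus> j)"
  by (auto simp: set_add_def set_mult_def)

lemma (in ring) mem_set_add_left:
  assumes "ideal I R" "ideal J R" "a \<in> I" shows "a \<in> I <+>\<^bsub>R\<^esub> J"
proof -
  have "a = a \<oplus> \<zero>" using ideal_subset_carrier assms by simp
  then show ?thesis using ideal_zero_closed[OF assms(2)] assms(3) mem_set_add by blast
qed

lemma (in ring) mem_set_add_right:
  assumes "ideal I R" "ideal J R" "a \<in> J" shows "a \<in> I <+>\<^bsub>R\<^esub> J"
proof -
  have "a = \<zero> \<oplus> a" using ideal_subset_carrier assms by simp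
  then show ?thesis using ideal_zero_closed[OF assms(1)] assms(3) mem_set_add by blast
qed

text \<open>The colon ideal of \<open>I\<close> by \<open>b\<close>. It reduces questions about
  multiples of \<open>b\<close> to generators, and the colon ideals by the powers of one element
  form the chain used in \<open>krull_intersection\<close>.\<close>

lemma (in cring) ideal_colon:
  assumes I: "ideal I R" and b: "b \<in> carrier R"
  shows "ideal {a \<in> carrier R. b \<otimes> a \<in> I} R"
proof (rule idealI[OF ring_axioms])
  interpret I: ideal I R by (rule I)
  show "subgroup {a \<in> carrier R. b \<otimes> a \<in> I} (add_monoid R)"
  proof (rule add.subgroupI)
    show "{a \<in> carrier R. b \<otimes> a \<in> I} \<noteq> {}" using b by (auto intro: exI[of _ \<zero>])
  next
    fix a assume "a \<in> {a \<in> carrier R. b \<otimes> a \<in> I}"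
    then show "\<ominus> a \<in> {a \<in> carrier R. b \<otimes> a \<in> I}"
      using b by (auto simp: r_minus)
  next
    fix a a' assume "a \<in> {a \<in> carrier R. b \<otimes> a \<in> I}" "a' \<in> {a \<in> carrier R. b \<otimes> a \<in> I}"
    then show "a \<oplus> a' \<in> {a \<in> carrier R. b \<otimes> a \<in> I}"
      using b by (auto simp: r_distr)
  qed auto
  fix a t assume "a \<in> {a \<in> carrier R. b \<otimes> a \<in> I}" and t: "t \<in> carrier R"
  then have a: "a \<in> carrier R" "b \<otimes> a \<in> I" by auto
  have "b \<otimes> (t \<otimes> a) = t \<otimes> (b \<otimes> a)" "b \<otimes> (a \<otimes> t) = (b \<otimes> a) \<otimes> t"
    using a t b by algebra+
  then show "t \<otimes> a \<in> {a \<in> carrier R. b \<otimes> a \<in> I}" "a \<otimes> t \<in> {a \<in> carrier R. b \<otimes> a \<in> I}"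
    using a t I.I_l_closed I.I_r_closed by auto
qed

lemma (in cring) mem_sum_cgenideal:
  assumes "ideal I R" "b \<in> carrier R"
  shows "a \<in> I <+>\<^bsub>R\<^esub> PIdl b \<longleftrightarrow> (\<exists>i\<in>I. \<exists>t\<in>carrier R. a = i \<oplus> t \<otimes> b)"
  unfolding mem_set_add cgenideal_def by blast

section \<open>Powers of an ideal\<close>

lemma (in ring) ideal_pow_ideal: "ideal I R \<Longrightarrow> ideal (ideal_pow R I n) R"
  by (induction n) (simp_all add: oneideal ideal_prod_is_ideal)

lemma (in cring) ideal_pow_1:
  assumes "ideal I R" shows "ideal_pow R I (Suc 0) = I"
  using ideal_prod_one[OF assms] ideal_prod_commute[OF assms oneideal] by simp

lemma (in ring) ideal_pow_Suc_subset:
  assumes "ideal I R" shows "ideal_pow R I (Suc n) \<subseteq> ideal_pow R I n"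
  using ideal_prod_inter[OF ideal_pow_ideal[OF assms] assms] by auto

lemma (in ring) ideal_pow_antimono:
  assumes "ideal I R" "i \<le> j" shows "ideal_pow R I j \<subseteq> ideal_pow R I i"
  using ideal_pow_Suc_subset[OF assms(1)] assms(2) by (metis lift_Suc_antimono_le)

lemma (in cring) ideal_pow_mult:
  assumes I: "ideal I R" and a: "a \<in> ideal_pow R I i" and b: "b \<in> ideal_pow R I j"
  shows "a \<otimes> b \<in> ideal_pow R I (i + j)"
  using b
proof (induction j arbitrary: b)
  case 0
  then show ?case using a ideal.I_r_closed[OF ideal_pow_ideal[OF I]] by simp
next
  case (Suc j)
  note ac = ideal_subset_carrier[OF ideal_pow_ideal[OF I] a]
  from Suc.prems have "b \<in> ideal_pow R I j \<cdot> I" by simp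
  then have "a \<otimes> b \<in> ideal_pow R I (i + j) \<cdot> I \<and> b \<in> carrier R"
  proof (induction b rule: ideal_prod.induct)
    case (prod u v)
    then have c: "u \<in> carrier R" "v \<in> carrier R"
      using ideal_subset_carrier I ideal_pow_ideal[OF I] by blast+
    have "a \<otimes> (u \<otimes> v) = (a \<otimes> u) \<otimes> v" using c ac by (simp add: m_assoc)
    then show ?case using Suc.IH[OF prod(1)] prod(2) c by (simp add: ideal_prod.prod)
  next
    case (sum u v)
    then show ?case using ac by (simp add: r_distr ideal_prod.sum)
  qed
  then show ?case by simp
qed

lemma (in cring) ideal_pow_nat_pow:
  assumes I: "ideal I R" and a: "a \<in> I"
  shows "a [^] (n::nat) \<in> ideal_pow R I n"
proof (induction n)
  case (Suc n)
  then show ?case using a by (auto intro: ideal_prod.prod)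
qed simp

lemma (in cring) ideal_pow_finprod:
  assumes I: "ideal I R" and fin: "finite J" and f: "\<And>l. l \<in> J \<Longrightarrow> f l \<in> ideal_pow R I (w l)"
  shows "(\<Otimes>l\<in>J. f l) \<in> ideal_pow R I (\<Sum>l\<in>J. w l)"
  using fin f
proof (induction rule: finite_induct)
  case (insert l J)
  have c: "f j \<in> carrier R" if "j \<in> insert l J" for j
    using insert.prems[OF that] ideal_subset_carrier[OF ideal_pow_ideal[OF I]] by blast
  then show ?case using insert ideal_pow_mult[OF I] by (simp add: finprod_insert Pi_iff)
qed simp

text \<open>Noetherianity as the maximum condition. Zorn's lemma asks for the union of each chain to
  stay in the family, and in a noetherian ring the union of a nonempty chain of ideals is a member
  of the chain.\<close>

lemma (in noetherian_ring) maximal_ideal_of_family: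
  assumes "F \<noteq> {}" "\<And>J. J \<in> F \<Longrightarrow> ideal J R"
  shows "\<exists>M\<in>F. \<forall>J\<in>F. M \<subseteq> J \<longrightarrow> J = M"
proof (rule subset_Zorn_nonempty[OF assms(1)])
  fix C assume C: "C \<noteq> {}" "subset.chain F C"
  then have "C \<subseteq> F" "subset.chain UNIV C" by (simp_all add: subset.chain_def)
  moreover have "ideal J R" if "J \<in> C" for J
    by (rule assms(2)[OF subsetD[OF \<open>C \<subseteq> F\<close> that]])
  ultimately have "subset.chain {J. ideal J R} C"
    by (simp add: subset.chain_def subset_iff)
  from ideal_chain_is_trivial[OF C(1) this] show "\<Union>C \<in> F"
    using C(2) by (auto simp: subset.chain_def)
qed

section \<open>Monomials\<close>

lemma (in cring) monomial_closed:
  "y \<in> J \<rightarrow> carrier R \<Longrightarrow> monomial R J y \<alpha> \<in> carrier R"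
  unfolding monomial_def by (rule finprod_closed) auto

lemma (in cring) monomial_add:
  assumes "y \<in> J \<rightarrow> carrier R"
  shows "monomial R J y (\<lambda>l. \<alpha> l + \<beta> l) = monomial R J y \<alpha> \<otimes> monomial R J y \<beta>"
proof -
  have "monomial R J y (\<lambda>l. \<alpha> l + \<beta> l) = (\<Otimes>l\<in>J. y l [^] \<alpha> l \<otimes> y l [^] \<beta> l)"
    unfolding monomial_def
    by (rule finprod_cong) (use assms in \<open>auto simp: nat_pow_mult Pi_iff simp_implies_def\<close>)
  also have "\<dots> = monomial R J y \<alpha> \<otimes> monomial R J y \<beta>"
    unfolding monomial_def by (rule finprod_multf) (use assms in auto)
  finally show ?thesis .
qed

lemma (in cring) monomial_zero: "monomial R J y (\<lambda>_. 0) = \<one>"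
  by (simp add: monomial_def)

lemma (in cring) monomial_single:
  assumes "y \<in> J \<rightarrow> carrier R" "finite J" "l \<in> J"
  shows "monomial R J y ((\<lambda>_. 0)(l := s)) = y l [^] s"
proof -
  have "monomial R J y ((\<lambda>_. 0)(l := s)) = (\<Otimes>j\<in>J. if l = j then y j [^] s else \<one>)"
    unfolding monomial_def
    by (rule finprod_cong) (use assms in \<open>auto simp: simp_implies_def\<close>)
  also have "\<dots> = y l [^] s"
    by (rule finprod_singleton[of l J "\<lambda>j. y j [^] s"]) (use assms in auto)
  finally show ?thesis .
qed

lemma (in cring) monomial_in_ideal_pow:
  assumes "ideal I R" "y \<in> {1..d} \<rightarrow> I"
  shows "monomial R {1..d} y \<alpha> \<in> ideal_pow R I (mdeg d \<alpha>)"
  unfolding monomial_def mdeg_def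
  by (rule ideal_pow_finprod)
    (use assms(2) in \<open>auto intro!: assms(1) ideal_pow_nat_pow\<close>)

section \<open>Leading exponents\<close>

text \<open>Otherwise the simplifier turns the index set \<open>{1..d}\<close> into \<open>{Suc 0..d}\<close>, out of reach of the
  rewrite rules stated for the former.\<close>

declare One_nat_def [simp del]

text \<open>The elements whose product with \<open>b\<close> lies in \<open>I\<close> form an ideal,
  so it is enough to test generators.\<close>

lemma (in cring) mem_genideal_mult:
  assumes I: "ideal I R" and S: "S \<subseteq> carrier R" and b: "b \<in> carrier R"
    and gen: "\<And>s. s \<in> S \<Longrightarrow> b \<otimes> s \<in> I" and a: "a \<in> Idl S"
  shows "b \<otimes> a \<in> I"
proof -
  have "S \<subseteq> {a \<in> carrier R. b \<otimes> a \<in> I}" using S gen by auto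
  from genideal_minimal[OF ideal_colon[OF I b] this] a show ?thesis by auto
qed

text \<open>A noetherian local ring with a coefficient field mapping onto the residue field, and
  with generators \<open>x\<close> of the maximal ideal. The relation between \<open>d\<close> and
  the dimension enters later, through the chain of primes in \<open>lead_zero_empty\<close>.\<close>

locale residually_rational_local_ring = cring R for R (structure) +
  fixes m :: "'a set" and \<iota> :: "'k::field \<Rightarrow> 'a" and d :: nat and x :: "nat \<Rightarrow> 'a"
  assumes noetherian: "noetherian_ring R"
    and m_ideal: "ideal m R"
    and one_notin_m: "\<one> \<notin> m"
    and unit_outside_m: "a \<in> carrier R \<Longrightarrow> a \<notin> m \<Longrightarrow> a \<in> Units R"
    and \<iota>_closed [simp]: "\<iota> c \<in> carrier R"
    and \<iota>_add: "\<iota> (c + c') = \<iota> c \<oplus> \<iota> c'"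
    and \<iota>_mult: "\<iota> (c * c') = \<iota> c \<otimes> \<iota> c'"
    and \<iota>_1 [simp]: "\<iota> 1 = \<one>"
    and residue: "a \<in> carrier R \<Longrightarrow> \<exists>c. a \<ominus> \<iota> c \<in> m"
    and x_closed: "x \<in> {1..d} \<rightarrow> carrier R"
    and m_gen: "m = Idl (x ` {1..d})"
begin

abbreviation E where "E \<equiv> exponents {1..d}"
abbreviation Edeg where "Edeg n \<equiv> {\<alpha> \<in> E. mdeg d \<alpha> < n}"
abbreviation xm where "xm \<alpha> \<equiv> monomial R {1..d} x \<alpha>"
abbreviation mpow where "mpow n \<equiv> ideal_pow R m n"
abbreviation above where "above \<alpha> \<equiv> {\<beta> \<in> E. deglex_less d \<alpha> \<beta>}"
text \<open>\<open>V (above \<alpha>)\<close> stands for the terms beyond \<alpha>. As \<alpha>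
  varies, these monomial ideals refine the filtration by powers of \<open>m\<close>.\<close>

definition V where "V S = Idl (xm ` S)"

lemma \<iota>_0 [simp]: "\<iota> 0 = \<zero>"
proof -
  have "\<iota> 0 \<oplus> \<iota> 0 = \<iota> 0 \<oplus> \<zero>" using \<iota>_add[of 0 0] by simp
  then show ?thesis by (metis \<iota>_closed add.l_cancel zero_closed)
qed

lemma \<iota>_minus: "\<iota> (- c) = \<ominus> \<iota> c"
proof -
  have "\<iota> c \<oplus> \<iota> (- c) = \<zero>" using \<iota>_add[of c "- c"] by simp
  then show ?thesis by (metis \<iota>_closed a_comm minus_equality)
qed

lemma mpow_ideal: "ideal (mpow n) R" by (rule ideal_pow_ideal[OF m_ideal])

lemma xm_closed [simp]: "xm \<alpha> \<in> carrier R" by (rule monomial_closed[OF x_closed])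

lemma xm_add: "xm (\<lambda>l. \<alpha> l + \<beta> l) = xm \<alpha> \<otimes> xm \<beta>" by (rule monomial_add[OF x_closed])

lemma x_in_m: "x \<in> {1..d} \<rightarrow> m"
proof -
  have "x ` {1..d} \<subseteq> m" unfolding m_gen by (rule genideal_self) (use x_closed in auto)
  then show ?thesis by auto
qed

lemma xm_in_mpow: "xm \<alpha> \<in> mpow (mdeg d \<alpha>)"
  by (rule monomial_in_ideal_pow[OF m_ideal x_in_m])

lemma xm_single: "l \<in> {1..d} \<Longrightarrow> xm ((\<lambda>_. 0)(l := s)) = x l [^] s"
  by (rule monomial_single[OF x_closed]) auto

lemma single_in_E: "l \<in> {1..d} \<Longrightarrow> (\<lambda>_. 0)(l := s) \<in> E"
  by (simp add: exponents_def)

lemma mdeg_single: "l \<in> {1..d} \<Longrightarrow> mdeg d ((\<lambda>_. 0)(l := s)) = s"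
  by (simp add: mdeg_def)

lemma xm_image_closed: "xm ` S \<subseteq> carrier R" by (rule image_subsetI) (rule xm_closed)

lemma V_ideal: "ideal (V S) R"
  unfolding V_def by (rule genideal_ideal[OF xm_image_closed])

lemma xm_in_V: "\<alpha> \<in> S \<Longrightarrow> xm \<alpha> \<in> V S"
  unfolding V_def using genideal_self[OF xm_image_closed] by blast

lemma V_subset: "ideal I R \<Longrightarrow> (\<And>\<alpha>. \<alpha> \<in> S \<Longrightarrow> xm \<alpha> \<in> I) \<Longrightarrow> V S \<subseteq> I"
  unfolding V_def by (rule genideal_minimal) (assumption, rule image_subsetI)

lemma V_mono: "S \<subseteq> T \<Longrightarrow> V S \<subseteq> V T"
  by (rule V_subset[OF V_ideal]) (rule xm_in_V, erule (1) subsetD)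

text \<open>All monomials of degree at least \<open>n\<close>, and not just those of degree
  \<open>n\<close>, are taken as generators, so that the index set is closed upwards and
  \<open>upset_induct\<close> can start from it.\<close>

lemma mpow_eq_V: "mpow n = V {\<alpha> \<in> E. n \<le> mdeg d \<alpha>}" (is "_ = V (?S n)")
proof
  show "V (?S n) \<subseteq> mpow n"
    by (rule V_subset[OF mpow_ideal])
      (auto intro: subsetD[OF ideal_pow_antimono[OF m_ideal] xm_in_mpow])
  show "mpow n \<subseteq> V (?S n)"
  proof (induction n)
    case 0
    have "(\<lambda>_. 0) \<in> ?S 0" by (simp add: exponents_def)
    then have "\<one> \<in> V (?S 0)" using xm_in_V monomial_zero by metis
    then show ?case using ideal.one_imp_carrier[OF V_ideal] by simp
  next
    case (Suc n)
    \<comment> \<open>Both factors are reduced to generators, by one use of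
      \<open>mem_genideal_mult\<close> for \<open>a\<close> and one for \<open>b\<close>.\<close>
    have step: "b \<otimes> a \<in> V (?S (Suc n))" if a: "a \<in> V (?S n)" and b: "b \<in> m" for a b
      unfolding m_gen
    proof (rule mem_genideal_mult[OF V_ideal xm_image_closed _ _ a[unfolded V_def]])
      show bc: "b \<in> carrier R" using ideal_subset_carrier[OF m_ideal b] .
      fix y assume "y \<in> xm ` ?S n"
      then obtain \<alpha> where \<alpha>: "\<alpha> \<in> ?S n" "y = xm \<alpha>" by blast
      have "xm \<alpha> \<otimes> b \<in> V (?S (Suc n))"
      proof (rule mem_genideal_mult[OF V_ideal _ xm_closed _ b[unfolded m_gen]])
        show "x ` {1..d} \<subseteq> carrier R" using x_closed by auto
        fix y assume "y \<in> x ` {1..d}"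
        then obtain l where l: "l \<in> {1..d}" "y = x l" by blast
        have xl: "x l \<in> carrier R" using x_closed l(1) by (rule funcset_mem)
        have "xm (\<lambda>j. \<alpha> j + ((\<lambda>_. 0)(l := 1)) j) = xm \<alpha> \<otimes> y"
          unfolding xm_add l(2) xm_single[OF l(1), of 1] nat_pow_eone[OF xl] ..
        moreover have "(\<lambda>j. \<alpha> j + ((\<lambda>_. 0)(l := 1)) j) \<in> ?S (Suc n)"
          using \<alpha>(1) exponents_add[OF _ single_in_E[OF l(1)], of \<alpha> 1]
          unfolding mem_Collect_eq mdeg_add mdeg_single[OF l(1)] by auto
        ultimately show "xm \<alpha> \<otimes> y \<in> V (?S (Suc n))" using xm_in_V by metis
      qed
      then show "b \<otimes> y \<in> V (?S (Suc n))" using bc \<alpha>(2) by (simp add: m_comm)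
    qed
    have "b \<in> V (?S (Suc n))" if "b \<in> ideal_prod R (mpow n) m" for b
      using that
    proof (induction b rule: ideal_prod.induct)
      case (prod i j)
      have "i \<otimes> j = j \<otimes> i"
        using prod ideal_subset_carrier[OF m_ideal] ideal_subset_carrier[OF mpow_ideal] by (simp add: m_comm)
      then show ?case using step[of i j] prod Suc.IH by auto
    next
      case (sum s1 s2)
      then show ?case by (intro ideal_add_closed[OF V_ideal])
    qed
    then show ?case by auto
  qed
qed

lemma mpow_subset_above: "mdeg d \<alpha> < n \<Longrightarrow> mpow n \<subseteq> V (above \<alpha>)"
  unfolding mpow_eq_V by (rule V_mono) (auto simp: deglex_less_def)

lemma V_above_mult:
  assumes "\<gamma> \<in> E" "a \<in> V (above \<alpha>)"
  shows "xm \<gamma> \<otimes> a \<in> V (above (\<lambda>l. \<gamma> l + \<alpha> l))"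
proof (rule mem_genideal_mult[OF V_ideal xm_image_closed xm_closed _ assms(2)[unfolded V_def]])
  fix y assume "y \<in> xm ` above \<alpha>"
  then obtain \<beta> where b: "\<beta> \<in> E" "deglex_less d \<alpha> \<beta>" "y = xm \<beta>" by blast
  have "xm (\<lambda>l. \<gamma> l + \<beta> l) \<in> V (above (\<lambda>l. \<gamma> l + \<alpha> l))"
    by (rule xm_in_V) (simp add: exponents_add assms(1) b deglex_less_add)
  then show "xm \<gamma> \<otimes> y \<in> V (above (\<lambda>l. \<gamma> l + \<alpha> l))" unfolding xm_add b(3) .
qed

lemma above_mono: "deglex_less d \<alpha> \<beta> \<Longrightarrow> above \<beta> \<subseteq> above \<alpha>"
  by (auto intro: deglex_less_trans)

text \<open>The elements \<open>r\<close> that admit such a \<open>c\<close> form an ideal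
  containing the generators of \<open>V (insert \<alpha> (above \<alpha>))\<close>. Closure under
  multiplication by \<open>t\<close> is where the residue field enters: \<open>t\<close> differs
  from some \<open>\<iota> c'\<close> by an element of \<open>m\<close>, and \<open>m\<close> times
  \<open>xm \<alpha>\<close> has higher order, hence lies in
  \<open>V (above \<alpha>)\<close>.\<close>

lemma leading_coefficient:
  assumes "\<alpha> \<in> E" "r \<in> V (insert \<alpha> (above \<alpha>))"
  shows "\<exists>c. r \<ominus> \<iota> c \<otimes> xm \<alpha> \<in> V (above \<alpha>)"
proof -
  let ?J = "{r \<in> carrier R. \<exists>c. r \<ominus> \<iota> c \<otimes> xm \<alpha> \<in> V (above \<alpha>)}"
  have mX: "a \<otimes> xm \<alpha> \<in> V (above \<alpha>)" if "a \<in> m" for a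
  proof -
    have "a \<otimes> xm \<alpha> \<in> mpow (Suc 0 + mdeg d \<alpha>)"
      using that ideal_pow_1[OF m_ideal] by (intro ideal_pow_mult[OF m_ideal] xm_in_mpow) simp
    then show ?thesis using mpow_subset_above[of \<alpha> "Suc 0 + mdeg d \<alpha>"] by auto
  qed
  have J: "ideal ?J R"
  proof (rule idealI[OF ring_axioms])
    show "subgroup ?J (add_monoid R)"
    proof (rule add.subgroupI)
      have "\<zero> \<ominus> \<iota> 0 \<otimes> xm \<alpha> \<in> V (above \<alpha>)"
        using ideal_zero_closed[OF V_ideal] by (simp add: a_minus_def)
      then have "\<zero> \<in> ?J" by blast
      then show "?J \<noteq> {}" by blast
    next
      fix a assume "a \<in> ?J"
      then obtain c where a: "a \<in> carrier R" "a \<ominus> \<iota> c \<otimes> xm \<alpha> \<in> V (above \<alpha>)" by blast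
      have "\<ominus> a \<ominus> \<iota> (- c) \<otimes> xm \<alpha> = \<zero> \<ominus> (a \<ominus> \<iota> c \<otimes> xm \<alpha>)"
        using a xm_closed[of \<alpha>] \<iota>_closed[of c] unfolding \<iota>_minus by algebra
      then have "\<ominus> a \<ominus> \<iota> (- c) \<otimes> xm \<alpha> \<in> V (above \<alpha>)"
        using ideal_minus_closed[OF V_ideal ideal_zero_closed[OF V_ideal] a(2)] by simp
      then show "\<ominus> a \<in> ?J" using a by blast
    next
      fix a a' assume "a \<in> ?J" "a' \<in> ?J"
      then obtain c c' where a: "a \<in> carrier R" "a \<ominus> \<iota> c \<otimes> xm \<alpha> \<in> V (above \<alpha>)"
        "a' \<in> carrier R" "a' \<ominus> \<iota> c' \<otimes> xm \<alpha> \<in> V (above \<alpha>)" by blast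
      have "a \<oplus> a' \<ominus> \<iota> (c + c') \<otimes> xm \<alpha> = (a \<ominus> \<iota> c \<otimes> xm \<alpha>) \<oplus> (a' \<ominus> \<iota> c' \<otimes> xm \<alpha>)"
        using a xm_closed[of \<alpha>] \<iota>_closed[of c] \<iota>_closed[of c'] unfolding \<iota>_add by algebra
      then have "a \<oplus> a' \<ominus> \<iota> (c + c') \<otimes> xm \<alpha> \<in> V (above \<alpha>)"
        using ideal_add_closed[OF V_ideal a(2,4)] by simp
      then show "a \<oplus> a' \<in> ?J" using a by blast
    qed auto
    fix a t assume "a \<in> ?J" and t: "t \<in> carrier R"
    then obtain c where a: "a \<in> carrier R" "a \<ominus> \<iota> c \<otimes> xm \<alpha> \<in> V (above \<alpha>)" by blast
    obtain c' where c': "t \<ominus> \<iota> c' \<in> m" using residue[OF t] by blast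
    have "t \<otimes> a \<ominus> \<iota> (c' * c) \<otimes> xm \<alpha>
        = t \<otimes> (a \<ominus> \<iota> c \<otimes> xm \<alpha>) \<oplus> \<iota> c \<otimes> ((t \<ominus> \<iota> c') \<otimes> xm \<alpha>)"
      using a t xm_closed[of \<alpha>] \<iota>_closed[of c] \<iota>_closed[of c'] unfolding \<iota>_mult by algebra
    also have "\<dots> \<in> V (above \<alpha>)"
      by (rule ideal_add_closed[OF V_ideal ideal.I_l_closed[OF V_ideal a(2) t]
            ideal.I_l_closed[OF V_ideal mX[OF c'] \<iota>_closed]])
    finally have "t \<otimes> a \<in> ?J" using a t by blast
    then show "t \<otimes> a \<in> ?J" "a \<otimes> t \<in> ?J" using a t by (simp_all add: m_comm)
  qed
  have "xm \<beta> \<in> ?J" if "\<beta> \<in> insert \<alpha> (above \<alpha>)" for \<beta>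
    using that
  proof
    assume \<beta>: "\<beta> = \<alpha>"
    have "xm \<alpha> \<ominus> \<iota> 1 \<otimes> xm \<alpha> = \<zero>" using xm_closed[of \<alpha>] unfolding \<iota>_1 by algebra
    then show ?thesis unfolding \<beta>
      by (intro CollectI conjI xm_closed exI[of _ 1]) (simp only: ideal_zero_closed[OF V_ideal])
  next
    assume "\<beta> \<in> above \<alpha>"
    moreover have "xm \<beta> \<ominus> \<iota> 0 \<otimes> xm \<alpha> = xm \<beta>"
      using xm_closed[of \<alpha>] xm_closed[of \<beta>] unfolding \<iota>_0 by algebra
    ultimately show ?thesis using xm_in_V[of \<beta> "above \<alpha>"]
      by (intro CollectI conjI xm_closed exI[of _ 0]) simp
  qed
  then have "V (insert \<alpha> (above \<alpha>)) \<subseteq> ?J" by (rule V_subset[OF J])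
  then show ?thesis using assms(2) by blast
qed

text \<open>Downward induction along the order: an up-closed set of exponents that contains all
  exponents of degree at least \<open>n\<close> is reached from the latter set by adding minimal elements.\<close>

lemma upset_induct:
  assumes "S \<subseteq> E" "\<And>\<alpha> \<beta>. \<alpha> \<in> S \<Longrightarrow> \<beta> \<in> E \<Longrightarrow> deglex_less d \<alpha> \<beta> \<Longrightarrow> \<beta> \<in> S"
    and "{\<alpha> \<in> E. n \<le> mdeg d \<alpha>} \<subseteq> S"
    and base: "Q {\<alpha> \<in> E. n \<le> mdeg d \<alpha>}"
    and step: "\<And>\<alpha>. \<alpha> \<in> S \<Longrightarrow> \<alpha> \<in> E \<Longrightarrow> mdeg d \<alpha> < n \<Longrightarrow> Q (above \<alpha>) \<Longrightarrow> Q (insert \<alpha> (above \<alpha>))"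
  shows "Q S"
  using assms(1-3) step
proof (induction "card (S \<inter> Edeg n)" arbitrary: S rule: less_induct)
  case less
  have fin: "finite (S \<inter> Edeg n)" using finite_mdeg_less by (rule finite_Int[OF disjI2])
  show ?case
  proof (cases "S \<inter> Edeg n = {}")
    case True
    have "\<alpha> \<in> {\<alpha> \<in> E. n \<le> mdeg d \<alpha>}" if "\<alpha> \<in> S" for \<alpha>
      using that True less.prems(1) by (cases "mdeg d \<alpha> < n") auto
    then have "S = {\<alpha> \<in> E. n \<le> mdeg d \<alpha>}" using less.prems(3) by blast
    then show ?thesis using base by simp
  next
    case False
    then obtain \<alpha> where \<alpha>: "\<alpha> \<in> S \<inter> Edeg n" "\<forall>\<beta>\<in>S \<inter> Edeg n. \<beta> \<noteq> \<alpha> \<longrightarrow> deglex_less d \<alpha> \<beta>"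
      using deglex_min_exists[OF fin False] by auto
    have min: "deglex_less d \<alpha> \<beta>" if "\<beta> \<in> S" "\<beta> \<noteq> \<alpha>" for \<beta>
    proof (cases "mdeg d \<beta> < n")
      case True
      then show ?thesis using \<alpha>(2) that less.prems(1) by auto
    next
      case False
      then show ?thesis using \<alpha>(1) by (auto simp: deglex_less_def)
    qed
    \<comment> \<open>The order is total, so an upward closed set with least element \<alpha>
      consists of \<alpha> and everything above it.\<close>
    have S: "S = insert \<alpha> (above \<alpha>)"
    proof (intro equalityI subsetI)
      fix \<beta> assume "\<beta> \<in> S"
      then show "\<beta> \<in> insert \<alpha> (above \<alpha>)"
        using min[of \<beta>] subsetD[OF less.prems(1), of \<beta>] by blast
    next
      fix \<beta> assume "\<beta> \<in> insert \<alpha> (above \<alpha>)"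
      then show "\<beta> \<in> S" using less.prems(2)[of \<alpha> \<beta>] \<alpha>(1) by blast
    qed
    have "\<alpha> \<in> S \<inter> Edeg n" "\<alpha> \<notin> above \<alpha> \<inter> Edeg n" "above \<alpha> \<inter> Edeg n \<subseteq> S \<inter> Edeg n"
      using \<alpha>(1) deglex_less_irrefl by (auto simp only: S)
    then have card: "card (above \<alpha> \<inter> Edeg n) < card (S \<inter> Edeg n)"
      by (intro psubset_card_mono[OF fin]) blast
    have Q: "Q (above \<alpha>)"
    proof (rule less.hyps[OF card])
      show "above \<alpha> \<subseteq> E" by (rule Collect_subset)
      show "\<gamma> \<in> above \<alpha>" if "\<beta> \<in> above \<alpha>" "\<gamma> \<in> E" "deglex_less d \<beta> \<gamma>" for \<beta> \<gamma>
        using that deglex_less_trans[of d \<alpha> \<beta> \<gamma>] by blast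
      show "{\<alpha> \<in> E. n \<le> mdeg d \<alpha>} \<subseteq> above \<alpha>"
        using \<alpha>(1) by (auto simp: deglex_less_def)
      show "Q (insert \<beta> (above \<beta>))"
        if "\<beta> \<in> above \<alpha>" "\<beta> \<in> E" "mdeg d \<beta> < n" "Q (above \<beta>)" for \<beta>
        using that by (intro less.prems(4)) (simp_all add: S)
    qed
    have "\<alpha> \<in> S" "\<alpha> \<in> E" "mdeg d \<alpha> < n" using \<alpha>(1) by auto
    from less.prems(4)[OF this Q] show ?thesis by (simp only: S)
  qed
qed

text \<open>As the monomials are not yet known to be independent, an element of \<open>I\<close>
  need not have a unique leading exponent. In particular an exponent \<alpha> is in
  \<open>lead {\<zero>}\<close> exactly when \<open>xm \<alpha>\<close> lies in
  \<open>V (above \<alpha>)\<close>, so \<open>lead {\<zero>}\<close> records the relations among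
  the monomials.\<close>

definition lead where
  "lead I = {\<alpha> \<in> E. \<exists>r\<in>I. r \<ominus> xm \<alpha> \<in> V (above \<alpha>)}"

lemma lead_mono: "I \<subseteq> J \<Longrightarrow> lead I \<subseteq> lead J"
  unfolding lead_def by blast

lemma lead_add:
  assumes "ideal I R" "\<alpha> \<in> lead I" "\<gamma> \<in> E"
  shows "(\<lambda>l. \<gamma> l + \<alpha> l) \<in> lead I"
proof -
  obtain r where r: "\<alpha> \<in> E" "r \<in> I" "r \<ominus> xm \<alpha> \<in> V (above \<alpha>)"
    using assms(2) unfolding lead_def by blast
  have rc: "r \<in> carrier R" using ideal_subset_carrier[OF assms(1) r(2)] .
  have "xm \<gamma> \<otimes> (r \<ominus> xm \<alpha>) = xm \<gamma> \<otimes> r \<ominus> xm (\<lambda>l. \<gamma> l + \<alpha> l)"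
    using rc xm_closed[of \<alpha>] xm_closed[of \<gamma>] unfolding xm_add by algebra
  then have "xm \<gamma> \<otimes> r \<ominus> xm (\<lambda>l. \<gamma> l + \<alpha> l) \<in> V (above (\<lambda>l. \<gamma> l + \<alpha> l))"
    using V_above_mult[OF assms(3) r(3)] by simp
  moreover have "xm \<gamma> \<otimes> r \<in> I" by (rule ideal.I_l_closed[OF assms(1) r(2) xm_closed])
  ultimately show ?thesis using exponents_add[OF assms(3) r(1)] unfolding lead_def by blast
qed

lemma lead_upward:
  assumes "ideal I R" "\<alpha> \<in> lead I" "\<beta> \<in> E" "\<alpha> \<le> \<beta>"
  shows "\<beta> \<in> lead I"
proof -
  have "(\<lambda>l. \<beta> l - \<alpha> l) \<in> E" using assms(3) by (simp add: exponents_def)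
  from lead_add[OF assms(1,2) this] show ?thesis
    using le_funD[OF assms(4)] by (simp add: le_add_diff_inverse2)
qed

lemma V_above_\<iota>:
  assumes "r \<in> V S" shows "\<iota> c \<otimes> r \<in> V S"
  using ideal.I_l_closed[OF V_ideal assms \<iota>_closed] .

text \<open>Division with remainder by elements of \<open>I\<close>, up to order \<open>n\<close>.\<close>

lemma span_modulo:
  assumes I: "ideal I R"
    and G: "\<And>\<alpha>. \<alpha> \<in> E \<Longrightarrow> G \<alpha> \<in> carrier R" "\<And>\<alpha>. \<alpha> \<in> E \<Longrightarrow> G \<alpha> \<ominus> xm \<alpha> \<in> V (above \<alpha>)"
    and r: "r \<in> carrier R"
  shows "\<exists>c. r \<ominus> (\<Oplus>\<alpha>\<in>Edeg n - lead I. \<iota> (c \<alpha>) \<otimes> G \<alpha>) \<in> I <+>\<^bsub>R\<^esub> mpow n"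
proof -
  \<comment> \<open>Generalised from all exponents to a set \<open>S\<close> for the sake of
    \<open>upset_induct\<close>; the remainder may use exponents of \<open>S\<close> only.\<close>
  define Q where "Q S \<longleftrightarrow> (\<forall>r\<in>V S. \<exists>c.
    r \<ominus> (\<Oplus>\<alpha>\<in>(S \<inter> Edeg n) - lead I. \<iota> (c \<alpha>) \<otimes> G \<alpha>) \<in> I <+>\<^bsub>R\<^esub> mpow n)" for S
  have In: "ideal (I <+>\<^bsub>R\<^esub> mpow n) R" by (rule add_ideals[OF I mpow_ideal])
  have sumc: "(\<Oplus>\<alpha>\<in>(S \<inter> Edeg n) - lead I. \<iota> (c \<alpha>) \<otimes> G \<alpha>) \<in> carrier R" for S c
    by (rule finsum_closed) (use G(1) in auto)
  have "Q E"
  proof (rule upset_induct[where n = n])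
    have "{\<alpha> \<in> E. n \<le> mdeg d \<alpha>} \<inter> Edeg n = {}" by auto
    then show "Q {\<alpha> \<in> E. n \<le> mdeg d \<alpha>}"
      unfolding Q_def mpow_eq_V[symmetric]
      using ideal_subset_carrier[OF mpow_ideal] mem_set_add_right[OF I mpow_ideal]
      by (auto simp: a_minus_def)
  next
    fix \<alpha> assume \<alpha>: "\<alpha> \<in> E" "mdeg d \<alpha> < n" and IH: "Q (above \<alpha>)"
    let ?A = "(above \<alpha> \<inter> Edeg n) - lead I"
    have Gc: "G \<alpha> \<in> carrier R" by (rule G(1)[OF \<alpha>(1)])
    show "Q (insert \<alpha> (above \<alpha>))"
      unfolding Q_def
    proof
      fix r assume r: "r \<in> V (insert \<alpha> (above \<alpha>))"
      have rc: "r \<in> carrier R" using ideal_subset_carrier[OF V_ideal r] .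
      obtain c where c: "r \<ominus> \<iota> c \<otimes> xm \<alpha> \<in> V (above \<alpha>)"
        using leading_coefficient[OF \<alpha>(1) r] by blast
      show "\<exists>c. r \<ominus> (\<Oplus>\<alpha>\<in>(insert \<alpha> (above \<alpha>) \<inter> Edeg n) - lead I. \<iota> (c \<alpha>) \<otimes> G \<alpha>) \<in> I <+>\<^bsub>R\<^esub> mpow n"
      \<comment> \<open>The term of \<open>r\<close> at \<alpha> is cancelled by an element of
        \<open>I\<close> if \<alpha> is in \<open>lead I\<close>, leaving no trace in the remainder,
        and by a multiple of \<open>G \<alpha>\<close> otherwise.\<close>
      proof (cases "\<alpha> \<in> lead I")
        case True
        then obtain i where i: "i \<in> I" "i \<ominus> xm \<alpha> \<in> V (above \<alpha>)" unfolding lead_def by blast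
        have ic: "i \<in> carrier R" using ideal_subset_carrier[OF I i(1)] .
        have "r \<ominus> \<iota> c \<otimes> i = (r \<ominus> \<iota> c \<otimes> xm \<alpha>) \<ominus> \<iota> c \<otimes> (i \<ominus> xm \<alpha>)"
          using rc ic xm_closed[of \<alpha>] \<iota>_closed[of c] by algebra
        then have "r \<ominus> \<iota> c \<otimes> i \<in> V (above \<alpha>)"
          using ideal_minus_closed[OF V_ideal c V_above_\<iota>[OF i(2), of c]] by simp
        then obtain c' where c': "r \<ominus> \<iota> c \<otimes> i \<ominus> (\<Oplus>\<alpha>\<in>?A. \<iota> (c' \<alpha>) \<otimes> G \<alpha>) \<in> I <+>\<^bsub>R\<^esub> mpow n"
          using IH unfolding Q_def by blast
        have eq: "(insert \<alpha> (above \<alpha>) \<inter> Edeg n) - lead I = ?A" using True by auto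
        have "\<iota> c \<otimes> i \<in> I <+>\<^bsub>R\<^esub> mpow n"
          by (rule mem_set_add_left[OF I mpow_ideal ideal.I_l_closed[OF I i(1) \<iota>_closed]])
        from ideal_add_closed[OF In c' this]
        have "r \<ominus> \<iota> c \<otimes> i \<ominus> (\<Oplus>\<alpha>\<in>?A. \<iota> (c' \<alpha>) \<otimes> G \<alpha>) \<oplus> \<iota> c \<otimes> i \<in> I <+>\<^bsub>R\<^esub> mpow n" .
        moreover have "r \<ominus> \<iota> c \<otimes> i \<ominus> s \<oplus> \<iota> c \<otimes> i = r \<ominus> s" if "s \<in> carrier R" for s
          using rc ic \<iota>_closed[of c] that by algebra
        note this[OF sumc[of c' "above \<alpha>"]]
        ultimately show ?thesis unfolding eq by auto
      next
        case False
        have "r \<ominus> \<iota> c \<otimes> G \<alpha> = (r \<ominus> \<iota> c \<otimes> xm \<alpha>) \<ominus> \<iota> c \<otimes> (G \<alpha> \<ominus> xm \<alpha>)"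
          using rc Gc xm_closed[of \<alpha>] \<iota>_closed[of c] by algebra
        then have "r \<ominus> \<iota> c \<otimes> G \<alpha> \<in> V (above \<alpha>)"
          using ideal_minus_closed[OF V_ideal c V_above_\<iota>[OF G(2)[OF \<alpha>(1)], of c]] by simp
        then obtain c' where c': "r \<ominus> \<iota> c \<otimes> G \<alpha> \<ominus> (\<Oplus>\<alpha>\<in>?A. \<iota> (c' \<alpha>) \<otimes> G \<alpha>) \<in> I <+>\<^bsub>R\<^esub> mpow n"
          using IH unfolding Q_def by blast
        define c'' where "c'' = c'(\<alpha> := c)"
        have \<alpha>A: "\<alpha> \<notin> ?A" using deglex_less_irrefl by auto
        have eq: "(insert \<alpha> (above \<alpha>) \<inter> Edeg n) - lead I = insert \<alpha> ?A" using False \<alpha> by auto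
        have fin: "finite ?A" using finite_mdeg_less by (intro finite_Diff finite_Int) auto
        have "(\<Oplus>\<alpha>\<in>?A. \<iota> (c'' \<alpha>) \<otimes> G \<alpha>) = (\<Oplus>\<alpha>\<in>?A. \<iota> (c' \<alpha>) \<otimes> G \<alpha>)"
          by (rule finsum_cong') (use \<alpha>A G(1) in \<open>auto simp: c''_def\<close>)
        then have "(\<Oplus>\<alpha>\<in>insert \<alpha> ?A. \<iota> (c'' \<alpha>) \<otimes> G \<alpha>)
            = \<iota> c \<otimes> G \<alpha> \<oplus> (\<Oplus>\<alpha>\<in>?A. \<iota> (c' \<alpha>) \<otimes> G \<alpha>)"
          using finsum_insert[OF fin \<alpha>A, of "\<lambda>\<alpha>. \<iota> (c'' \<alpha>) \<otimes> G \<alpha>"] G(1) \<alpha>(1)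
          by (auto simp: c''_def)
        moreover have "r \<ominus> (\<iota> c \<otimes> G \<alpha> \<oplus> s) = r \<ominus> \<iota> c \<otimes> G \<alpha> \<ominus> s" if "s \<in> carrier R" for s
          using rc Gc \<iota>_closed[of c] that by algebra
        note this[OF sumc[of c' "above \<alpha>"]]
        ultimately show ?thesis using c' unfolding eq by (intro exI[of _ c'']) (simp only:)
      qed
    qed
  qed auto
  moreover have "r \<in> V E"
    using r mpow_eq_V[of 0] by simp
  moreover have "E \<inter> Edeg n = Edeg n" by auto
  ultimately show ?thesis unfolding Q_def by auto
qed

text \<open>Take the least \<alpha> with nonzero coefficient. The other terms and
  \<open>mpow n\<close> lie in \<open>V (above \<alpha>)\<close>, so after division by
  \<open>c \<alpha>\<close> the component of the sum in \<open>I\<close> has leading exponent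
  \<alpha>, which the index set excludes. \<open>G\<close> is a parameter because the lemma serves
  both the monomials in \<open>x\<close> and the mixed products of \<open>h\<close> and
  \<open>x\<close>.\<close>

lemma independent_modulo:
  assumes I: "ideal I R"
    and G: "\<And>\<alpha>. \<alpha> \<in> E \<Longrightarrow> G \<alpha> \<in> carrier R" "\<And>\<alpha>. \<alpha> \<in> E \<Longrightarrow> G \<alpha> \<ominus> xm \<alpha> \<in> V (above \<alpha>)"
    and sum: "(\<Oplus>\<alpha>\<in>Edeg n - lead I. \<iota> (c \<alpha>) \<otimes> G \<alpha>) \<in> I <+>\<^bsub>R\<^esub> mpow n"
    and \<beta>: "\<beta> \<in> Edeg n - lead I"
  shows "c \<beta> = 0"
proof (rule ccontr)
  let ?A = "Edeg n - lead I"
  assume nz: "c \<beta> \<noteq> 0"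
  have finA: "finite ?A" using finite_mdeg_less by (rule finite_Diff)
  have "finite {\<alpha> \<in> ?A. c \<alpha> \<noteq> 0}" "{\<alpha> \<in> ?A. c \<alpha> \<noteq> 0} \<noteq> {}" "{\<alpha> \<in> ?A. c \<alpha> \<noteq> 0} \<subseteq> E"
    using finite_subset[OF _ finA, of "{\<alpha> \<in> ?A. c \<alpha> \<noteq> 0}"] nz \<beta> by blast+
  from deglex_min_exists[OF this] obtain \<alpha> where \<alpha>: "\<alpha> \<in> {\<alpha> \<in> ?A. c \<alpha> \<noteq> 0}"
    "\<forall>\<beta>\<in>{\<alpha> \<in> ?A. c \<alpha> \<noteq> 0}. \<beta> \<noteq> \<alpha> \<longrightarrow> deglex_less d \<alpha> \<beta>" by (rule bexE)
  have \<alpha>E: "\<alpha> \<in> E" "mdeg d \<alpha> < n" "c \<alpha> \<noteq> 0" "\<alpha> \<notin> lead I" "\<alpha> \<in> ?A" using \<alpha>(1) by auto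
  define t where "t = (\<Oplus>\<gamma>\<in>?A - {\<alpha>}. \<iota> (c \<gamma>) \<otimes> G \<gamma>)"
  have t: "t \<in> V (above \<alpha>)"
    unfolding t_def
  proof (rule ideal_finsum_closed[OF V_ideal])
    fix \<gamma> assume \<gamma>: "\<gamma> \<in> ?A - {\<alpha>}"
    then have \<gamma>E: "\<gamma> \<in> E" by auto
    show "\<iota> (c \<gamma>) \<otimes> G \<gamma> \<in> V (above \<alpha>)"
    proof (cases "c \<gamma> = 0")
      case True
      then show ?thesis using ideal_zero_closed[OF V_ideal] G(1)[OF \<gamma>E] by simp
    next
      case False
      then have less: "deglex_less d \<alpha> \<gamma>" using \<alpha>(2) \<gamma> by auto
      have "G \<gamma> \<ominus> xm \<gamma> \<in> V (above \<alpha>)" using G(2)[OF \<gamma>E] V_mono[OF above_mono[OF less]] by (rule subsetD[rotated])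
      moreover have "xm \<gamma> \<in> V (above \<alpha>)" by (rule xm_in_V) (simp add: \<gamma>E less)
      ultimately have "G \<gamma> \<in> V (above \<alpha>)" by (rule ideal_of_diff[OF V_ideal _ _ G(1)[OF \<gamma>E]])
      then show ?thesis by (rule V_above_\<iota>)
    qed
  qed
  have tc: "t \<in> carrier R" using ideal_subset_carrier[OF V_ideal t] .
  have Gc: "G \<alpha> \<in> carrier R" by (rule G(1)[OF \<alpha>E(1)])
  have split: "(\<Oplus>\<alpha>\<in>?A. \<iota> (c \<alpha>) \<otimes> G \<alpha>) = \<iota> (c \<alpha>) \<otimes> G \<alpha> \<oplus> t"
    using finsum_insert[of "?A - {\<alpha>}" \<alpha> "\<lambda>\<alpha>. \<iota> (c \<alpha>) \<otimes> G \<alpha>"] finA G(1) \<alpha>E(1,5)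
    unfolding t_def by (auto simp: insert_absorb)
  obtain i p where ip: "i \<in> I" "p \<in> mpow n" "\<iota> (c \<alpha>) \<otimes> G \<alpha> \<oplus> t = i \<oplus> p"
    using sum unfolding split mem_set_add by blast
  have ic: "i \<in> carrier R" and pc: "p \<in> carrier R"
    using ideal_subset_carrier[OF I ip(1)] ideal_subset_carrier[OF mpow_ideal ip(2)] .
  have pV: "p \<in> V (above \<alpha>)" using mpow_subset_above[OF \<alpha>E(2)] ip(2) by (rule subsetD)
  define e where "e = \<iota> (inverse (c \<alpha>))"
  have e: "e \<in> carrier R" "e \<otimes> \<iota> (c \<alpha>) = \<one>"
    using \<alpha>E(3) unfolding e_def \<iota>_mult[symmetric] by simp_all
  have i_eq: "i = \<iota> (c \<alpha>) \<otimes> G \<alpha> \<oplus> t \<ominus> p" unfolding ip(3) using ic pc by algebra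
  have "e \<otimes> i = (e \<otimes> \<iota> (c \<alpha>)) \<otimes> G \<alpha> \<oplus> e \<otimes> (t \<ominus> p)"
    unfolding i_eq using e(1) Gc tc pc \<iota>_closed[of "c \<alpha>"] by algebra
  then have "e \<otimes> i \<ominus> xm \<alpha> = (G \<alpha> \<ominus> xm \<alpha>) \<oplus> e \<otimes> (t \<ominus> p)"
    unfolding e(2) using e(1) Gc tc pc xm_closed[of \<alpha>] by algebra
  also have "\<dots> \<in> V (above \<alpha>)"
    by (intro ideal_add_closed[OF V_ideal] G(2) \<alpha>E(1) ideal.I_l_closed[OF V_ideal] e(1)
        ideal_minus_closed[OF V_ideal] t pV)
  finally have "\<alpha> \<in> lead I"
    unfolding lead_def using \<alpha>E(1) ideal.I_l_closed[OF I ip(1) e(1)] by blast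
  then show False using \<alpha>E(4) by simp
qed

end

section \<open>The Artin--Rees lemma\<close>

context residually_rational_local_ring
begin

section \<open>Krull's intersection theorem\<close>

lemma proper_ideal_subset_m:
  assumes "ideal I R" "\<one> \<notin> I" shows "I \<subseteq> m"
proof
  fix a assume a: "a \<in> I"
  have ac: "a \<in> carrier R" by (rule ideal_subset_carrier[OF assms(1) a])
  show "a \<in> m"
  proof (rule ccontr)
    assume "a \<notin> m"
    then have u: "a \<in> Units R" by (rule unit_outside_m[OF ac])
    have "inv a \<otimes> a \<in> I" by (rule ideal.I_l_closed[OF assms(1) a Units_inv_closed[OF u]])
    then show False using Units_l_inv[OF u] assms(2) by simp
  qed
qed

text \<open>If \<open>r\<close> is not in \<open>K\<close>, choose \<open>L\<close> maximal among
  the ideals that contain \<open>K\<close> and all \<open>a \<otimes> r\<close> with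
  \<open>a\<close> in \<open>m\<close>, but not \<open>r\<close>. Maximality makes every element of
  \<open>m\<close> nilpotent modulo \<open>L\<close>, so \<open>L\<close> contains a power of
  \<open>m\<close>. As \<open>r\<close> is in \<open>K\<close> plus that power, it is in
  \<open>L\<close> after all.\<close>

lemma krull_intersection:
  assumes K: "ideal K R" and rc: "r \<in> carrier R" and r: "\<And>n. r \<in> K <+>\<^bsub>R\<^esub> mpow n"
  shows "r \<in> K"
proof (rule ccontr)
  assume rK: "r \<notin> K"
  define F where "F = {L. ideal L R \<and> K \<subseteq> L \<and> (\<forall>a\<in>m. a \<otimes> r \<in> L) \<and> r \<notin> L}"
  let ?mr = "ideal_prod R m (PIdl r)"
  have Pr: "ideal (PIdl r) R" by (rule cgenideal_ideal[OF rc])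
  have mr: "ideal ?mr R" by (rule ideal_prod_is_ideal[OF m_ideal Pr])
  have mr_elem: "\<exists>a\<in>m. b = a \<otimes> r" if "b \<in> ?mr" for b
    using that
  proof (induction b rule: ideal_prod.induct)
    case (prod i j)
    then obtain t where t: "t \<in> carrier R" "j = t \<otimes> r" unfolding cgenideal_def by blast
    have "i \<otimes> j = (i \<otimes> t) \<otimes> r" unfolding t(2) using t rc ideal_subset_carrier[OF m_ideal prod(1)] by algebra
    then show ?case using ideal.I_r_closed[OF m_ideal prod(1) t(1)] by blast
  next
    case (sum b b')
    then obtain a a' where a: "a \<in> m" "b = a \<otimes> r" "a' \<in> m" "b' = a' \<otimes> r" by blast
    have "b \<oplus> b' = (a \<oplus> a') \<otimes> r"
      unfolding a using ideal_subset_carrier[OF m_ideal a(1)] ideal_subset_carrier[OF m_ideal a(3)] rc by algebra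
    then show ?case using ideal_add_closed[OF m_ideal a(1,3)] by blast
  qed
  have "K <+>\<^bsub>R\<^esub> ?mr \<in> F"
    unfolding F_def
  proof (intro CollectI conjI ballI)
    show "ideal (K <+>\<^bsub>R\<^esub> ?mr) R" by (rule add_ideals[OF K mr])
    show "K \<subseteq> K <+>\<^bsub>R\<^esub> ?mr" using mem_set_add_left[OF K mr] by (rule subsetI)
    show "a \<otimes> r \<in> K <+>\<^bsub>R\<^esub> ?mr" if "a \<in> m" for a
      by (rule mem_set_add_right[OF K mr]) (rule ideal_prod.prod[OF that cgenideal_self[OF rc]])
    \<comment> \<open>Nakayama's argument: \<open>r = k \<oplus> a \<otimes> r\<close> with
      \<open>a\<close> in \<open>m\<close> puts \<open>(\<one> \<ominus> a) \<otimes> r\<close> into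
      \<open>K\<close>, and \<open>\<one> \<ominus> a\<close> is a unit.\<close>
    show "r \<notin> K <+>\<^bsub>R\<^esub> ?mr"
    proof
      assume "r \<in> K <+>\<^bsub>R\<^esub> ?mr"
      then obtain k b where kb: "k \<in> K" "b \<in> ?mr" "r = k \<oplus> b"
        unfolding mem_set_add by (elim bexE)
      from mr_elem[OF kb(2)] obtain a where a: "a \<in> m" "b = a \<otimes> r" by (rule bexE)
      note ka = kb(1) a(1) kb(3)[unfolded a(2)]
      have kc: "k \<in> carrier R" and ac: "a \<in> carrier R"
        using ideal_subset_carrier[OF K ka(1)] ideal_subset_carrier[OF m_ideal ka(2)] .
      have "\<one> \<ominus> a \<notin> m"
        using ideal_of_diff[OF m_ideal _ ka(2) one_closed] one_notin_m by blast
      then have u: "\<one> \<ominus> a \<in> Units R" using ac by (intro unit_outside_m) auto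
      have "(\<one> \<ominus> a) \<otimes> r = (k \<oplus> a \<otimes> r) \<ominus> a \<otimes> r"
        unfolding ka(3)[symmetric] using ac rc by algebra
      also have "\<dots> = k" using kc ac rc by algebra
      finally have "(\<one> \<ominus> a) \<otimes> r \<in> K" using ka(1) by simp
      then have "inv (\<one> \<ominus> a) \<otimes> ((\<one> \<ominus> a) \<otimes> r) \<in> K"
        by (rule ideal.I_l_closed[OF K _ Units_inv_closed[OF u]])
      also have "inv (\<one> \<ominus> a) \<otimes> ((\<one> \<ominus> a) \<otimes> r) = r"
        using u rc Units_closed[OF u] Units_inv_closed[OF u] by (simp add: m_assoc[symmetric])
      finally show False using rK by simp
    qed
  qed
  then have "F \<noteq> {}" by blast
  moreover have "ideal I R" if "I \<in> F" for I using that by (simp add: F_def)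
  ultimately have "\<exists>L\<in>F. \<forall>I\<in>F. L \<subseteq> I \<longrightarrow> I = L"
    by (rule noetherian_ring.maximal_ideal_of_family[OF noetherian])
  then obtain L where LF: "L \<in> F" and max: "\<forall>I\<in>F. L \<subseteq> I \<longrightarrow> I = L" by (rule bexE)
  have L: "ideal L R" "K \<subseteq> L" "\<And>a. a \<in> m \<Longrightarrow> a \<otimes> r \<in> L" "r \<notin> L"
    using LF by (simp_all add: F_def)
  have nilpotent: "\<exists>s::nat. y [^] s \<in> L" if ym: "y \<in> m" for y
  proof -
    have yc: "y \<in> carrier R" by (rule ideal_subset_carrier[OF m_ideal ym])
    define C where "C s = {t \<in> carrier R. y [^] (s::nat) \<otimes> t \<in> L}" for s
    have Cid: "ideal (C s) R" for s
      unfolding C_def by (rule ideal_colon[OF L(1)]) (simp add: yc)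
    have Cmono: "C s \<subseteq> C (Suc s)" for s
    proof
      fix t assume t: "t \<in> C s"
      then have tc: "t \<in> carrier R" "y [^] s \<otimes> t \<in> L" unfolding C_def by auto
      have pc: "y [^] s \<in> carrier R" using yc by simp
      have "y [^] Suc s \<otimes> t = y \<otimes> (y [^] s \<otimes> t)"
        unfolding nat_pow_Suc using tc pc yc by algebra
      then show "t \<in> C (Suc s)" using ideal.I_l_closed[OF L(1) tc(2) yc] tc(1) unfolding C_def by simp
    qed
    have "range C \<noteq> {}" by blast
    moreover have "ideal I R" if "I \<in> range C" for I using that Cid by (elim rangeE) simp
    ultimately have "\<exists>M\<in>range C. \<forall>I\<in>range C. M \<subseteq> I \<longrightarrow> I = M"
      by (rule noetherian_ring.maximal_ideal_of_family[OF noetherian])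
    then obtain M where M: "M \<in> range C" "\<forall>I\<in>range C. M \<subseteq> I \<longrightarrow> I = M" by (rule bexE)
    from M(1) obtain s where s: "M = C s" by (rule rangeE)
    have Ceq: "C (Suc s) = C s"
      using bspec[OF M(2) rangeI[of C "Suc s"]] Cmono[of s] unfolding s by (rule mp)
    have pc: "y [^] s \<in> carrier R" using yc by simp
    \<comment> \<open>Otherwise maximality of \<open>L\<close> gives
      \<open>r = l \<oplus> t \<otimes> y [^] s\<close> with \<open>l\<close> in \<open>L\<close>.
      Multiplying by \<open>y\<close> shows that \<open>t\<close> is in \<open>C (Suc s)\<close>,
      which equals \<open>C s\<close>, so \<open>t \<otimes> y [^] s\<close> and with it
      \<open>r\<close> would be in \<open>L\<close>.\<close>
    have "y [^] s \<in> L"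
    proof (rule ccontr)
      assume yL: "y [^] s \<notin> L"
      let ?L' = "L <+>\<^bsub>R\<^esub> PIdl (y [^] s)"
      note Pi = cgenideal_ideal[OF pc]
      have L': "ideal ?L' R" by (rule add_ideals[OF L(1) Pi])
      have LL': "L \<subseteq> ?L'" using mem_set_add_left[OF L(1) Pi] by (rule subsetI)
      have "y [^] s \<in> ?L'" by (rule mem_set_add_right[OF L(1) Pi cgenideal_self[OF pc]])
      then have "?L' \<notin> F" using max LL' yL by blast
      moreover have "K \<subseteq> ?L'" by (rule subset_trans[OF L(2) LL'])
      moreover have "\<forall>a\<in>m. a \<otimes> r \<in> ?L'" using L(3) LL' by blast
      ultimately have "r \<in> ?L'" using L' unfolding F_def by blast
      then obtain l t where lt: "l \<in> L" "t \<in> carrier R" "r = l \<oplus> t \<otimes> y [^] s"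
        unfolding mem_sum_cgenideal[OF L(1) pc] by blast
      have lc: "l \<in> carrier R" by (rule ideal_subset_carrier[OF L(1) lt(1)])
      have "y [^] Suc s \<otimes> t = y \<otimes> (l \<oplus> t \<otimes> y [^] s) \<ominus> y \<otimes> l"
        unfolding nat_pow_Suc using yc pc lt(2) lc by algebra
      also have "\<dots> = y \<otimes> r \<ominus> y \<otimes> l" using lt(3) by simp
      also have "\<dots> \<in> L"
        by (rule ideal_minus_closed[OF L(1) L(3)[OF ym] ideal.I_l_closed[OF L(1) lt(1) yc]])
      finally have "t \<in> C (Suc s)" using lt(2) unfolding C_def by simp
      then have "y [^] s \<otimes> t \<in> L" unfolding Ceq unfolding C_def by simp
      then have "t \<otimes> y [^] s \<in> L" using m_comm[OF pc lt(2)] by simp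
      then have "r \<in> L" unfolding lt(3) by (rule ideal_add_closed[OF L(1) lt(1)])
      then show False using L(4) by simp
    qed
    then show ?thesis by blast
  qed
  have "\<forall>l\<in>{1..d}. \<exists>s::nat. x l [^] s \<in> L" using nilpotent x_in_m by (auto simp: Pi_iff)
  from bchoice[OF this] obtain s :: "nat \<Rightarrow> nat" where s: "\<forall>l\<in>{1..d}. x l [^] s l \<in> L" by (rule exE)
  \<comment> \<open>A monomial of degree above the sum of the \<open>s l\<close> has some exponent
    at least \<open>s l\<close>, hence a factor \<open>x l [^] s l\<close> in
    \<open>L\<close>.\<close>
  define n where "n = Suc (\<Sum>l\<in>{1..d}. s l)"
  have "mpow n \<subseteq> L"
    unfolding mpow_eq_V
  proof (rule V_subset[OF L(1)])
    fix \<alpha> assume \<alpha>: "\<alpha> \<in> {\<alpha> \<in> E. n \<le> mdeg d \<alpha>}"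
    have "\<exists>l\<in>{1..d}. s l \<le> \<alpha> l"
    proof (rule ccontr)
      assume "\<not> ?thesis"
      then have "mdeg d \<alpha> \<le> (\<Sum>l\<in>{1..d}. s l)" unfolding mdeg_def by (intro sum_mono) (simp add: not_le less_imp_le)
      then show False using \<alpha> by (simp add: n_def)
    qed
    then obtain l where l: "l \<in> {1..d}" "s l \<le> \<alpha> l" by (rule bexE)
    have "\<alpha> = (\<lambda>j. (\<alpha>(l := \<alpha> l - s l)) j + ((\<lambda>_. 0)(l := s l)) j)"
      using l(2) by (auto simp: fun_eq_iff)
    then have "xm \<alpha> = xm (\<alpha>(l := \<alpha> l - s l)) \<otimes> x l [^] s l"
      using xm_add xm_single[OF l(1)] by metis
    then show "xm \<alpha> \<in> L" using ideal.I_l_closed[OF L(1) bspec[OF s l(1)] xm_closed] by simp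
  qed
  then have "r \<in> L"
    using r[of n] L(2) ideal_add_closed[OF L(1)] unfolding mem_set_add by blast
  then show False using L(4) by simp
qed

text \<open>A standard basis of \<open>J\<close> exists by Dickson's lemma, and division by it
  expresses elements of \<open>J\<close> of high order, up to terms of even higher order.\<close>

lemma artin_rees:
  assumes J: "ideal J R"
  shows "\<exists>c. \<forall>n. J \<inter> mpow n \<subseteq> ideal_prod R (mpow (n - c)) J"
proof -
  have "lead J \<subseteq> E" unfolding lead_def by (rule Collect_subset[THEN subset_trans]) blast
  from dickson[OF this] obtain B where B: "finite B" "B \<subseteq> lead J" "\<forall>\<alpha>\<in>lead J. \<exists>\<beta>\<in>B. \<beta> \<le> \<alpha>"
    by (elim exE conjE)
  \<comment> \<open>A bound on the degrees in the standard basis: subtracting some \<beta> of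
    \<open>B\<close> from an exponent lowers the degree by at most \<open>c\<close>.\<close>
  define c where "c = (\<Sum>\<beta>\<in>B. mdeg d \<beta>)"
  have c: "mdeg d \<beta> \<le> c" if "\<beta> \<in> B" for \<beta>
    unfolding c_def using that B(1) by (intro member_le_sum) auto
  have "J \<inter> mpow n \<subseteq> ideal_prod R (mpow (n - c)) J" for n
  proof
    fix y assume y: "y \<in> J \<inter> mpow n"
    let ?K = "ideal_prod R (mpow (n - c)) J"
    have K: "ideal ?K R" by (rule ideal_prod_is_ideal[OF mpow_ideal J])
    show "y \<in> ?K"
    \<comment> \<open>Division by the standard basis pushes the remainder to ever higher order but
      may never end, so it is stopped at an arbitrary order \<open>M\<close>.\<close>
    proof (rule krull_intersection[OF K])
      show "y \<in> carrier R" using y ideal_subset_carrier[OF J] by blast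
      fix M
      have KM: "ideal (?K <+>\<^bsub>R\<^esub> mpow M) R" by (rule add_ideals[OF K mpow_ideal])
      show "y \<in> ?K <+>\<^bsub>R\<^esub> mpow M"
      proof (cases "n \<le> M")
        case False
        then have "mpow n \<subseteq> mpow M" by (intro ideal_pow_antimono[OF m_ideal]) simp
        then show ?thesis using y by (intro mem_set_add_right[OF K mpow_ideal]) blast
      next
        case True
        \<comment> \<open>The intersection with \<open>J\<close> is carried along because a
          remainder in \<open>J\<close> has its leading exponent in \<open>lead J\<close>, so that
          some element of \<open>B\<close> divides it again.\<close>
        define Q where "Q S \<longleftrightarrow> J \<inter> V S \<subseteq> ?K <+>\<^bsub>R\<^esub> mpow M" for S
        have "Q {\<alpha> \<in> E. n \<le> mdeg d \<alpha>}"
        proof (rule upset_induct[where n = M])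
          show "{\<alpha> \<in> E. n \<le> mdeg d \<alpha>} \<subseteq> E" by (rule Collect_subset[THEN subset_trans]) blast
          show "{\<alpha> \<in> E. M \<le> mdeg d \<alpha>} \<subseteq> {\<alpha> \<in> E. n \<le> mdeg d \<alpha>}" using True by auto
          show "\<beta> \<in> {\<alpha> \<in> E. n \<le> mdeg d \<alpha>}"
            if "\<alpha> \<in> {\<alpha> \<in> E. n \<le> mdeg d \<alpha>}" "\<beta> \<in> E" "deglex_less d \<alpha> \<beta>" for \<alpha> \<beta>
            using that deglex_less_mdeg[OF that(3)] by simp
          show "Q {\<alpha> \<in> E. M \<le> mdeg d \<alpha>}"
            unfolding Q_def mpow_eq_V[symmetric] using mem_set_add_right[OF K mpow_ideal] by blast
        next
          fix \<alpha> assume \<alpha>': "\<alpha> \<in> {\<alpha> \<in> E. n \<le> mdeg d \<alpha>}" and \<alpha>: "\<alpha> \<in> E" and IH: "Q (above \<alpha>)"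
          then have \<alpha>n: "n \<le> mdeg d \<alpha>" by simp
          show "Q (insert \<alpha> (above \<alpha>))"
            unfolding Q_def
          proof
            fix r assume r: "r \<in> J \<inter> V (insert \<alpha> (above \<alpha>))"
            have rc: "r \<in> carrier R" using r ideal_subset_carrier[OF J] by blast
            obtain b where b: "r \<ominus> \<iota> b \<otimes> xm \<alpha> \<in> V (above \<alpha>)"
              using leading_coefficient[OF \<alpha>, of r] r by blast
            show "r \<in> ?K <+>\<^bsub>R\<^esub> mpow M"
            proof (cases "b = 0")
              case True
              then have "r \<in> V (above \<alpha>)" using b rc by (simp add: a_minus_def)
              then show ?thesis using IH r unfolding Q_def by blast
            next
              case False
              define e where "e = \<iota> (inverse b)"
              have e: "e \<in> carrier R" "e \<otimes> \<iota> b = \<one>"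
                using False unfolding e_def \<iota>_mult[symmetric] by simp_all
              have "e \<otimes> (r \<ominus> \<iota> b \<otimes> xm \<alpha>) = e \<otimes> r \<ominus> (e \<otimes> \<iota> b) \<otimes> xm \<alpha>"
                using e(1) rc \<iota>_closed[of b] xm_closed[of \<alpha>] by algebra
              also have "\<dots> = e \<otimes> r \<ominus> xm \<alpha>" unfolding e(2) using xm_closed[of \<alpha>] by simp
              finally have "e \<otimes> r \<ominus> xm \<alpha> \<in> V (above \<alpha>)"
                using ideal.I_l_closed[OF V_ideal b e(1)] by simp
              moreover have "e \<otimes> r \<in> J" using ideal.I_l_closed[OF J _ e(1)] r by blast
              ultimately have "\<alpha> \<in> lead J" unfolding lead_def using \<alpha> by blast
              then obtain \<beta> where \<beta>: "\<beta> \<in> B" "\<beta> \<le> \<alpha>" using bspec[OF B(3)] by blast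
              then obtain g where g: "g \<in> J" "g \<ominus> xm \<beta> \<in> V (above \<beta>)"
                using B(2) unfolding lead_def by blast
              have gc: "g \<in> carrier R" by (rule ideal_subset_carrier[OF J g(1)])
              define \<gamma> where "\<gamma> = (\<lambda>l. \<alpha> l - \<beta> l)"
              have \<gamma>E: "\<gamma> \<in> E" using \<alpha> unfolding \<gamma>_def exponents_def by simp
              have sum: "(\<lambda>l. \<gamma> l + \<beta> l) = \<alpha>" unfolding \<gamma>_def using le_funD[OF \<beta>(2)] by simp
              have X: "xm \<alpha> = xm \<gamma> \<otimes> xm \<beta>" using xm_add[of \<gamma> \<beta>] unfolding sum .
              have "mdeg d \<alpha> = mdeg d \<gamma> + mdeg d \<beta>" using mdeg_add[of d \<gamma> \<beta>] unfolding sum .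
              then have "n - c \<le> mdeg d \<gamma>" using c[OF \<beta>(1)] \<alpha>n by linarith
              then have "xm \<gamma> \<in> mpow (n - c)"
                by (rule subsetD[OF ideal_pow_antimono[OF m_ideal] xm_in_mpow])
              then have xg: "xm \<gamma> \<otimes> g \<in> ?K" using g(1) by (rule ideal_prod.prod)
              then have bxg: "\<iota> b \<otimes> (xm \<gamma> \<otimes> g) \<in> ?K" by (rule ideal.I_l_closed[OF K _ \<iota>_closed])
              have "xm \<gamma> \<otimes> (g \<ominus> xm \<beta>) \<in> V (above \<alpha>)"
                using V_above_mult[OF \<gamma>E g(2)] unfolding sum .
              then have v: "\<iota> b \<otimes> (xm \<gamma> \<otimes> (g \<ominus> xm \<beta>)) \<in> V (above \<alpha>)" by (rule V_above_\<iota>)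
              define r' where "r' = r \<ominus> \<iota> b \<otimes> (xm \<gamma> \<otimes> g)"
              have "r' = (r \<ominus> \<iota> b \<otimes> xm \<alpha>) \<ominus> \<iota> b \<otimes> (xm \<gamma> \<otimes> (g \<ominus> xm \<beta>))"
                unfolding r'_def X using rc gc \<iota>_closed[of b] xm_closed[of \<gamma>] xm_closed[of \<beta>] by algebra
              then have "r' \<in> V (above \<alpha>)" using ideal_minus_closed[OF V_ideal b v] by simp
              moreover have "\<iota> b \<otimes> (xm \<gamma> \<otimes> g) \<in> J"
                by (intro ideal.I_l_closed[OF J] g(1) xm_closed \<iota>_closed)
              then have "r' \<in> J" unfolding r'_def using r by (intro ideal_minus_closed[OF J]) auto
              ultimately have "r' \<in> ?K <+>\<^bsub>R\<^esub> mpow M" using IH unfolding Q_def by blast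
              then show ?thesis unfolding r'_def
                by (rule ideal_of_diff[OF KM _ mem_set_add_left[OF K mpow_ideal bxg] rc])
            qed
          qed
        qed
        then show ?thesis using y unfolding Q_def mpow_eq_V[symmetric] by blast
      qed
    qed
  qed
  then show ?thesis by blast
qed

text \<open>Write \<open>y \<otimes> r = p \<oplus> z\<close> with \<open>p\<close> in
  \<open>P\<close> and \<open>z\<close> in \<open>mpow n\<close>. Then \<open>z\<close> lies in
  \<open>P + (y)\<close>, and Artin--Rees for this ideal gives
  \<open>z = p' \<oplus> y \<otimes> t\<close> with \<open>p'\<close> in \<open>P\<close> and
  \<open>t\<close> in \<open>mpow (n - c)\<close>. So \<open>y \<otimes> (r \<ominus> t)\<close> is
  in \<open>P\<close>, and primality cancels \<open>y\<close>.\<close>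

lemma colon_shift:
  assumes P: "primeideal P R" and y: "y \<in> carrier R" "y \<notin> P"
  shows "\<exists>c. \<forall>n. \<forall>r\<in>carrier R. y \<otimes> r \<in> P <+>\<^bsub>R\<^esub> mpow n \<longrightarrow> r \<in> P <+>\<^bsub>R\<^esub> mpow (n - c)"
proof -
  have Pi: "ideal P R" using P by (rule primeideal.axioms(1))
  note Yi = cgenideal_ideal[OF y(1)]
  let ?J = "P <+>\<^bsub>R\<^esub> PIdl y"
  have J: "ideal ?J R" by (rule add_ideals[OF Pi Yi])
  obtain c where c: "\<And>n. ?J \<inter> mpow n \<subseteq> ideal_prod R (mpow (n - c)) ?J"
    using artin_rees[OF J] by blast
  have "r \<in> P <+>\<^bsub>R\<^esub> mpow (n - c)" if r: "r \<in> carrier R" and yr: "y \<otimes> r \<in> P <+>\<^bsub>R\<^esub> mpow n" for n r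
  proof -
    obtain p z where pz: "p \<in> P" "z \<in> mpow n" "y \<otimes> r = p \<oplus> z" using yr unfolding mem_set_add by blast
    have pc: "p \<in> carrier R" and zc: "z \<in> carrier R"
      using ideal_subset_carrier[OF Pi pz(1)] ideal_subset_carrier[OF mpow_ideal pz(2)] .
    have "z = (p \<oplus> z) \<ominus> p" using pc zc by algebra
    also have "\<dots> = r \<otimes> y \<ominus> p" unfolding pz(3)[symmetric] using r y(1) by (simp add: m_comm)
    also have "\<dots> = (\<ominus> p) \<oplus> r \<otimes> y" using pc r y(1) by algebra
    finally have "z \<in> ?J"
      unfolding mem_sum_cgenideal[OF Pi y(1)]
      using additive_subgroup.a_inv_closed[OF ideal.axioms(1)[OF Pi] pz(1)] r by blast
    then have "z \<in> ideal_prod R (mpow (n - c)) ?J" using c[of n] pz(2) by blast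
    then have "\<exists>p'\<in>P. \<exists>t\<in>mpow (n - c). z = p' \<oplus> y \<otimes> t"
    proof (induction z rule: ideal_prod.induct)
      case (prod i j)
      then obtain p' t where t: "p' \<in> P" "t \<in> carrier R" "j = p' \<oplus> t \<otimes> y"
        unfolding mem_sum_cgenideal[OF Pi y(1)] by blast
      have ic: "i \<in> carrier R" by (rule ideal_subset_carrier[OF mpow_ideal prod(1)])
      have "i \<otimes> j = i \<otimes> p' \<oplus> y \<otimes> (i \<otimes> t)"
        unfolding t(3) using ic t(2) y(1) ideal_subset_carrier[OF Pi t(1)] by algebra
      then show ?case
        using ideal.I_l_closed[OF Pi t(1) ic] ideal.I_r_closed[OF mpow_ideal prod(1) t(2)] by blast
    next
      case (sum z z')
      then obtain p1 t1 p2 t2 where t: "p1 \<in> P" "t1 \<in> mpow (n - c)" "z = p1 \<oplus> y \<otimes> t1"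
        "p2 \<in> P" "t2 \<in> mpow (n - c)" "z' = p2 \<oplus> y \<otimes> t2" by blast
      have "z \<oplus> z' = (p1 \<oplus> p2) \<oplus> y \<otimes> (t1 \<oplus> t2)"
        unfolding t(3,6) using y(1) ideal_subset_carrier[OF Pi t(1)] ideal_subset_carrier[OF Pi t(4)]
          ideal_subset_carrier[OF mpow_ideal t(2)] ideal_subset_carrier[OF mpow_ideal t(5)] by algebra
      then show ?case
        using ideal_add_closed[OF Pi t(1,4)] ideal_add_closed[OF mpow_ideal t(2,5)] by blast
    qed
    then obtain p' t where t: "p' \<in> P" "t \<in> mpow (n - c)" "z = p' \<oplus> y \<otimes> t" by blast
    have p'c: "p' \<in> carrier R" and tc: "t \<in> carrier R"
      using ideal_subset_carrier[OF Pi t(1)] ideal_subset_carrier[OF mpow_ideal t(2)] .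
    have "y \<otimes> (r \<ominus> t) = y \<otimes> r \<ominus> y \<otimes> t" using y(1) r tc by algebra
    also have "\<dots> = p \<oplus> p'" unfolding pz(3) t(3) using pc p'c y(1) tc by algebra
    finally have "y \<otimes> (r \<ominus> t) \<in> P" using ideal_add_closed[OF Pi pz(1) t(1)] by simp
    then have "r \<ominus> t \<in> P"
      using primeideal.I_prime[OF P y(1), of "r \<ominus> t"] r tc y(2) by auto
    moreover have "r = (r \<ominus> t) \<oplus> t" using r tc by algebra
    ultimately show ?thesis unfolding mem_set_add using t(2) by blast
  qed
  then show ?thesis by blast
qed

end

section \<open>The Hilbert function and chains of primes\<close>

context residually_rational_local_ring
begin

section \<open>Linear combinations with coefficients in \<open>k\<close>\<close>

lemma lincomb_closed:
  assumes "\<And>s. s \<in> S \<Longrightarrow> F s \<in> carrier R"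
  shows "(\<Oplus>s\<in>S. \<iota> (a s) \<otimes> F s) \<in> carrier R"
  by (rule finsum_closed) (use assms in auto)

lemma lincomb_add:
  assumes F: "\<And>s. s \<in> S \<Longrightarrow> F s \<in> carrier R"
  shows "(\<Oplus>s\<in>S. \<iota> (a s + b s) \<otimes> F s) = (\<Oplus>s\<in>S. \<iota> (a s) \<otimes> F s) \<oplus> (\<Oplus>s\<in>S. \<iota> (b s) \<otimes> F s)"
proof -
  have "(\<Oplus>s\<in>S. \<iota> (a s + b s) \<otimes> F s) = (\<Oplus>s\<in>S. \<iota> (a s) \<otimes> F s \<oplus> \<iota> (b s) \<otimes> F s)"
    by (rule finsum_cong') (use F in \<open>auto simp: \<iota>_add l_distr\<close>)
  also have "\<dots> = (\<Oplus>s\<in>S. \<iota> (a s) \<otimes> F s) \<oplus> (\<Oplus>s\<in>S. \<iota> (b s) \<otimes> F s)"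
    by (rule finsum_addf) (use F in auto)
  finally show ?thesis .
qed

lemma lincomb_smult:
  assumes F: "\<And>s. s \<in> S \<Longrightarrow> F s \<in> carrier R"
  shows "(\<Oplus>s\<in>S. \<iota> (z * a s) \<otimes> F s) = \<iota> z \<otimes> (\<Oplus>s\<in>S. \<iota> (a s) \<otimes> F s)"
proof (cases "finite S")
  case True
  have "\<iota> z \<otimes> (\<Oplus>s\<in>S. \<iota> (a s) \<otimes> F s) = (\<Oplus>s\<in>S. \<iota> z \<otimes> (\<iota> (a s) \<otimes> F s))"
    by (rule finsum_rdistr[OF True \<iota>_closed]) (use F in auto)
  also have "\<dots> = (\<Oplus>s\<in>S. \<iota> (z * a s) \<otimes> F s)"
    by (rule finsum_cong') (use F in \<open>auto simp: \<iota>_mult m_assoc\<close>)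
  finally show ?thesis ..
qed simp

lemma lincomb_diff:
  assumes F: "\<And>s. s \<in> S \<Longrightarrow> F s \<in> carrier R"
  shows "(\<Oplus>s\<in>S. \<iota> (a s) \<otimes> F s) \<ominus> (\<Oplus>s\<in>S. \<iota> (b s) \<otimes> F s) = (\<Oplus>s\<in>S. \<iota> (a s - b s) \<otimes> F s)"
proof -
  let ?u = "\<Oplus>s\<in>S. \<iota> (a s) \<otimes> F s" and ?v = "\<Oplus>s\<in>S. \<iota> (b s) \<otimes> F s"
  have c: "?u \<in> carrier R" "?v \<in> carrier R" by (rule lincomb_closed, rule F, assumption)+
  have "(\<Oplus>s\<in>S. \<iota> (a s + (-1) * b s) \<otimes> F s) = ?u \<oplus> (\<Oplus>s\<in>S. \<iota> ((-1) * b s) \<otimes> F s)"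
    by (rule lincomb_add) (rule F)
  also have "(\<Oplus>s\<in>S. \<iota> ((-1) * b s) \<otimes> F s) = \<iota> (-1) \<otimes> ?v"
    by (rule lincomb_smult) (rule F)
  also have "?u \<oplus> \<iota> (-1) \<otimes> ?v = ?u \<ominus> ?v"
    unfolding \<iota>_minus \<iota>_1 a_minus_def using c by (simp add: l_minus)
  finally show ?thesis by simp
qed

lemma lincomb_lincomb:
  assumes F: "\<And>s. s \<in> S \<Longrightarrow> F s \<in> carrier R" and T: "finite T"
  shows "(\<Oplus>t\<in>T. \<iota> (z t) \<otimes> (\<Oplus>s\<in>S. \<iota> (a s t) \<otimes> F s))
    = (\<Oplus>s\<in>S. \<iota> (\<Sum>t\<in>T. a s t * z t) \<otimes> F s)"
  using T
proof (induction T rule: finite_induct)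
  case empty
  have "(\<Oplus>s\<in>S. \<iota> 0 \<otimes> F s) = (\<Oplus>s\<in>S. \<zero>)"
    by (rule finsum_cong') (use F in auto)
  then show ?case by simp
next
  case (insert t T)
  have lc: "(\<Oplus>s\<in>S. \<iota> (b s) \<otimes> F s) \<in> carrier R" for b by (rule lincomb_closed) (rule F)
  have "(\<Oplus>u\<in>insert t T. \<iota> (z u) \<otimes> (\<Oplus>s\<in>S. \<iota> (a s u) \<otimes> F s))
      = \<iota> (z t) \<otimes> (\<Oplus>s\<in>S. \<iota> (a s t) \<otimes> F s) \<oplus> (\<Oplus>s\<in>S. \<iota> (\<Sum>t\<in>T. a s t * z t) \<otimes> F s)"
    unfolding insert.IH[symmetric]
    by (rule finsum_insert[OF insert.hyps]) (simp_all add: Pi_iff lc)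
  also have "\<iota> (z t) \<otimes> (\<Oplus>s\<in>S. \<iota> (a s t) \<otimes> F s) = (\<Oplus>s\<in>S. \<iota> (z t * a s t) \<otimes> F s)"
    by (rule lincomb_smult[symmetric]) (rule F)
  also have "\<dots> \<oplus> (\<Oplus>s\<in>S. \<iota> (\<Sum>t\<in>T. a s t * z t) \<otimes> F s)
      = (\<Oplus>s\<in>S. \<iota> (z t * a s t + (\<Sum>t\<in>T. a s t * z t)) \<otimes> F s)"
    by (rule lincomb_add[symmetric]) (rule F)
  also have "\<dots> = (\<Oplus>s\<in>S. \<iota> (\<Sum>t\<in>insert t T. a s t * z t) \<otimes> F s)"
    using insert.hyps by (simp add: mult.commute)
  finally show ?case .
qed

section \<open>The Hilbert function\<close>

definition hilbert where "hilbert I n = card (Edeg n - lead I)"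

lemma hilbert_antimono: "I \<subseteq> J \<Longrightarrow> hilbert J n \<le> hilbert I n"
  unfolding hilbert_def using lead_mono[of I J] finite_mdeg_less
  by (intro card_mono finite_Diff) auto

lemma hilbert_mono: "i \<le> j \<Longrightarrow> hilbert I i \<le> hilbert I j"
  unfolding hilbert_def using finite_mdeg_less
  by (intro card_mono finite_Diff) auto

lemma xm_diff_above: "xm \<alpha> \<ominus> xm \<alpha> \<in> V S"
proof -
  have "xm \<alpha> \<ominus> xm \<alpha> = \<zero>" using xm_closed[of \<alpha>] by algebra
  then show ?thesis using ideal_zero_closed[OF V_ideal] by (simp only:)
qed

text \<open>The monomials that are standard for \<open>P + (y)\<close> in degrees below \<open>n\<close>, together with \<open>y\<close> times
  the monomials that are standard for \<open>P\<close> in degrees below \<open>n - c\<close>, are linearly independent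
  modulo \<open>P + m\<^sup>n\<close>.\<close>

lemma hilbert_cut:
  assumes P: "primeideal P R" and y: "y \<in> carrier R" "y \<notin> P"
  shows "\<exists>c. \<forall>n. hilbert (P <+>\<^bsub>R\<^esub> PIdl y) n + hilbert P (n - c) \<le> hilbert P n"
proof -
  have Pi: "ideal P R" using P by (rule primeideal.axioms(1))
  note Yi = cgenideal_ideal[OF y(1)]
  let ?J = "P <+>\<^bsub>R\<^esub> PIdl y"
  have J: "ideal ?J R" by (rule add_ideals[OF Pi Yi])
  obtain c where c: "\<forall>n. \<forall>r\<in>carrier R. y \<otimes> r \<in> P <+>\<^bsub>R\<^esub> mpow n \<longrightarrow> r \<in> P <+>\<^bsub>R\<^esub> mpow (n - c)"
    using colon_shift[OF P y] by (rule exE)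
  have "hilbert ?J n + hilbert P (n - c) \<le> hilbert P n" for n
  proof (rule ccontr)
    let ?S = "Edeg n - lead P" and ?A = "Edeg n - lead ?J" and ?B = "Edeg (n - c) - lead P"
    let ?Pn = "P <+>\<^bsub>R\<^esub> mpow n"
    have Pn: "ideal ?Pn R" by (rule add_ideals[OF Pi mpow_ideal])
    \<comment> \<open>The two families are tagged in a disjoint sum, so that indices are counted and
      not possibly coinciding elements.\<close>
    define T where "T = Inl ` ?A \<union> Inr ` ?B"
    define e where "e = case_sum xm (\<lambda>\<alpha>. y \<otimes> xm \<alpha>)"
    have ec: "e t \<in> carrier R" for t unfolding e_def using y(1) by (cases t) simp_all
    have fin: "finite ?S" "finite ?A" "finite ?B" using finite_mdeg_less by auto
    have finT: "finite T" unfolding T_def using fin by auto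
    assume "\<not> hilbert ?J n + hilbert P (n - c) \<le> hilbert P n"
    moreover have "card T = hilbert ?J n + hilbert P (n - c)"
      unfolding T_def hilbert_def using fin
      by (subst card_Un_disjoint) (auto simp: card_image)
    ultimately have "card ?S < card T" unfolding hilbert_def by simp
    \<comment> \<open>Each \<open>e t\<close> is a combination of the standard monomials of
      \<open>P\<close> modulo \<open>?Pn\<close>. As there are supposed to be more indices than such
      monomials, some nontrivial combination of the \<open>e t\<close> vanishes modulo
      \<open>?Pn\<close>.\<close>
    have "\<forall>t. \<exists>a. e t \<ominus> (\<Oplus>\<alpha>\<in>?S. \<iota> (a \<alpha>) \<otimes> xm \<alpha>) \<in> ?Pn"
      by (intro allI span_modulo[OF Pi xm_closed xm_diff_above ec])
    from choice[OF this] obtain a where a: "\<forall>t. e t \<ominus> (\<Oplus>\<alpha>\<in>?S. \<iota> (a t \<alpha>) \<otimes> xm \<alpha>) \<in> ?Pn" by (rule exE)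
    from homogeneous_system_nontrivial_solution[OF fin(1) finT \<open>card ?S < card T\<close>, of "\<lambda>\<alpha> t. a t \<alpha>"]
    obtain z where z: "\<exists>t\<in>T. z t \<noteq> 0" "\<forall>\<alpha>\<in>?S. (\<Sum>t\<in>T. a t \<alpha> * z t) = 0" by (elim exE conjE)
    define w where "w t = (\<Oplus>\<alpha>\<in>?S. \<iota> (a t \<alpha>) \<otimes> xm \<alpha>)" for t
    have wc: "w t \<in> carrier R" for t unfolding w_def by (rule lincomb_closed) (rule xm_closed)
    have "(\<Oplus>t\<in>T. \<iota> (z t) \<otimes> w t) = (\<Oplus>\<alpha>\<in>?S. \<iota> (\<Sum>t\<in>T. a t \<alpha> * z t) \<otimes> xm \<alpha>)"
      unfolding w_def by (rule lincomb_lincomb[OF xm_closed finT])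
    also have "\<dots> = (\<Oplus>\<alpha>\<in>?S. \<zero>)"
      by (rule finsum_cong') (use z(2) in auto)
    finally have zw: "(\<Oplus>t\<in>T. \<iota> (z t) \<otimes> w t) = \<zero>" by simp
    have "(\<Oplus>t\<in>T. \<iota> (z t) \<otimes> (e t \<ominus> w t)) \<in> ?Pn"
      by (rule ideal_finsum_closed[OF Pn])
        (rule ideal.I_l_closed[OF Pn spec[OF a, folded w_def] \<iota>_closed])
    moreover have "(\<Oplus>t\<in>T. \<iota> (z t) \<otimes> e t) = (\<Oplus>t\<in>T. \<iota> (z t) \<otimes> (e t \<ominus> w t) \<oplus> \<iota> (z t) \<otimes> w t)"
    proof (rule finsum_cong'[OF refl])
      fix t
      have "\<iota> (z t) \<otimes> u = \<iota> (z t) \<otimes> (u \<ominus> v) \<oplus> \<iota> (z t) \<otimes> v" if "u \<in> carrier R" "v \<in> carrier R" for u v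
        using that \<iota>_closed[of "z t"] by algebra
      then show "\<iota> (z t) \<otimes> e t = \<iota> (z t) \<otimes> (e t \<ominus> w t) \<oplus> \<iota> (z t) \<otimes> w t" using ec wc by blast
    qed (use ec wc in auto)
    moreover have "\<dots> = (\<Oplus>t\<in>T. \<iota> (z t) \<otimes> (e t \<ominus> w t)) \<oplus> (\<Oplus>t\<in>T. \<iota> (z t) \<otimes> w t)"
      by (rule finsum_addf) (use ec wc in auto)
    ultimately have sumT: "(\<Oplus>t\<in>T. \<iota> (z t) \<otimes> e t) \<in> ?Pn"
      unfolding zw using ideal_subset_carrier[OF Pn] by simp
    define sA where "sA = (\<Oplus>\<alpha>\<in>?A. \<iota> (z (Inl \<alpha>)) \<otimes> xm \<alpha>)"
    define sB where "sB = (\<Oplus>\<alpha>\<in>?B. \<iota> (z (Inr \<alpha>)) \<otimes> xm \<alpha>)"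
    have sc: "sA \<in> carrier R" "sB \<in> carrier R"
      unfolding sA_def sB_def by (rule lincomb_closed, rule xm_closed)+
    have "(\<Oplus>t\<in>T. \<iota> (z t) \<otimes> e t) = (\<Oplus>t\<in>Inl ` ?A. \<iota> (z t) \<otimes> e t) \<oplus> (\<Oplus>t\<in>Inr ` ?B. \<iota> (z t) \<otimes> e t)"
      unfolding T_def by (rule finsum_Un_disjoint) (use fin ec in auto)
    also have "(\<Oplus>t\<in>Inl ` ?A. \<iota> (z t) \<otimes> e t) = (\<Oplus>\<alpha>\<in>?A. \<iota> (z (Inl \<alpha>)) \<otimes> e (Inl \<alpha>))"
      by (rule finsum_reindex) (use ec in auto)
    also have "\<dots> = sA" unfolding sA_def e_def by simp
    also have "(\<Oplus>t\<in>Inr ` ?B. \<iota> (z t) \<otimes> e t) = (\<Oplus>\<alpha>\<in>?B. \<iota> (z (Inr \<alpha>)) \<otimes> e (Inr \<alpha>))"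
      by (rule finsum_reindex) (use ec in auto)
    also have "\<dots> = (\<Oplus>\<alpha>\<in>?B. y \<otimes> (\<iota> (z (Inr \<alpha>)) \<otimes> xm \<alpha>))"
      by (rule finsum_cong') (use y(1) in \<open>auto simp: e_def m_lcomm\<close>)
    also have "\<dots> = y \<otimes> sB"
      unfolding sB_def by (rule finsum_rdistr[symmetric]) (use fin y(1) in auto)
    finally have AB: "sA \<oplus> y \<otimes> sB \<in> ?Pn" using sumT by simp
    \<comment> \<open>Modulo \<open>?J\<close> the summand \<open>y \<otimes> sB\<close> disappears,
      so the coefficients of the first family vanish on their own.\<close>
    have zA: "z (Inl \<alpha>) = 0" if "\<alpha> \<in> ?A" for \<alpha>
    proof (rule independent_modulo[OF J xm_closed xm_diff_above _ that])
      obtain p u where pu: "p \<in> P" "u \<in> mpow n" "sA \<oplus> y \<otimes> sB = p \<oplus> u"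
        using AB unfolding mem_set_add by (elim bexE)
      have pc: "p \<in> carrier R" and uc: "u \<in> carrier R"
        using ideal_subset_carrier[OF Pi pu(1)] ideal_subset_carrier[OF mpow_ideal pu(2)] .
      have "sA = (sA \<oplus> y \<otimes> sB) \<ominus> y \<otimes> sB" using sc y(1) by algebra
      also have "\<dots> = (p \<oplus> (\<ominus> sB) \<otimes> y) \<oplus> u" unfolding pu(3) using sc y(1) pc uc by algebra
      finally have "sA = (p \<oplus> (\<ominus> sB) \<otimes> y) \<oplus> u" .
      moreover have "p \<oplus> (\<ominus> sB) \<otimes> y \<in> ?J"
        unfolding mem_sum_cgenideal[OF Pi y(1)] using pu(1) sc(2) by blast
      ultimately have "sA \<in> ?J <+>\<^bsub>R\<^esub> mpow n" unfolding mem_set_add[of sA] using pu(2) by blast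
      then show "(\<Oplus>\<alpha>\<in>?A. \<iota> (z (Inl \<alpha>)) \<otimes> xm \<alpha>) \<in> ?J <+>\<^bsub>R\<^esub> mpow n" unfolding sA_def .
    qed
    have "sA = (\<Oplus>\<alpha>\<in>?A. \<zero>)"
      unfolding sA_def by (rule finsum_cong') (use zA in auto)
    then have "y \<otimes> sB \<in> ?Pn" using AB sc(2) y(1) by simp
    \<comment> \<open>Cancelling \<open>y\<close> costs \<open>c\<close> in the order, which is why
      the second family stops at degree \<open>n - c\<close>.\<close>
    then have "sB \<in> P <+>\<^bsub>R\<^esub> mpow (n - c)" using bspec[OF spec[OF c] sc(2)] by blast
    then have zB: "z (Inr \<alpha>) = 0" if "\<alpha> \<in> ?B" for \<alpha>
      unfolding sB_def by (rule independent_modulo[OF Pi xm_closed xm_diff_above _ that])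
    show False using z(1) zA zB unfolding T_def by blast
  qed
  then show ?thesis by blast
qed

text \<open>Induction along the chain. With \<open>y\<close> in \<open>Z 1\<close> but not in
  \<open>Z 0\<close>, the ideal \<open>J = Z 0 + (y)\<close> lies in \<open>Z 1\<close>, so the
  shorter chain bounds \<open>hilbert J\<close> from below; repeated use of
  \<open>hilbert_cut\<close> adds up about \<open>n / (2 * c)\<close> of its values, at arguments
  not less than \<open>n / 2\<close>. As \<open>J\<close> need not be prime, the claim is made for
  any ideal inside \<open>Z 0\<close>.\<close>

lemma hilbert_prime_chain:
  assumes "ideal I R" "I \<subseteq> Z 0" "\<And>i. i \<le> r \<Longrightarrow> primeideal (Z i) R" "\<And>i. i < r \<Longrightarrow> Z i \<subset> Z (Suc i)"
  shows "\<exists>C. \<forall>n\<ge>1. n ^ r \<le> C * hilbert I n"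
  using assms
proof (induction r arbitrary: I Z)
  case 0
  have P: "ideal (Z 0) R" "Z 0 \<noteq> carrier R"
    using primeideal.axioms(1)[OF 0(3)[of 0]] primeideal.I_notcarr[OF 0(3)[of 0]] by auto
  have one: "\<one> \<notin> I" using P(2) ideal.one_imp_carrier[OF P(1)] subsetD[OF 0(2)] by blast
  \<comment> \<open>A single standard exponent suffices: zero is never leading for a proper ideal,
    as its monomial is \<one>.\<close>
  have "n ^ 0 \<le> 1 * hilbert I n" if "n \<ge> 1" for n
  proof -
    have zE: "(\<lambda>_. 0) \<in> Edeg n" using that by (simp add: exponents_def mdeg_def)
    have "(\<lambda>_. 0) \<notin> lead I"
    proof
      assume "(\<lambda>_. 0) \<in> lead I"
      then have "\<exists>i\<in>I. i \<ominus> \<one> \<in> V (above (\<lambda>_. 0))"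
        unfolding lead_def mem_Collect_eq monomial_zero by (rule conjunct2)
      then obtain i where i: "i \<in> I" "i \<ominus> \<one> \<in> V (above (\<lambda>_. 0))" by (rule bexE)
      have "above (\<lambda>_. 0) \<subseteq> {\<alpha> \<in> E. 1 \<le> mdeg d \<alpha>}"
      proof
        fix \<beta> assume "\<beta> \<in> above (\<lambda>_. 0)"
        then have \<beta>: "\<beta> \<in> E" "deglex_less d (\<lambda>_. 0) \<beta>" by simp_all
        have "mdeg d \<beta> \<noteq> 0"
        proof
          assume z: "mdeg d \<beta> = 0"
          then have "less_fun (\<lambda>_. 0) \<beta>" using \<beta>(2) unfolding deglex_less_def by simp
          then obtain k where k: "0 < \<beta> k" by (rule less_funE)
          then have "k \<in> {1..d}" using \<beta>(1) unfolding exponents_def by force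
          from exponent_le_mdeg[OF this, of \<beta>] k z show False by simp
        qed
        then show "\<beta> \<in> {\<alpha> \<in> E. 1 \<le> mdeg d \<alpha>}" using \<beta>(1) by simp
      qed
      from subsetD[OF V_mono[OF this] i(2)] have "i \<ominus> \<one> \<in> mpow 1" unfolding mpow_eq_V .
      then have "i \<ominus> \<one> \<in> m" by (simp only: One_nat_def ideal_pow_1[OF m_ideal])
      moreover have im: "i \<in> m" using proper_ideal_subset_m[OF 0(1) one] i(1) by (rule subsetD)
      ultimately have "i \<ominus> (i \<ominus> \<one>) \<in> m" using ideal_minus_closed[OF m_ideal im] by blast
      moreover have "i \<ominus> (i \<ominus> \<one>) = \<one>" using ideal_subset_carrier[OF m_ideal im] by algebra
      ultimately show False using one_notin_m by simp
    qed
    then have "Edeg n - lead I \<noteq> {}" using zE by blast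
    then have "0 < hilbert I n" unfolding hilbert_def using finite_mdeg_less by (simp add: card_gt_0_iff)
    then show ?thesis by simp
  qed
  then show ?case by blast
next
  case (Suc r)
  let ?P = "Z 0"
  have P: "primeideal ?P R" by (rule Suc.prems(3)) simp
  have Pi: "ideal ?P R" using P by (rule primeideal.axioms(1))
  obtain y where y: "y \<in> Z 1" "y \<notin> ?P" using Suc.prems(4)[of 0] by (auto simp: One_nat_def)
  have P1: "ideal (Z 1) R" using Suc.prems(3)[of 1] primeideal.axioms(1) by auto
  have yc: "y \<in> carrier R" by (rule ideal_subset_carrier[OF P1 y(1)])
  let ?J = "?P <+>\<^bsub>R\<^esub> PIdl y"
  have J: "ideal ?J R" by (rule add_ideals[OF Pi cgenideal_ideal[OF yc]])
  have PJ: "?P \<subseteq> ?J" using mem_set_add_left[OF Pi cgenideal_ideal[OF yc]] by (rule subsetI)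
  have "?J \<subseteq> Z 1"
  proof
    fix a assume "a \<in> ?J"
    then obtain p t where "p \<in> ?P" "t \<in> carrier R" "a = p \<oplus> t \<otimes> y"
      unfolding mem_sum_cgenideal[OF Pi yc] by blast
    moreover have "?P \<subseteq> Z 1" using Suc.prems(4)[of 0] by (simp add: One_nat_def psubset_imp_subset)
    ultimately show "a \<in> Z 1"
      using ideal_add_closed[OF P1 _ ideal.I_l_closed[OF P1 y(1)]] by blast
  qed
  then have "\<exists>C. \<forall>n\<ge>1. n ^ r \<le> C * hilbert ?J n"
    using Suc.IH[OF J, of "\<lambda>i. Z (Suc i)"] Suc.prems(3,4) by (simp add: One_nat_def)
  then obtain C where C: "\<And>n. n \<ge> 1 \<Longrightarrow> n ^ r \<le> C * hilbert ?J n" by blast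
  obtain c0 where c0: "\<And>n. hilbert ?J n + hilbert ?P (n - c0) \<le> hilbert ?P n"
    using hilbert_cut[OF P yc y(2)] by blast
  \<comment> \<open>Made positive so that it can serve as a divisor; a larger shift merely weakens
    the inequality.\<close>
  define c where "c = Suc c0"
  have c: "hilbert ?J n + hilbert ?P (n - c) \<le> hilbert ?P n" for n
  proof -
    have "n - c \<le> n - c0" by (simp add: c_def)
    from hilbert_mono[OF this, of ?P] c0[of n] show ?thesis by linarith
  qed
  have iter: "t * hilbert ?J (n - (t - 1) * c) \<le> hilbert ?P n" for t n
  proof (induction t arbitrary: n)
    case (Suc t)
    have "hilbert ?J (n - t * c) \<le> hilbert ?J n" by (rule hilbert_mono) simp
    moreover have "t * hilbert ?J (n - t * c) \<le> hilbert ?P (n - c)"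
    proof (cases t)
      case (Suc t')
      then show ?thesis using Suc.IH[of "n - c"] by (simp add: diff_diff_left)
    qed simp
    ultimately show ?case using c[of n] by simp
  qed simp
  have "n ^ Suc r \<le> (2 * c * 2 ^ r * C) * hilbert I n" if n: "n \<ge> 1" for n
  proof -
    \<comment> \<open>At most half of \<open>n\<close> is spent: \<open>t\<close> steps of size
      \<open>c\<close> leave an argument of at least \<open>n / 2\<close>, while
      \<open>t + 1\<close> still exceeds \<open>n / (2 * c)\<close>.\<close>
    define t where "t = n div (2 * c)"
    have cpos: "c > 0" by (simp add: c_def)
    have "n = 2 * c * t + n mod (2 * c)" unfolding t_def by simp
    moreover have "n mod (2 * c) < 2 * c" using cpos by simp
    ultimately have n1: "n \<le> 2 * c * Suc t" "2 * (c * t) \<le> n" by (simp_all add: algebra_simps)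
    define k where "k = n - t * c"
    have k: "n \<le> 2 * k" "k \<ge> 1" using n1 n unfolding k_def by (simp_all add: algebra_simps)
    have "n ^ r \<le> (2 * k) ^ r" using k(1) by (rule power_mono) simp
    also have "\<dots> \<le> 2 ^ r * (C * hilbert ?J k)" unfolding power_mult_distrib using C[OF k(2)] by simp
    finally have "n ^ Suc r \<le> (2 * c * Suc t) * (2 ^ r * (C * hilbert ?J k))"
      unfolding power_Suc by (rule mult_mono[OF n1(1)]) simp_all
    also have "\<dots> = (2 * c * 2 ^ r * C) * (Suc t * hilbert ?J k)" by (simp add: algebra_simps)
    also have "\<dots> \<le> (2 * c * 2 ^ r * C) * hilbert ?P n"
      using iter[of "Suc t" n] by (intro mult_left_mono) (simp_all add: k_def)
    also have "\<dots> \<le> (2 * c * 2 ^ r * C) * hilbert I n"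
      using hilbert_antimono[OF Suc.prems(2), of n] by (intro mult_left_mono) simp_all
    finally show ?thesis .
  qed
  then show ?case by blast
qed

text \<open>One exponent in \<open>lead {\<zero>}\<close> brings all exponents above it along, so
  \<open>card_avoiding_le\<close> bounds the remaining ones and contradicts the growth forced by the
  chain.\<close>

theorem lead_zero_empty:
  assumes "has_chain {\<pp>. primeideal \<pp> R} d"
  shows "lead {\<zero>} = {}"
proof (rule ccontr)
  assume "lead {\<zero>} \<noteq> {}"
  then obtain \<gamma> where \<gamma>: "\<gamma> \<in> lead {\<zero>}" by blast
  have \<gamma>E: "\<gamma> \<in> E" using \<gamma> unfolding lead_def by blast
  obtain Z where Z: "\<And>i. i \<le> d \<Longrightarrow> primeideal (Z i) R" "\<And>i. i < d \<Longrightarrow> Z i \<subset> Z (Suc i)"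
    using assms unfolding has_chain_def by auto
  have "{\<zero>} \<subseteq> Z 0" using ideal_zero_closed[OF primeideal.axioms(1)[OF Z(1)[of 0]]] by simp
  from hilbert_prime_chain[OF zeroideal this Z]
  obtain C where C: "\<And>n. n \<ge> 1 \<Longrightarrow> n ^ d \<le> C * hilbert {\<zero>} n" by blast
  have ub: "hilbert {\<zero>} n \<le> mdeg d \<gamma> * n ^ (d - 1)" for n
  proof -
    have "Edeg n - lead {\<zero>} \<subseteq> {\<alpha> \<in> E. mdeg d \<alpha> < n \<and> (\<exists>l. \<alpha> l < \<gamma> l)}"
    proof
      fix \<alpha> assume \<alpha>: "\<alpha> \<in> Edeg n - lead {\<zero>}"
      then have "\<not> \<gamma> \<le> \<alpha>" using lead_upward[OF zeroideal \<gamma>, of \<alpha>] by blast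
      then obtain l where "\<alpha> l < \<gamma> l" by (auto simp: le_fun_def not_le)
      then show "\<alpha> \<in> {\<alpha> \<in> E. mdeg d \<alpha> < n \<and> (\<exists>l. \<alpha> l < \<gamma> l)}" using \<alpha> by blast
    qed
    moreover have "finite {\<alpha> \<in> E. mdeg d \<alpha> < n \<and> (\<exists>l. \<alpha> l < \<gamma> l)}"
      by (rule finite_subset[OF _ finite_mdeg_less[of d n]]) blast
    ultimately have "hilbert {\<zero>} n \<le> card {\<alpha> \<in> E. mdeg d \<alpha> < n \<and> (\<exists>l. \<alpha> l < \<gamma> l)}"
      unfolding hilbert_def by (intro card_mono)
    also have "\<dots> \<le> mdeg d \<gamma> * n ^ (d - 1)" by (rule card_avoiding_le[OF \<gamma>E])
    finally show ?thesis .
  qed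
  show False
  \<comment> \<open>For \<open>d = 0\<close> the truncated \<open>d - 1\<close> gives no smaller
    power, but then \<open>mdeg d \<gamma>\<close> is zero and so is the upper bound.\<close>
  proof (cases "d = 0")
    case True
    then show False using C[of 1] ub[of 1] by (simp add: mdeg_def)
  next
    case False
    \<comment> \<open>Chosen so that \<open>n ^ d\<close> exceeds
      \<open>C * mdeg d \<gamma> * n ^ (d - 1)\<close>.\<close>
    define n where "n = Suc (C * mdeg d \<gamma>)"
    have "n * n ^ (d - 1) = n ^ d" using False by (simp add: power_eq_if)
    also have "\<dots> \<le> C * hilbert {\<zero>} n" by (rule C) (simp add: n_def)
    also have "\<dots> \<le> C * (mdeg d \<gamma> * n ^ (d - 1))" using ub[of n] by simp
    finally have "n * n ^ (d - 1) \<le> (C * mdeg d \<gamma>) * n ^ (d - 1)" by (simp add: mult.assoc)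
    moreover have "n ^ (d - 1) > 0" by (simp add: n_def)
    ultimately have "n \<le> C * mdeg d \<gamma>" unfolding mult_le_cancel2 by blast
    then show False by (simp add: n_def)
  qed
qed

end

section \<open>The completion\<close>

lemma (in ring) coset_eq_iff:
  assumes "ideal I R" "a \<in> carrier R" "b \<in> carrier R"
  shows "I +> a = I +> b \<longleftrightarrow> a \<ominus> b \<in> I"
  using quotient_eq_iff_same_a_r_cos[OF assms] ..

lemma (in ring) mem_coset_iff:
  assumes "ideal I R" "a \<in> carrier R" "b \<in> carrier R"
  shows "a \<in> I +> b \<longleftrightarrow> a \<ominus> b \<in> I"
proof -
  interpret abelian_subgroup I R
    by (rule abelian_subgroupI3[OF ideal.axioms(1)[OF assms(1)] is_abelian_group])
  show ?thesis using a_rcos_module[OF assms(3,2)] by (simp add: a_minus_def)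
qed

lemma (in ring) coset_subset_carrier:
  assumes "ideal I R" "b \<in> carrier R" shows "I +> b \<subseteq> carrier R"
  using a_r_coset_subset_G[OF additive_subgroup.a_subset[OF ideal.axioms(1)[OF assms(1)]] assms(2)] .

lemma (in ring) coset_mono:
  assumes "ideal I R" "ideal J R" "I \<subseteq> J" "a \<in> carrier R" "b \<in> carrier R" "a \<ominus> b \<in> J"
  shows "I +> a \<subseteq> J +> b"
proof -
  have "I +> a \<subseteq> J +> a" using assms(3) unfolding a_r_coset_def r_coset_def by blast
  then show ?thesis using coset_eq_iff[OF assms(2,4,5)] assms(6) by simp
qed

lemma (in abelian_monoid) finsum_Sigma:
  assumes "finite A" "\<And>a. a \<in> A \<Longrightarrow> finite (B a)"
    and "\<And>a b. a \<in> A \<Longrightarrow> b \<in> B a \<Longrightarrow> g a b \<in> carrier G"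
  shows "(\<Oplus>a\<in>A. \<Oplus>b\<in>B a. g a b) = (\<Oplus>p\<in>Sigma A B. g (fst p) (snd p))"
  using assms
proof (induction A rule: finite_induct)
  case (insert a A)
  have "Sigma (insert a A) B = Pair a ` B a \<union> Sigma A B" by auto
  moreover have "(\<Oplus>p\<in>Pair a ` B a \<union> Sigma A B. g (fst p) (snd p))
     = (\<Oplus>p\<in>Pair a ` B a. g (fst p) (snd p)) \<oplus> (\<Oplus>p\<in>Sigma A B. g (fst p) (snd p))"
    by (rule finsum_Un_disjoint) (use insert in auto)
  moreover have "(\<Oplus>p\<in>Pair a ` B a. g (fst p) (snd p)) = (\<Oplus>b\<in>B a. g a b)"
    by (subst finsum_reindex) (use insert.prems in \<open>auto simp: inj_on_def\<close>)
  moreover have "(\<Oplus>a\<in>insert a A. \<Oplus>b\<in>B a. g a b) = (\<Oplus>b\<in>B a. g a b) \<oplus> (\<Oplus>a\<in>A. \<Oplus>b\<in>B a. g a b)"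
    by (rule finsum_insert[OF insert.hyps]) (use insert.prems in \<open>auto intro!: finsum_closed\<close>)
  ultimately show ?case using insert by simp
qed simp

locale adic_cring = cring R for R (structure) +
  fixes I :: "'a set"
  assumes I_ideal: "ideal I R"
begin

abbreviation pw where "pw n \<equiv> ideal_pow R I n"
abbreviation T where "T \<equiv> completion R I"

lemma pw_ideal: "ideal (pw n) R" by (rule ideal_pow_ideal[OF I_ideal])

lemma quot_cring: "cring (R Quot pw n)"
  by (rule ideal.quotient_is_cring[OF pw_ideal is_cring])

lemma quot_carrier: "c \<in> carrier (R Quot pw n) \<longleftrightarrow> (\<exists>r\<in>carrier R. c = pw n +> r)"
  by (auto simp: FactRing_simps)

lemma coset_add: "a \<in> carrier R \<Longrightarrow> b \<in> carrier R \<Longrightarrow>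
    (pw n +> a) \<oplus>\<^bsub>R Quot pw n\<^esub> (pw n +> b) = pw n +> (a \<oplus> b)"
  using ideal.a_rcos_sum[OF pw_ideal] by (simp add: FactRing_def)

lemma coset_mult: "a \<in> carrier R \<Longrightarrow> b \<in> carrier R \<Longrightarrow>
    (pw n +> a) \<otimes>\<^bsub>R Quot pw n\<^esub> (pw n +> b) = pw n +> (a \<otimes> b)"
  using ideal.rcoset_mult_add[OF pw_ideal] by (simp add: FactRing_def)

lemma coset_zero: "a \<in> pw n \<Longrightarrow> pw n +> a = pw n +> \<zero>"
  using coset_eq_iff[OF pw_ideal, of a \<zero>] ideal_subset_carrier[OF pw_ideal]
  by (simp add: a_minus_def)

text \<open>Compatibility, defined by inclusion of cosets, becomes a common representative at two
  consecutive levels. In this form closure under the ring operations is checked on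
  representatives.\<close>

lemma carrier_T_iff:
  "s \<in> carrier T \<longleftrightarrow> (\<forall>n. \<exists>r\<in>carrier R. s n = pw n +> r \<and> s (Suc n) = pw (Suc n) +> r)"
proof
  assume s: "s \<in> carrier T"
  show "\<forall>n. \<exists>r\<in>carrier R. s n = pw n +> r \<and> s (Suc n) = pw (Suc n) +> r"
  proof
    fix n
    have sub: "s (Suc n) \<subseteq> s n" and "s (Suc n) \<in> carrier (R Quot pw (Suc n))"
      "s n \<in> carrier (R Quot pw n)"
      using s by (simp_all add: completion_def del: ideal_pow.simps)
    then obtain r r' where r: "r \<in> carrier R" "s (Suc n) = pw (Suc n) +> r"
      "r' \<in> carrier R" "s n = pw n +> r'" unfolding quot_carrier by blast
    have "r \<ominus> r = \<zero>" using r(1) by algebra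
    then have "r \<in> pw (Suc n) +> r"
      using mem_coset_iff[OF pw_ideal r(1,1)] ideal_zero_closed[OF pw_ideal] by metis
    then have "r \<in> pw n +> r'" using sub r(2,4) by blast
    then have "r \<ominus> r' \<in> pw n" using mem_coset_iff[OF pw_ideal r(1,3)] by blast
    then have "pw n +> r = pw n +> r'" using coset_eq_iff[OF pw_ideal r(1,3)] by blast
    then have "s n = pw n +> r" using r(4) by simp
    then show "\<exists>r\<in>carrier R. s n = pw n +> r \<and> s (Suc n) = pw (Suc n) +> r" using r by blast
  qed
next
  assume A: "\<forall>n. \<exists>r\<in>carrier R. s n = pw n +> r \<and> s (Suc n) = pw (Suc n) +> r"
  have "s n \<in> carrier (R Quot pw n) \<and> s (Suc n) \<subseteq> s n" for n
  proof -
    obtain r where r: "r \<in> carrier R" "s n = pw n +> r" "s (Suc n) = pw (Suc n) +> r"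
      using spec[OF A, of n] by blast
    have "r \<ominus> r = \<zero>" using r(1) by algebra
    then have "pw (Suc n) +> r \<subseteq> pw n +> r"
      using coset_mono[OF pw_ideal pw_ideal ideal_pow_Suc_subset[OF I_ideal] r(1,1), of n]
        ideal_zero_closed[OF pw_ideal, of n] by simp
    then show ?thesis using r unfolding quot_carrier by blast
  qed
  then show "s \<in> carrier T" unfolding completion_def by simp
qed

lemma carrier_T_E:
  assumes "s \<in> carrier T" obtains r where "r \<in> carrier R" "s n = pw n +> r"
  using assms unfolding carrier_T_iff by blast

lemma T_add: "(s \<oplus>\<^bsub>T\<^esub> t) n = s n \<oplus>\<^bsub>R Quot pw n\<^esub> t n"
  and T_mult: "(s \<otimes>\<^bsub>T\<^esub> t) n = s n \<otimes>\<^bsub>R Quot pw n\<^esub> t n"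
  and T_zero: "\<zero>\<^bsub>T\<^esub> n = \<zero>\<^bsub>R Quot pw n\<^esub>"
  and T_one: "\<one>\<^bsub>T\<^esub> n = \<one>\<^bsub>R Quot pw n\<^esub>"
  by (simp_all add: completion_def)

lemma to_completion_closed: "a \<in> carrier R \<Longrightarrow> to_completion R I a \<in> carrier T"
  unfolding carrier_T_iff to_completion_def by blast

lemma T_carrier_quot: "s \<in> carrier T \<Longrightarrow> s n \<in> carrier (R Quot pw n)"
  by (simp add: completion_def)

lemma T_zero_eq: "\<zero>\<^bsub>T\<^esub> = to_completion R I \<zero>"
  using a_rcos_zero[OF pw_ideal ideal_zero_closed[OF pw_ideal]]
  by (simp add: completion_def to_completion_def FactRing_def fun_eq_iff)

lemma T_one_eq: "\<one>\<^bsub>T\<^esub> = to_completion R I \<one>"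
  by (simp add: completion_def to_completion_def FactRing_def fun_eq_iff)

lemma T_add_closed: "s \<in> carrier T \<Longrightarrow> t \<in> carrier T \<Longrightarrow> s \<oplus>\<^bsub>T\<^esub> t \<in> carrier T"
proof -
  assume s: "s \<in> carrier T" and t: "t \<in> carrier T"
  show ?thesis
    unfolding carrier_T_iff T_add
  proof
    fix n
    obtain a where a: "a \<in> carrier R" "s n = pw n +> a" "s (Suc n) = pw (Suc n) +> a"
      using s unfolding carrier_T_iff by blast
    obtain b where b: "b \<in> carrier R" "t n = pw n +> b" "t (Suc n) = pw (Suc n) +> b"
      using t unfolding carrier_T_iff by blast
    show "\<exists>r\<in>carrier R. s n \<oplus>\<^bsub>R Quot pw n\<^esub> t n = pw n +> r
        \<and> s (Suc n) \<oplus>\<^bsub>R Quot pw (Suc n)\<^esub> t (Suc n) = pw (Suc n) +> r"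
      unfolding a(2,3) b(2,3) coset_add[OF a(1) b(1)] using add.m_closed[OF a(1) b(1)] by blast
  qed
qed

lemma T_mult_closed: "s \<in> carrier T \<Longrightarrow> t \<in> carrier T \<Longrightarrow> s \<otimes>\<^bsub>T\<^esub> t \<in> carrier T"
proof -
  assume s: "s \<in> carrier T" and t: "t \<in> carrier T"
  show ?thesis unfolding carrier_T_iff T_mult
  proof
    fix n
    obtain a where a: "a \<in> carrier R" "s n = pw n +> a" "s (Suc n) = pw (Suc n) +> a"
      using s unfolding carrier_T_iff by blast
    obtain b where b: "b \<in> carrier R" "t n = pw n +> b" "t (Suc n) = pw (Suc n) +> b"
      using t unfolding carrier_T_iff by blast
    show "\<exists>r\<in>carrier R. s n \<otimes>\<^bsub>R Quot pw n\<^esub> t n = pw n +> r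
        \<and> s (Suc n) \<otimes>\<^bsub>R Quot pw (Suc n)\<^esub> t (Suc n) = pw (Suc n) +> r"
      unfolding a(2,3) b(2,3) coset_mult[OF a(1) b(1)] using m_closed[OF a(1) b(1)] by blast
  qed
qed

lemma T_cring: "cring T"
proof (rule cringI)
  show "abelian_group T"
  proof (rule abelian_groupI)
    fix s t assume "s \<in> carrier T" "t \<in> carrier T"
    then show "s \<oplus>\<^bsub>T\<^esub> t \<in> carrier T" by (rule T_add_closed)
  next
    show "\<zero>\<^bsub>T\<^esub> \<in> carrier T" unfolding T_zero_eq by (rule to_completion_closed) simp
  next
    fix s t u assume "s \<in> carrier T" "t \<in> carrier T" "u \<in> carrier T"
    note c = this[THEN T_carrier_quot]
    show "s \<oplus>\<^bsub>T\<^esub> t \<oplus>\<^bsub>T\<^esub> u = s \<oplus>\<^bsub>T\<^esub> (t \<oplus>\<^bsub>T\<^esub> u)"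
      by (rule ext) (simp add: T_add c ring.ring_simprules(7)[OF cring.axioms(1)[OF quot_cring]])
  next
    fix s t assume "s \<in> carrier T" "t \<in> carrier T"
    note c = this[THEN T_carrier_quot]
    show "s \<oplus>\<^bsub>T\<^esub> t = t \<oplus>\<^bsub>T\<^esub> s"
      by (rule ext) (simp add: T_add c ring.ring_simprules(10)[OF cring.axioms(1)[OF quot_cring]])
  next
    fix s assume "s \<in> carrier T"
    note c = this[THEN T_carrier_quot]
    show "\<zero>\<^bsub>T\<^esub> \<oplus>\<^bsub>T\<^esub> s = s"
      by (rule ext) (simp add: T_add T_zero c ring.ring_simprules(8)[OF cring.axioms(1)[OF quot_cring]])
  next
    fix s assume s: "s \<in> carrier T"
    have "\<forall>n. \<exists>r. r \<in> carrier R \<and> s n = pw n +> r \<and> s (Suc n) = pw (Suc n) +> r"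
      using s unfolding carrier_T_iff by blast
    from choice[OF this] obtain r where
      r: "\<forall>n. r n \<in> carrier R \<and> s n = pw n +> r n \<and> s (Suc n) = pw (Suc n) +> r n" by (rule exE)
    \<comment> \<open>The inverse is built from chosen representatives. The choices fit together
      because \<open>r n\<close> and \<open>r (Suc n)\<close> both represent
      \<open>s (Suc n)\<close>.\<close>
    define t where "t n = pw n +> (\<ominus> r n)" for n
    have t: "t (Suc n) = pw (Suc n) +> (\<ominus> r n)" for n
    proof -
      have c: "r n \<in> carrier R" "r (Suc n) \<in> carrier R" using r by blast+
      have "pw (Suc n) +> r n = pw (Suc n) +> r (Suc n)" using r by metis
      then have "r n \<ominus> r (Suc n) \<in> pw (Suc n)" using coset_eq_iff[OF pw_ideal c] by blast
      moreover have "\<ominus> r (Suc n) \<ominus> (\<ominus> r n) = r n \<ominus> r (Suc n)" using c by algebra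
      ultimately show ?thesis unfolding t_def using c by (subst coset_eq_iff[OF pw_ideal]) auto
    qed
    have "t \<in> carrier T" unfolding carrier_T_iff
    proof
      fix n
      show "\<exists>r\<in>carrier R. t n = pw n +> r \<and> t (Suc n) = pw (Suc n) +> r"
        by (rule bexI[of _ "\<ominus> r n"]) (use t t_def r in auto)
    qed
    moreover have "t \<oplus>\<^bsub>T\<^esub> s = \<zero>\<^bsub>T\<^esub>"
    proof (rule ext)
      fix n
      have c: "r n \<in> carrier R" "s n = pw n +> r n" using r by blast+
      have "(t \<oplus>\<^bsub>T\<^esub> s) n = pw n +> (\<ominus> r n \<oplus> r n)"
        unfolding T_add t_def c(2) by (rule coset_add) (use c in auto)
      also have "\<dots> = \<zero>\<^bsub>T\<^esub> n" using c(1) by (simp add: l_neg T_zero_eq to_completion_def)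
      finally show "(t \<oplus>\<^bsub>T\<^esub> s) n = \<zero>\<^bsub>T\<^esub> n" .
    qed
    ultimately show "\<exists>t\<in>carrier T. t \<oplus>\<^bsub>T\<^esub> s = \<zero>\<^bsub>T\<^esub>" by blast
  qed
  show "comm_monoid T"
  proof (rule comm_monoidI)
    fix s t assume "s \<in> carrier T" "t \<in> carrier T"
    then show "s \<otimes>\<^bsub>T\<^esub> t \<in> carrier T" by (rule T_mult_closed)
  next
    show "\<one>\<^bsub>T\<^esub> \<in> carrier T" unfolding T_one_eq by (rule to_completion_closed) simp
  next
    fix s t u assume "s \<in> carrier T" "t \<in> carrier T" "u \<in> carrier T"
    note c = this[THEN T_carrier_quot]
    show "s \<otimes>\<^bsub>T\<^esub> t \<otimes>\<^bsub>T\<^esub> u = s \<otimes>\<^bsub>T\<^esub> (t \<otimes>\<^bsub>T\<^esub> u)"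
      by (rule ext) (simp add: T_mult c ring.ring_simprules(11)[OF cring.axioms(1)[OF quot_cring]])
  next
    fix s t assume "s \<in> carrier T" "t \<in> carrier T"
    note c = this[THEN T_carrier_quot]
    show "s \<otimes>\<^bsub>T\<^esub> t = t \<otimes>\<^bsub>T\<^esub> s"
      by (rule ext) (simp add: T_mult c cring.cring_simprules(14)[OF quot_cring])
  next
    fix s assume "s \<in> carrier T"
    note c = this[THEN T_carrier_quot]
    show "\<one>\<^bsub>T\<^esub> \<otimes>\<^bsub>T\<^esub> s = s"
      by (rule ext) (simp add: T_mult T_one c cring.cring_simprules(12)[OF quot_cring])
  qed
  fix s t u assume "s \<in> carrier T" "t \<in> carrier T" "u \<in> carrier T"
  note c = this[THEN T_carrier_quot]
  show "(s \<oplus>\<^bsub>T\<^esub> t) \<otimes>\<^bsub>T\<^esub> u = s \<otimes>\<^bsub>T\<^esub> u \<oplus>\<^bsub>T\<^esub> t \<otimes>\<^bsub>T\<^esub> u"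
    by (rule ext) (simp add: T_mult T_add c cring.cring_simprules(13)[OF quot_cring])
qed

lemma to_completion_hom: "ring_hom_cring R T (to_completion R I)"
proof -
  have "to_completion R I \<in> ring_hom R T"
  proof (rule ring_hom_memI)
    fix a b assume "a \<in> carrier R" "b \<in> carrier R"
    then show "to_completion R I (a \<otimes> b) = to_completion R I a \<otimes>\<^bsub>T\<^esub> to_completion R I b"
      "to_completion R I (a \<oplus> b) = to_completion R I a \<oplus>\<^bsub>T\<^esub> to_completion R I b"
      by (auto simp: fun_eq_iff T_mult T_add to_completion_def coset_mult coset_add)
  qed (simp_all add: to_completion_closed T_one_eq)
  then show ?thesis
    by (simp add: ring_hom_cring_def ring_hom_cring_axioms_def is_cring T_cring)
qed

lemma monomial_to_completion:
  assumes "y \<in> J \<rightarrow> carrier R"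
  shows "monomial T J (\<lambda>l. to_completion R I (y l)) K = to_completion R I (monomial R J y K)"
proof -
  interpret T: cring T by (rule T_cring)
  interpret h: ring_hom_cring R T "to_completion R I" by (rule to_completion_hom)
  have pow: "to_completion R I (a [^] (k::nat)) = to_completion R I a [^]\<^bsub>T\<^esub> k" if "a \<in> carrier R" for a k
    by (induction k) (simp_all add: that h.hom_mult)
  have "to_completion R I (monomial R J y K) = (\<Otimes>\<^bsub>T\<^esub>l\<in>J. (to_completion R I \<circ> (\<lambda>l. y l [^] K l)) l)"
    unfolding monomial_def by (rule h.hom_finprod) (use assms in auto)
  also have "\<dots> = monomial T J (\<lambda>l. to_completion R I (y l)) K"
    unfolding monomial_def
    by (rule T.finprod_cong) (use assms to_completion_closed in \<open>auto simp: pow Pi_iff simp_implies_def\<close>)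
  finally show ?thesis ..
qed

text \<open>The representatives are required at level \<open>n\<close> alone and may depend on
  \<open>n\<close>, so truncations of infinite sums can be computed in \<open>R\<close>.\<close>

lemma T_finsum_coset:
  assumes "finite F" "\<And>i. i \<in> F \<Longrightarrow> t i \<in> carrier T"
    "\<And>i. i \<in> F \<Longrightarrow> r i \<in> carrier R" "\<And>i. i \<in> F \<Longrightarrow> t i n = pw n +> r i"
  shows "finsum T t F n = pw n +> finsum R r F"
  using assms
proof (induction F rule: finite_induct)
  case empty
  interpret T: cring T by (rule T_cring)
  show ?case by (simp add: T_zero_eq to_completion_def)
next
  case (insert i F)
  interpret T: cring T by (rule T_cring)
  have "finsum T t (insert i F) = t i \<oplus>\<^bsub>T\<^esub> finsum T t F"
    by (rule T.finsum_insert[OF insert.hyps]) (use insert.prems in auto)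
  moreover have "finsum R r (insert i F) = r i \<oplus> finsum R r F"
    by (rule finsum_insert[OF insert.hyps]) (use insert.prems in auto)
  moreover have "finsum R r F \<in> carrier R" by (rule finsum_closed) (use insert.prems in auto)
  ultimately show ?case using insert.IH insert.prems by (simp add: T_add coset_add)
qed

text \<open>The weight \<open>w\<close> measures the order of the terms. At level \<open>n\<close>
  the terms of weight at least \<open>n\<close> vanish, so all finite sums over sets containing the
  finitely many lighter indices coincide, and the limit of the net is read off from the lighter
  indices.\<close>

lemma has_sum_iff:
  assumes t: "\<And>i. i \<in> A \<Longrightarrow> t i \<in> carrier T"
    and fin: "\<And>n. finite {i \<in> A. w i < n}"
    and small: "\<And>i n. i \<in> A \<Longrightarrow> n \<le> w i \<Longrightarrow> t i n = pw n +> \<zero>"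
  shows "completion_has_sum R I t A s \<longleftrightarrow>
    s \<in> carrier T \<and> (\<forall>n. s n = finsum T t {i \<in> A. (w i :: nat) < n} n)"
proof -
  interpret T: cring T by (rule T_cring)
  have stable: "finsum T t F n = finsum T t {i \<in> A. w i < n} n"
    if F: "finite F" "{i \<in> A. w i < n} \<subseteq> F" "F \<subseteq> A" for F n
  proof -
    let ?F0 = "{i \<in> A. w i < n}"
    have c: "finsum T t ?F0 \<in> carrier T" by (rule T.finsum_closed) (use t in auto)
    have "F = ?F0 \<union> (F - ?F0)" using F by blast
    then have "finsum T t F = finsum T t (?F0 \<union> (F - ?F0))" by (rule arg_cong)
    also have "\<dots> = finsum T t ?F0 \<oplus>\<^bsub>T\<^esub> finsum T t (F - ?F0)"
      by (rule T.finsum_Un_disjoint) (use F t fin in auto)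
    finally have "finsum T t F n = finsum T t ?F0 n \<oplus>\<^bsub>R Quot pw n\<^esub> finsum T t (F - ?F0) n"
      by (simp add: T_add)
    also have "finsum T t (F - ?F0) n = pw n +> finsum R (\<lambda>_. \<zero>) (F - ?F0)"
    proof (rule T_finsum_coset)
      fix i assume "i \<in> F - ?F0"
      then have i: "i \<in> A" "n \<le> w i" using F(3) by auto
      show "t i \<in> carrier T" by (rule t[OF i(1)])
      show "t i n = pw n +> \<zero>" by (rule small[OF i])
    qed (use F(1) in auto)
    also have "finsum R (\<lambda>_. \<zero>) (F - ?F0) = \<zero>" by simp
    finally have e: "finsum T t F n = finsum T t ?F0 n \<oplus>\<^bsub>R Quot pw n\<^esub> (pw n +> \<zero>)" .
    obtain r where r: "r \<in> carrier R" "finsum T t ?F0 n = pw n +> r"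
      using c by (rule carrier_T_E)
    show ?thesis unfolding e r(2) using coset_add[OF r(1) zero_closed] r(1) by simp
  qed
  show ?thesis
  proof
    assume hs: "completion_has_sum R I t A s"
    have "s n = finsum T t {i \<in> A. w i < n} n" for n
    proof -
      obtain F0 where F0: "finite F0" "F0 \<subseteq> A"
        "\<And>F. finite F \<Longrightarrow> F0 \<subseteq> F \<Longrightarrow> F \<subseteq> A \<Longrightarrow> finsum T t F n = s n"
        using hs unfolding completion_has_sum_def by meson
      let ?F = "F0 \<union> {i \<in> A. w i < n}"
      have F: "finite ?F" "{i \<in> A. w i < n} \<subseteq> ?F" "?F \<subseteq> A" "F0 \<subseteq> ?F" using F0(1,2) fin by auto
      show ?thesis using F0(3)[OF F(1,4,3)] stable[OF F(1-3)] by simp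
    qed
    then show "s \<in> carrier T \<and> (\<forall>n. s n = finsum T t {i \<in> A. w i < n} n)"
      using hs unfolding completion_has_sum_def by blast
  next
    assume s: "s \<in> carrier T \<and> (\<forall>n. s n = finsum T t {i \<in> A. w i < n} n)"
    show "completion_has_sum R I t A s"
      unfolding completion_has_sum_def
    proof (intro conjI allI)
      show "t ` A \<subseteq> carrier T" using t by blast
      show "s \<in> carrier T" using s by blast
      fix n
      show "\<exists>F\<^sub>0. finite F\<^sub>0 \<and> F\<^sub>0 \<subseteq> A \<and>
          (\<forall>F. finite F \<and> F\<^sub>0 \<subseteq> F \<and> F \<subseteq> A \<longrightarrow> finsum T t F n = s n)"
      proof (intro exI[of _ "{i \<in> A. w i < n}"] conjI allI impI)
        fix F assume "finite F \<and> {i \<in> A. w i < n} \<subseteq> F \<and> F \<subseteq> A"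
        then show "finsum T t F n = s n" using stable[of F n] s by simp
      qed (use fin in auto)
    qed
  qed
qed

end

section \<open>Expansions in powers of \<open>h\<close>\<close>

text \<open>Products of initial forms are well defined, because \<open>f \<otimes> f' \<ominus> g
  \<otimes> g' = (f \<ominus> g) \<otimes> f' \<oplus> g \<otimes> (f' \<ominus>
  g')\<close>.\<close>

lemma (in cring) mult_cong_ideal_pow:
  assumes I: "ideal I R"
    and f: "f \<in> ideal_pow R I w" "g \<in> ideal_pow R I w" "f \<ominus> g \<in> ideal_pow R I (Suc w)"
    and f': "f' \<in> ideal_pow R I w'" "g' \<in> ideal_pow R I w'" "f' \<ominus> g' \<in> ideal_pow R I (Suc w')"
  shows "f \<otimes> f' \<ominus> g \<otimes> g' \<in> ideal_pow R I (Suc (w + w'))"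
proof -
  note c = ideal_subset_carrier[OF ideal_pow_ideal[OF I]]
  have "f \<otimes> f' \<ominus> g \<otimes> g' = (f \<ominus> g) \<otimes> f' \<oplus> g \<otimes> (f' \<ominus> g')"
    using c[OF f(1)] c[OF f(2)] c[OF f'(1)] c[OF f'(2)] by algebra
  moreover have "(f \<ominus> g) \<otimes> f' \<in> ideal_pow R I (Suc (w + w'))"
    using ideal_pow_mult[OF I f(3) f'(1)] by (simp del: ideal_pow.simps)
  moreover have "g \<otimes> (f' \<ominus> g') \<in> ideal_pow R I (Suc (w + w'))"
    using ideal_pow_mult[OF I f(2) f'(3)] by (simp del: ideal_pow.simps)
  ultimately show ?thesis using ideal_add_closed[OF ideal_pow_ideal[OF I]] by metis
qed

lemma (in cring) nat_pow_cong_ideal_pow: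
  assumes I: "ideal I R"
    and f: "f \<in> ideal_pow R I w" "g \<in> ideal_pow R I w" "f \<ominus> g \<in> ideal_pow R I (Suc w)"
  shows "f [^] (b::nat) \<in> ideal_pow R I (w * b) \<and> g [^] b \<in> ideal_pow R I (w * b) \<and>
    f [^] b \<ominus> g [^] b \<in> ideal_pow R I (Suc (w * b))"
proof (induction b)
  case 0
  have "\<one> \<ominus> \<one> = \<zero>" by algebra
  then have "\<one> \<ominus> \<one> \<in> ideal_pow R I (Suc 0)" using ideal_zero_closed[OF ideal_pow_ideal[OF I]] by (simp only:)
  then show ?case by (simp del: ideal_pow.simps(2))
next
  case (Suc b)
  have e: "w * Suc b = w * b + w" by simp
  show ?case
    unfolding nat_pow_Suc e
    using Suc.IH ideal_pow_mult[OF I _ f(1), of "f [^] b"] ideal_pow_mult[OF I _ f(2), of "g [^] b"]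
      mult_cong_ideal_pow[OF I, of "f [^] b" "w * b" "g [^] b" f w g] f by blast
qed

lemma (in cring) finprod_cong_ideal_pow:
  assumes I: "ideal I R" and fin: "finite J"
    and f: "\<And>l. l \<in> J \<Longrightarrow> f l \<in> ideal_pow R I (w l)" "\<And>l. l \<in> J \<Longrightarrow> g l \<in> ideal_pow R I (w l)"
      "\<And>l. l \<in> J \<Longrightarrow> f l \<ominus> g l \<in> ideal_pow R I (Suc (w l))"
  shows "(\<Otimes>l\<in>J. f l) \<ominus> (\<Otimes>l\<in>J. g l) \<in> ideal_pow R I (Suc (\<Sum>l\<in>J. w l))"
  using fin f
proof (induction J rule: finite_induct)
  case empty
  have "\<one> \<ominus> \<one> = \<zero>" by algebra
  then have "\<one> \<ominus> \<one> \<in> ideal_pow R I (Suc 0)" using ideal_zero_closed[OF ideal_pow_ideal[OF I]] by (simp only:)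
  then show ?case by (simp del: ideal_pow.simps)
next
  case (insert l J)
  note c = ideal_subset_carrier[OF ideal_pow_ideal[OF I]]
  have e: "(\<Otimes>l\<in>insert l J. f l) = f l \<otimes> (\<Otimes>l\<in>J. f l)" "(\<Otimes>l\<in>insert l J. g l) = g l \<otimes> (\<Otimes>l\<in>J. g l)"
    by (rule finprod_insert[OF insert.hyps]; use insert.prems c in blast)+
  have "(\<Otimes>l\<in>J. f l) \<in> ideal_pow R I (\<Sum>l\<in>J. w l)" "(\<Otimes>l\<in>J. g l) \<in> ideal_pow R I (\<Sum>l\<in>J. w l)"
    by (rule ideal_pow_finprod[OF I insert.hyps(1)]; use insert.prems in simp)+
  moreover have "(\<Otimes>l\<in>J. f l) \<ominus> (\<Otimes>l\<in>J. g l) \<in> ideal_pow R I (Suc (\<Sum>l\<in>J. w l))"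
    by (rule insert.IH) (use insert.prems in simp_all)
  ultimately have "f l \<otimes> (\<Otimes>l\<in>J. f l) \<ominus> g l \<otimes> (\<Otimes>l\<in>J. g l) \<in> ideal_pow R I (Suc (w l + (\<Sum>l\<in>J. w l)))"
    by (intro mult_cong_ideal_pow[OF I] insert.prems insertI1)
  then show ?case unfolding e using insert.hyps by simp
qed

text \<open>The algebra left after the geometry has been used: \<open>lead_0\<close> is the
  independence of the monomials, and \<open>h_cong\<close> says that \<open>h l\<close> and
  \<open>x l [^] q l\<close> agree to leading order, with \<open>q l\<close> any positive
  integer.\<close>

locale parameter_expansion = residually_rational_local_ring +
  fixes N :: nat and q :: "nat \<Rightarrow> nat" and h :: "nat \<Rightarrow> 'a"
  assumes lead_0: "lead {\<zero>} = {}"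
    and N_le: "N \<le> d"
    and q_pos: "l \<in> {1..N} \<Longrightarrow> q l > 0"
    and h_closed: "h \<in> {1..N} \<rightarrow> carrier R"
    and h_cong: "l \<in> {1..N} \<Longrightarrow> h l \<ominus> x l [^] q l \<in> mpow (Suc (q l))"
begin

sublocale adic_cring R m
  by (rule adic_cring.intro[OF is_cring adic_cring_axioms.intro[OF m_ideal]])

abbreviation EN where "EN \<equiv> exponents {1..N}"
abbreviation EM where "EM \<equiv> exponents {N+1..d}"
abbreviation KR where "KR \<equiv> K_range d N q"
abbreviation hm where "hm B \<equiv> monomial R {1..N} h B"
definition qexp where "qexp B = (\<lambda>l. q l * B l)" for B :: "nat \<Rightarrow> nat"
text \<open>Together with the three maps below, a bijection between the triples indexing an
  expansion and all exponents: division with remainder by \<open>q l\<close> for \<open>l\<close> up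
  to \<open>N\<close>, the exponent itself beyond. The value 0 elsewhere keeps the parts inside
  their sets of exponents.\<close>

definition enc where "enc B K L = (\<lambda>l. qexp B l + (K l + L l))" for B K L :: "nat \<Rightarrow> nat"
definition decB where "decB \<alpha> = (\<lambda>l. if l \<in> {1..N} then \<alpha> l div q l else 0)"
definition decK where "decK \<alpha> = (\<lambda>l. if l \<in> {1..N} then \<alpha> l mod q l else 0)"
definition decL where "decL \<alpha> = (\<lambda>l. if l \<in> {N+1..d} then \<alpha> l else 0)" for \<alpha> :: "nat \<Rightarrow> nat"
definition trm where "trm B K L = hm B \<otimes> (xm K \<otimes> xm L)"
definition G where "G \<alpha> = trm (decB \<alpha>) (decK \<alpha>) (decL \<alpha>)"

lemma hm_closed [simp]: "hm B \<in> carrier R" by (rule monomial_closed[OF h_closed])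

lemma trm_closed [simp]: "trm B K L \<in> carrier R" unfolding trm_def by simp

lemma G_closed [simp]: "G \<alpha> \<in> carrier R" unfolding G_def by simp

lemma EN_E: "B \<in> EN \<Longrightarrow> B \<in> E"
  using N_le by (auto simp: exponents_def)

lemma EM_E: "L \<in> EM \<Longrightarrow> L \<in> E"
  by (simp add: exponents_def)

lemma KR_E: "K \<in> KR \<Longrightarrow> K \<in> E"
  by (simp add: K_range_def)

lemma KR_less: "K \<in> KR \<Longrightarrow> l \<in> {1..N} \<Longrightarrow> K l < q l"
  using q_pos[of l] by (force simp: K_range_def)

lemma KR_0: "K \<in> KR \<Longrightarrow> l \<notin> {1..N} \<Longrightarrow> K l = 0"
  by (cases "l \<in> {1..d}") (auto simp: K_range_def exponents_def)

lemma qexp_EN: "B \<in> EN \<Longrightarrow> qexp B \<in> EN"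
  by (simp add: exponents_def qexp_def)

lemma enc_E: "B \<in> EN \<Longrightarrow> K \<in> KR \<Longrightarrow> L \<in> EM \<Longrightarrow> enc B K L \<in> E"
  unfolding enc_def by (intro exponents_add EN_E qexp_EN KR_E EM_E)

lemma dec_in:
  assumes "\<alpha> \<in> E" shows "decB \<alpha> \<in> EN" "decK \<alpha> \<in> KR" "decL \<alpha> \<in> EM"
proof -
  show "decB \<alpha> \<in> EN" "decL \<alpha> \<in> EM" by (simp_all add: exponents_def decB_def decL_def)
  have "\<alpha> l mod q l \<le> q l - 1" if "l \<in> {1..N}" for l
    using mod_less_divisor[OF q_pos[OF that], of "\<alpha> l"] by linarith
  then show "decK \<alpha> \<in> KR" using N_le by (simp add: K_range_def exponents_def decK_def)
qed

lemma enc_dec: "\<alpha> \<in> E \<Longrightarrow> enc (decB \<alpha>) (decK \<alpha>) (decL \<alpha>) = \<alpha>"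
proof
  fix l assume \<alpha>: "\<alpha> \<in> E"
  show "enc (decB \<alpha>) (decK \<alpha>) (decL \<alpha>) l = \<alpha> l"
  proof (cases "l \<in> {1..N}")
    case True
    then have "l \<notin> {N+1..d}" by simp
    then show ?thesis using True by (simp add: enc_def qexp_def decB_def decK_def decL_def)
  next
    case False
    have "l \<notin> {N+1..d} \<Longrightarrow> \<alpha> l = 0" using \<alpha> False unfolding exponents_def by auto
    then show ?thesis using False by (auto simp: enc_def qexp_def decB_def decK_def decL_def)
  qed
qed

text \<open>On \<open>{1..N}\<close> the exponent is \<open>q l * B l + K l\<close> with
  \<open>K l < q l\<close>, elsewhere it is \<open>L l\<close>, so no part can be traded for
  another. This is where the range of \<open>K\<close> matters for uniqueness.\<close>

lemma dec_enc:
  assumes "B \<in> EN" "K \<in> KR" "L \<in> EM"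
  shows "decB (enc B K L) = B" "decK (enc B K L) = K" "decL (enc B K L) = L"
proof -
  have L0: "L l = 0" if "l \<notin> {N+1..d}" for l using assms(3) that unfolding exponents_def by blast
  have B0: "B l = 0" if "l \<notin> {1..N}" for l using assms(1) that unfolding exponents_def by blast
  have lo: "enc B K L l = q l * B l + K l" if "l \<in> {1..N}" for l
    unfolding enc_def qexp_def using L0[of l] that by simp
  have hi: "enc B K L l = L l" if "l \<notin> {1..N}" for l
    unfolding enc_def qexp_def using B0[OF that] KR_0[OF assms(2) that] by simp
  have div: "(q l * B l + K l) div q l = B l" and mod: "(q l * B l + K l) mod q l = K l" if "l \<in> {1..N}" for l
    using KR_less[OF assms(2) that] by simp_all
  show "decB (enc B K L) = B"
    by (rule ext) (simp add: decB_def lo div B0 del: atLeastAtMost_iff)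
  show "decK (enc B K L) = K"
    by (rule ext) (simp add: decK_def lo mod_less[OF KR_less[OF assms(2)]] KR_0[OF assms(2)] del: atLeastAtMost_iff)
  show "decL (enc B K L) = L"
  proof (rule ext)
    fix l
    show "decL (enc B K L) l = L l"
    proof (cases "l \<in> {N+1..d}")
      case True
      then have "l \<notin> {1..N}" by simp
      then show ?thesis using True hi by (simp add: decL_def del: atLeastAtMost_iff)
    next
      case False
      then show ?thesis using L0 by (simp add: decL_def del: atLeastAtMost_iff)
    qed
  qed
qed

lemma mdeg_enc: "mdeg d (enc B K L) = mdeg d (qexp B) + (mdeg d K + mdeg d L)"
  unfolding enc_def mdeg_add ..

lemma monomial_restrict:
  assumes "J \<subseteq> {1..d}" "\<alpha> \<in> exponents J"
  shows "monomial R J x \<alpha> = xm \<alpha>"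
  unfolding monomial_def
proof (rule finprod_mono_neutral_cong_left[OF _ assms(1)])
  show "x i [^] \<alpha> i = \<one>" if "i \<in> {1..d} - J" for i
    using assms(2) that by (simp add: exponents_def)
  show "(\<lambda>l. x l [^] \<alpha> l) \<in> {1..d} \<rightarrow> carrier R" using x_closed by auto
qed simp_all

lemma mdeg_restrict: "B \<in> EN \<Longrightarrow> mdeg d B = (\<Sum>l\<in>{1..N}. B l)"
  unfolding mdeg_def using N_le
  by (intro sum.mono_neutral_right) (auto simp: exponents_def)

lemma x_closed_N: "l \<in> {1..N} \<Longrightarrow> x l \<in> carrier R"
  using N_le by (intro funcset_mem[OF x_closed]) simp

lemma x_pow_in: "l \<in> {1..N} \<Longrightarrow> x l [^] q l \<in> mpow (q l)"
  using x_in_m N_le by (intro ideal_pow_nat_pow[OF m_ideal]) auto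

lemma h_in: "l \<in> {1..N} \<Longrightarrow> h l \<in> mpow (q l)"
proof -
  assume l: "l \<in> {1..N}"
  have "h l \<ominus> x l [^] q l \<in> mpow (q l)"
    using h_cong[OF l] ideal_pow_Suc_subset[OF m_ideal] by blast
  then show ?thesis
    by (rule ideal_of_diff[OF mpow_ideal _ x_pow_in[OF l]]) (use h_closed l in auto)
qed

lemma hm_cong:
  assumes B: "B \<in> EN"
  shows "hm B \<in> mpow (mdeg d (qexp B))" "hm B \<ominus> xm (qexp B) \<in> mpow (Suc (mdeg d (qexp B)))"
proof -
  have deg: "mdeg d (qexp B) = (\<Sum>l\<in>{1..N}. q l * B l)"
    unfolding mdeg_restrict[OF qexp_EN[OF B]] by (simp add: qexp_def)
  note pc = nat_pow_cong_ideal_pow[OF m_ideal h_in x_pow_in h_cong]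
  have "xm (qexp B) = monomial R {1..N} x (qexp B)"
    by (rule monomial_restrict[symmetric, OF _ qexp_EN[OF B]]) (use N_le in auto)
  also have "\<dots> = (\<Otimes>l\<in>{1..N}. (x l [^] q l) [^] B l)"
    unfolding monomial_def qexp_def
  proof (rule finprod_cong')
    show "x l [^] (q l * B l) = (x l [^] q l) [^] B l" if "l \<in> {1..N}" for l
      using x_closed_N[OF that] by (simp add: nat_pow_pow)
    show "(\<lambda>l. (x l [^] q l) [^] B l) \<in> {1..N} \<rightarrow> carrier R"
      by (intro funcsetI nat_pow_closed x_closed_N)
  qed simp
  finally have X: "xm (qexp B) = (\<Otimes>l\<in>{1..N}. (x l [^] q l) [^] B l)" .
  show "hm B \<in> mpow (mdeg d (qexp B))"
    unfolding monomial_def deg by (rule ideal_pow_finprod[OF m_ideal]) (use pc in auto)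
  show "hm B \<ominus> xm (qexp B) \<in> mpow (Suc (mdeg d (qexp B)))"
    unfolding X unfolding monomial_def deg
    by (rule finprod_cong_ideal_pow[OF m_ideal]) (use pc in \<open>auto simp del: ideal_pow.simps\<close>)
qed

lemma trm_cong:
  assumes "B \<in> EN"
  shows "trm B K L \<in> mpow (mdeg d (enc B K L))"
    "trm B K L \<ominus> xm (enc B K L) \<in> mpow (Suc (mdeg d (enc B K L)))"
proof -
  have X: "xm (enc B K L) = xm (qexp B) \<otimes> (xm K \<otimes> xm L)" unfolding enc_def xm_add ..
  have KL: "xm K \<otimes> xm L \<in> mpow (mdeg d K + mdeg d L)"
    by (rule ideal_pow_mult[OF m_ideal xm_in_mpow xm_in_mpow])
  have "xm K \<otimes> xm L \<ominus> xm K \<otimes> xm L = \<zero>" using xm_closed[of K] xm_closed[of L] by algebra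
  then have KL0: "xm K \<otimes> xm L \<ominus> xm K \<otimes> xm L \<in> mpow (Suc (mdeg d K + mdeg d L))"
    using ideal_zero_closed[OF mpow_ideal] by (simp only:)
  show "trm B K L \<in> mpow (mdeg d (enc B K L))"
    unfolding trm_def mdeg_enc by (rule ideal_pow_mult[OF m_ideal hm_cong(1)[OF assms] KL])
  show "trm B K L \<ominus> xm (enc B K L) \<in> mpow (Suc (mdeg d (enc B K L)))"
    unfolding trm_def X mdeg_enc
    by (rule mult_cong_ideal_pow[OF m_ideal hm_cong(1)[OF assms] xm_in_mpow hm_cong(2)[OF assms] KL KL KL0])
qed

lemma G_in: "\<alpha> \<in> E \<Longrightarrow> G \<alpha> \<in> mpow (mdeg d \<alpha>)"
  using trm_cong(1)[OF dec_in(1), of \<alpha> "decK \<alpha>" "decL \<alpha>"] by (simp add: G_def enc_dec)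

lemma G_cong: "\<alpha> \<in> E \<Longrightarrow> G \<alpha> \<ominus> xm \<alpha> \<in> V (above \<alpha>)"
  using trm_cong(2)[OF dec_in(1), of \<alpha> "decK \<alpha>" "decL \<alpha>"] mpow_subset_above[of \<alpha> "Suc (mdeg d \<alpha>)"]
  by (auto simp: G_def enc_dec simp del: ideal_pow.simps)

abbreviation Gsum where "Gsum c n \<equiv> (\<Oplus>\<alpha>\<in>Edeg n. \<iota> (c \<alpha>) \<otimes> G \<alpha>)"

lemma Gsum_closed [simp]: "Gsum c n \<in> carrier R"
  by (rule lincomb_closed) simp

lemma zero_add_mpow: "a \<in> {\<zero>} <+>\<^bsub>R\<^esub> mpow n \<longleftrightarrow> a \<in> mpow n"
  unfolding mem_set_add using ideal_subset_carrier[OF mpow_ideal] by auto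

text \<open>The case of the zero ideal, for which \<open>lead_0\<close> makes every exponent
  standard.\<close>

lemma Gsum_exists:
  assumes "r \<in> carrier R" shows "\<exists>c. r \<ominus> Gsum c n \<in> mpow n"
  using span_modulo[OF zeroideal G_closed G_cong assms, of n] unfolding lead_0 zero_add_mpow by simp

lemma Gsum_unique:
  assumes "Gsum a n \<ominus> Gsum b n \<in> mpow n" "\<alpha> \<in> Edeg n"
  shows "a \<alpha> = b \<alpha>"
proof -
  have "Gsum a n \<ominus> Gsum b n = Gsum (\<lambda>\<alpha>. a \<alpha> - b \<alpha>) n" by (rule lincomb_diff) simp
  then have "Gsum (\<lambda>\<alpha>. a \<alpha> - b \<alpha>) n \<in> {\<zero>} <+>\<^bsub>R\<^esub> mpow n" using assms(1) unfolding zero_add_mpow by simp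
  then have "a \<alpha> - b \<alpha> = 0"
    using independent_modulo[OF zeroideal G_closed G_cong, of "\<lambda>\<alpha>. a \<alpha> - b \<alpha>" n \<alpha>] assms(2)
    unfolding lead_0 by simp
  then show ?thesis by simp
qed

lemma Gsum_subset:
  assumes A: "finite A" "A \<subseteq> E" "Edeg n \<subseteq> A"
  shows "(\<Oplus>\<alpha>\<in>A. \<iota> (c \<alpha>) \<otimes> G \<alpha>) \<ominus> Gsum c n \<in> mpow n"
proof -
  define rest where "rest = (\<Oplus>\<alpha>\<in>A - Edeg n. \<iota> (c \<alpha>) \<otimes> G \<alpha>)"
  have "rest \<in> mpow n"
    unfolding rest_def
  proof (rule ideal_finsum_closed[OF mpow_ideal])
    fix \<alpha> assume "\<alpha> \<in> A - Edeg n"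
    then have \<alpha>: "\<alpha> \<in> E" "n \<le> mdeg d \<alpha>" using A(2) by auto
    have "G \<alpha> \<in> mpow n" using G_in[OF \<alpha>(1)] ideal_pow_antimono[OF m_ideal \<alpha>(2)] by blast
    then show "\<iota> (c \<alpha>) \<otimes> G \<alpha> \<in> mpow n" by (rule ideal.I_l_closed[OF mpow_ideal _ \<iota>_closed])
  qed
  moreover have "(\<Oplus>\<alpha>\<in>A. \<iota> (c \<alpha>) \<otimes> G \<alpha>) = Gsum c n \<oplus> rest"
  proof -
    have "A = Edeg n \<union> (A - Edeg n)" using A(3) by blast
    then have "(\<Oplus>\<alpha>\<in>A. \<iota> (c \<alpha>) \<otimes> G \<alpha>) = (\<Oplus>\<alpha>\<in>Edeg n \<union> (A - Edeg n). \<iota> (c \<alpha>) \<otimes> G \<alpha>)" by (rule arg_cong)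
    also have "\<dots> = Gsum c n \<oplus> rest"
      unfolding rest_def by (rule finsum_Un_disjoint) (use A(1) finite_mdeg_less in auto)
    finally show ?thesis .
  qed
  moreover have "s \<oplus> r \<ominus> s = r" if "s \<in> carrier R" "r \<in> carrier R" for s r using that by algebra
  ultimately show ?thesis using ideal_subset_carrier[OF mpow_ideal] by simp
qed

text \<open>At level \<open>n\<close> the coefficients in degrees below \<open>n\<close> exist and
  are unique. Uniqueness makes the levels agree, so the coefficients glue to one family.\<close>

lemma expansion_exists_unique:
  assumes f: "f \<in> carrier T"
  shows "\<exists>c. \<forall>n. f n = mpow n +> Gsum c n"
    and "\<lbrakk>\<forall>n. f n = mpow n +> Gsum a n; \<forall>n. f n = mpow n +> Gsum b n; \<alpha> \<in> E\<rbrakk> \<Longrightarrow> a \<alpha> = b \<alpha>"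
proof -
  have "\<exists>c. f n = mpow n +> Gsum c n \<and> f (Suc n) = mpow (Suc n) +> Gsum c (Suc n)" for n
  proof -
    obtain r where r: "r \<in> carrier R" "f n = mpow n +> r" "f (Suc n) = mpow (Suc n) +> r"
      using f unfolding carrier_T_iff by blast
    \<comment> \<open>Coefficients found for level \<open>Suc n\<close> also serve level
      \<open>n\<close>, since the extra terms lie in \<open>mpow n\<close>.\<close>
    obtain c where c: "r \<ominus> Gsum c (Suc n) \<in> mpow (Suc n)" using Gsum_exists[OF r(1)] by blast
    have "r \<ominus> Gsum c (Suc n) \<in> mpow n" using c ideal_pow_Suc_subset[OF m_ideal] by blast
    moreover have "Gsum c (Suc n) \<ominus> Gsum c n \<in> mpow n"
      by (rule Gsum_subset[OF finite_mdeg_less]) auto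
    ultimately have "(r \<ominus> Gsum c (Suc n)) \<oplus> (Gsum c (Suc n) \<ominus> Gsum c n) \<in> mpow n"
      by (rule ideal_add_closed[OF mpow_ideal])
    moreover have "(r \<ominus> s) \<oplus> (s \<ominus> t) = r \<ominus> t" if "s \<in> carrier R" "t \<in> carrier R" for s t
      using that r(1) by algebra
    note this[OF Gsum_closed Gsum_closed]
    ultimately have "r \<ominus> Gsum c n \<in> mpow n" by (simp only:)
    then show ?thesis
      unfolding r(2,3) coset_eq_iff[OF mpow_ideal r(1) Gsum_closed]
      using c by (intro exI[of _ c] conjI)
  qed
  then have "\<forall>n. \<exists>c. f n = mpow n +> Gsum c n \<and> f (Suc n) = mpow (Suc n) +> Gsum c (Suc n)" by blast
  from choice[OF this] obtain c where
    c: "\<forall>n. f n = mpow n +> Gsum (c n) n \<and> f (Suc n) = mpow (Suc n) +> Gsum (c n) (Suc n)" by (rule exE)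
  have uniq: "a \<alpha> = b \<alpha>" if "f n = mpow n +> Gsum a n" "f n = mpow n +> Gsum b n" "\<alpha> \<in> Edeg n" for a b n \<alpha>
  proof (rule Gsum_unique[OF _ that(3)])
    show "Gsum a n \<ominus> Gsum b n \<in> mpow n"
      using that(1,2) unfolding coset_eq_iff[OF mpow_ideal Gsum_closed Gsum_closed, symmetric] by simp
  qed
  show "a \<alpha> = b \<alpha>" if "\<forall>n. f n = mpow n +> Gsum a n" "\<forall>n. f n = mpow n +> Gsum b n" "\<alpha> \<in> E"
    using uniq[OF spec[OF that(1)] spec[OF that(2)], of \<alpha> "Suc (mdeg d \<alpha>)"] that(3) by simp
  \<comment> \<open>\<open>c n\<close> represents \<open>f\<close> at level \<open>Suc n\<close> as
    well, so it is already right in degree \<open>n\<close>, and the coefficient of \<alpha> settles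
    at index \<open>mdeg d \<alpha>\<close>.\<close>
  have step: "c (Suc n) \<alpha> = c n \<alpha>" if "\<alpha> \<in> Edeg (Suc n)" for n \<alpha>
    by (rule uniq[OF conjunct1[OF spec[OF c]] conjunct2[OF spec[OF c]] that])
  have stable: "c (mdeg d \<alpha> + k) \<alpha> = c (mdeg d \<alpha>) \<alpha>" if "\<alpha> \<in> E" for \<alpha> k
  proof (induction k)
    case (Suc k)
    then show ?case using step[of \<alpha> "mdeg d \<alpha> + k"] that by simp
  qed simp
  have "f n = mpow n +> Gsum (\<lambda>\<alpha>. c (mdeg d \<alpha>) \<alpha>) n" for n
  proof -
    have "Gsum (\<lambda>\<alpha>. c (mdeg d \<alpha>) \<alpha>) n = Gsum (c n) n"
    proof (rule finsum_cong'[OF refl])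
      fix \<alpha> assume "\<alpha> \<in> Edeg n"
      then have "c n \<alpha> = c (mdeg d \<alpha>) \<alpha>" using stable[of \<alpha> "n - mdeg d \<alpha>"] by simp
      then show "\<iota> (c (mdeg d \<alpha>) \<alpha>) \<otimes> G \<alpha> = \<iota> (c n \<alpha>) \<otimes> G \<alpha>" by simp
    qed simp
    then show ?thesis using conjunct1[OF spec[OF c, of n]] by (simp only:)
  qed
  then show "\<exists>c. \<forall>n. f n = mpow n +> Gsum c n"
    by (intro exI[of _ "\<lambda>\<alpha>. c (mdeg d \<alpha>) \<alpha>"] allI)
qed

end

context parameter_expansion
begin

section \<open>Truncated expansions\<close>

abbreviation ser_deg where "ser_deg n \<equiv> {L \<in> EM. mdeg d L < n}"
definition ser where "ser c n = (\<Oplus>L\<in>ser_deg n. \<iota> (c L) \<otimes> xm L)"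

lemma finite_ser_deg: "finite (ser_deg n)"
  by (rule finite_subset[OF _ finite_mdeg_less[of d n]]) (auto dest: EM_E)

lemma ser_closed [simp]: "ser c n \<in> carrier R"
  unfolding ser_def by (rule lincomb_closed) simp

lemma finite_KR: "finite KR"
proof (rule finite_subset[OF _ card_box_le(1)])
  show "KR \<subseteq> {\<alpha> \<in> E. \<forall>l\<in>{1..d}. \<alpha> l < (if l \<in> {1..N} then q l else 1)}"
    using KR_E KR_less KR_0 by auto
qed

lemma power_series_converges_iff:
  "power_series_converges R m \<iota> {N+1..d} x c s \<longleftrightarrow>
    s \<in> carrier T \<and> (\<forall>n. s n = mpow n +> ser c n)"
proof -
  let ?t = "\<lambda>L. to_completion R m (\<iota> (c L)) \<otimes>\<^bsub>T\<^esub> monomial T {N+1..d} (\<lambda>l. to_completion R m (x l)) L"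
  have xM: "x \<in> {N+1..d} \<rightarrow> carrier R" using x_closed by auto
  interpret hom: ring_hom_cring R T "to_completion R m" by (rule to_completion_hom)
  have t: "?t L = to_completion R m (\<iota> (c L) \<otimes> xm L)" if "L \<in> EM" for L
    unfolding monomial_to_completion[OF xM] monomial_restrict[OF _ that, simplified]
    by simp
  have tc: "?t L \<in> carrier T" if "L \<in> EM" for L
    unfolding t[OF that] by (rule to_completion_closed) simp
  have tn: "?t L n = mpow n +> (\<iota> (c L) \<otimes> xm L)" if "L \<in> EM" for L n
    unfolding t[OF that] by (simp add: to_completion_def)
  have small: "?t L n = mpow n +> \<zero>" if "L \<in> EM" "n \<le> mdeg d L" for L n
    unfolding tn[OF that(1)]
    by (rule coset_zero, rule ideal.I_l_closed[OF mpow_ideal _ \<iota>_closed])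
      (rule subsetD[OF ideal_pow_antimono[OF m_ideal that(2)] xm_in_mpow])
  have sum: "finsum T ?t (ser_deg n) n = mpow n +> ser c n" for n
    unfolding ser_def by (rule T_finsum_coset[OF finite_ser_deg]) (simp_all add: tc tn)
  show ?thesis
    unfolding power_series_converges_def
    by (subst has_sum_iff[where w = "mdeg d", OF tc finite_ser_deg small]) (simp_all add: sum)
qed

abbreviation B_deg where "B_deg n \<equiv> {B \<in> EN. mdeg d (qexp B) < n}"
text \<open>\<open>coef b B n\<close> and \<open>total b n\<close> represent
  \<open>a\<^sub>B\<close> and the whole expansion at level \<open>n\<close>. The cut-off for
  \<open>B\<close> is the degree of \<open>qexp B\<close>, because \<open>hm B\<close> lies in that
  power of \<open>m\<close>.\<close>

definition coef where "coef b B n = (\<Oplus>K\<in>KR. ser (b B K) n \<otimes> xm K)"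
definition total where "total b n = (\<Oplus>B\<in>B_deg n. coef b B n \<otimes> hm B)"

text \<open>Positivity of \<open>q\<close> enters here; it makes \<open>B_deg n\<close>
  finite.\<close>

lemma mdeg_le_qexp: "B \<in> EN \<Longrightarrow> mdeg d B \<le> mdeg d (qexp B)"
  unfolding mdeg_restrict[OF qexp_EN] mdeg_restrict
  by (intro sum_mono) (use q_pos in \<open>auto simp: qexp_def Suc_le_eq\<close>)

lemma finite_B_deg: "finite (B_deg n)"
  by (rule finite_subset[OF _ finite_mdeg_less[of d n]])
    (auto intro: EN_E le_less_trans[OF mdeg_le_qexp])

lemma coef_closed [simp]: "coef b B n \<in> carrier R"
  unfolding coef_def by (rule finsum_closed) auto

lemma total_closed [simp]: "total b n \<in> carrier R"
  unfolding total_def by (rule finsum_closed) auto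

lemma total_eq:
  "total b n = (\<Oplus>p\<in>B_deg n \<times> (KR \<times> ser_deg n). \<iota> (b (fst p) (fst (snd p)) (snd (snd p)))
      \<otimes> trm (fst p) (fst (snd p)) (snd (snd p)))"
proof -
  have coef: "coef b B n \<otimes> hm B = (\<Oplus>r\<in>KR \<times> ser_deg n. \<iota> (b B (fst r) (snd r)) \<otimes> trm B (fst r) (snd r))" for B
  proof -
    have inner: "ser (b B K) n \<otimes> xm K \<otimes> hm B = (\<Oplus>L\<in>ser_deg n. \<iota> (b B K L) \<otimes> trm B K L)" for K
    proof -
      have "ser (b B K) n \<otimes> xm K \<otimes> hm B = ser (b B K) n \<otimes> (xm K \<otimes> hm B)" by (simp add: m_assoc)
      also have "\<dots> = (\<Oplus>L\<in>ser_deg n. \<iota> (b B K L) \<otimes> xm L \<otimes> (xm K \<otimes> hm B))"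
        unfolding ser_def by (rule finsum_ldistr) (auto intro: finite_ser_deg)
      also have "\<dots> = (\<Oplus>L\<in>ser_deg n. \<iota> (b B K L) \<otimes> trm B K L)"
        by (rule finsum_cong') (auto simp: trm_def m_ac)
      finally show ?thesis .
    qed
    have "coef b B n \<otimes> hm B = (\<Oplus>K\<in>KR. ser (b B K) n \<otimes> xm K \<otimes> hm B)"
      unfolding coef_def by (rule finsum_ldistr) (auto intro: finite_KR)
    also have "\<dots> = (\<Oplus>K\<in>KR. \<Oplus>L\<in>ser_deg n. \<iota> (b B K L) \<otimes> trm B K L)"
      unfolding inner ..
    also have "\<dots> = (\<Oplus>r\<in>KR \<times> ser_deg n. \<iota> (b B (fst r) (snd r)) \<otimes> trm B (fst r) (snd r))"
      by (rule finsum_Sigma) (auto intro: finite_KR finite_ser_deg)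
    finally show ?thesis .
  qed
  show ?thesis
    unfolding total_def coef
    by (rule finsum_Sigma) (auto intro: finite_B_deg finite_KR finite_ser_deg)
qed

text \<open>Reindexing along the encoding turns the triple sum into a sum over exponents.
  \<open>B\<close> and \<open>L\<close> are truncated separately, so the triples cover more than
  \<open>Edeg n\<close>; the surplus terms lie in \<open>mpow n\<close>.\<close>

lemma total_Gsum: "mpow n +> total b n = mpow n +> Gsum (\<lambda>\<alpha>. b (decB \<alpha>) (decK \<alpha>) (decL \<alpha>)) n"
proof -
  let ?D = "B_deg n \<times> (KR \<times> ser_deg n)"
  let ?e = "\<lambda>p. enc (fst p) (fst (snd p)) (snd (snd p))"
  let ?c = "\<lambda>\<alpha>. b (decB \<alpha>) (decK \<alpha>) (decL \<alpha>)"
  have fin: "finite ?D" by (intro finite_cartesian_product finite_B_deg finite_KR finite_ser_deg)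
  have dec: "decB (?e p) = fst p" "decK (?e p) = fst (snd p)" "decL (?e p) = snd (snd p)" if "p \<in> ?D" for p
    using that by (auto simp: dec_enc)
  have inj: "inj_on ?e ?D"
  proof (rule inj_onI)
    fix p p' assume p: "p \<in> ?D" "p' \<in> ?D" "?e p = ?e p'"
    have "fst p' = fst p" "fst (snd p') = fst (snd p)" "snd (snd p') = snd (snd p)"
      by (rule dec[OF p(1), unfolded p(3), unfolded dec[OF p(2)]])+
    then show "p = p'" by (intro prod_eqI) simp_all
  qed
  have "total b n = (\<Oplus>p\<in>?D. \<iota> (?c (?e p)) \<otimes> G (?e p))"
    unfolding total_eq by (rule finsum_cong') (auto simp: dec_enc G_def)
  also have "\<dots> = (\<Oplus>\<alpha>\<in>?e ` ?D. \<iota> (?c \<alpha>) \<otimes> G \<alpha>)"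
    by (rule finsum_reindex[symmetric, OF _ inj]) auto
  finally have total: "total b n = (\<Oplus>\<alpha>\<in>?e ` ?D. \<iota> (?c \<alpha>) \<otimes> G \<alpha>)" .
  have "(\<Oplus>\<alpha>\<in>?e ` ?D. \<iota> (?c \<alpha>) \<otimes> G \<alpha>) \<ominus> Gsum ?c n \<in> mpow n"
  proof (rule Gsum_subset)
    show "finite (?e ` ?D)" using fin by (rule finite_imageI)
    show "?e ` ?D \<subseteq> E" by (auto intro: enc_E)
    show "Edeg n \<subseteq> ?e ` ?D"
    proof
      fix \<alpha> assume \<alpha>: "\<alpha> \<in> Edeg n"
      then have \<alpha>E: "\<alpha> \<in> E" and "mdeg d (enc (decB \<alpha>) (decK \<alpha>) (decL \<alpha>)) < n" by (simp_all add: enc_dec)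
      then have "mdeg d (qexp (decB \<alpha>)) < n" "mdeg d (decL \<alpha>) < n" unfolding mdeg_enc by linarith+
      then have "(decB \<alpha>, decK \<alpha>, decL \<alpha>) \<in> ?D" using dec_in[OF \<alpha>E] by simp
      moreover have "\<alpha> = ?e (decB \<alpha>, decK \<alpha>, decL \<alpha>)" using enc_dec[OF \<alpha>E] by simp
      ultimately show "\<alpha> \<in> ?e ` ?D" by (rule rev_image_eqI[where f = ?e])
    qed
  qed
  then have "total b n \<ominus> Gsum ?c n \<in> mpow n" unfolding total .
  then show ?thesis unfolding coset_eq_iff[OF mpow_ideal total_closed Gsum_closed] .
qed

text \<open>The values \<beta> and \<open>a\<close> hidden in the definition are determined by
  \<open>b\<close>, and at level \<open>n\<close> they are represented by truncations. So the nested
  sums reduce to one congruence in \<open>R\<close> for each level.\<close>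

lemma is_expansion_iff:
  assumes f: "f \<in> carrier T"
  shows "is_expansion R m \<iota> d N q h x f b \<longleftrightarrow>
    (\<forall>n. f n = mpow n +> Gsum (\<lambda>\<alpha>. b (decB \<alpha>) (decK \<alpha>) (decL \<alpha>)) n)"
proof -
  interpret T: cring T by (rule T_cring)
  let ?X = "\<lambda>K. monomial T {1..d} (\<lambda>l. to_completion R m (x l)) K"
  let ?H = "\<lambda>B. monomial T {1..N} (\<lambda>l. to_completion R m (h l)) B"
  have X: "?X K = to_completion R m (xm K)" for K by (rule monomial_to_completion[OF x_closed])
  have H: "?H B = to_completion R m (hm B)" for B by (rule monomial_to_completion[OF h_closed])
  have XT: "?X K \<in> carrier T" and HT: "?H B \<in> carrier T" for K B
    unfolding X H by (simp_all add: to_completion_closed)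
  have Xn: "?X K n = mpow n +> xm K" and Hn: "?H B n = mpow n +> hm B" for K B n
    unfolding X H by (simp_all add: to_completion_def)
  \<comment> \<open>Stated for arbitrary admissible \<beta> and \<open>a\<close>: one direction of
    the claim receives them from the definition, the other supplies the ones constructed
    below.\<close>
  have sum_iff: "completion_has_sum R m (\<lambda>B. a B \<otimes>\<^bsub>T\<^esub> ?H B) EN f
      \<longleftrightarrow> (\<forall>n. f n = mpow n +> total b n)"
    if \<beta>: "\<forall>B\<in>EN. \<forall>K\<in>KR. power_series_converges R m \<iota> {N+1..d} x (b B K) (\<beta> B K)"
      and a: "\<forall>B\<in>EN. a B = (\<Oplus>\<^bsub>T\<^esub>K\<in>KR. \<beta> B K \<otimes>\<^bsub>T\<^esub> ?X K)" for \<beta> a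
  proof -
    have \<beta>T: "\<beta> B K \<in> carrier T" and \<beta>n: "\<beta> B K n = mpow n +> ser (b B K) n" if "B \<in> EN" "K \<in> KR" for B K n
      using \<beta> that unfolding power_series_converges_iff by blast+
    have aT: "a B \<in> carrier T" if "B \<in> EN" for B
      using a that \<beta>T XT by (auto intro!: T.finsum_closed)
    have an: "a B n = mpow n +> coef b B n" if B: "B \<in> EN" for B n
      unfolding bspec[OF a B] coef_def
      by (rule T_finsum_coset[OF finite_KR])
        (simp_all add: \<beta>T[OF B] XT T_mult \<beta>n[OF B] Xn coset_mult)
    let ?t = "\<lambda>B. a B \<otimes>\<^bsub>T\<^esub> ?H B"
    have tT: "?t B \<in> carrier T" if "B \<in> EN" for B using aT[OF that] HT by simp
    have tn: "?t B n = mpow n +> (coef b B n \<otimes> hm B)" if "B \<in> EN" for B n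
      using an[OF that] Hn by (simp add: T_mult coset_mult)
    have small: "?t B n = mpow n +> \<zero>" if "B \<in> EN" "n \<le> mdeg d (qexp B)" for B n
      unfolding tn[OF that(1)]
      by (rule coset_zero, rule ideal.I_l_closed[OF mpow_ideal _ coef_closed])
        (rule subsetD[OF ideal_pow_antimono[OF m_ideal that(2)] hm_cong(1)[OF that(1)]])
    have sum: "finsum T ?t (B_deg n) n = mpow n +> total b n" for n
      unfolding total_def by (rule T_finsum_coset[OF finite_B_deg]) (simp_all add: tT tn)
    show ?thesis
      by (subst has_sum_iff[where w = "\<lambda>B. mdeg d (qexp B)", OF tT finite_B_deg small])
        (simp_all add: sum f)
  qed
  define \<beta> where "\<beta> B K n = mpow n +> ser (b B K) n" for B K n
  define a where "a B = (\<Oplus>\<^bsub>T\<^esub>K\<in>KR. \<beta> B K \<otimes>\<^bsub>T\<^esub> ?X K)" for B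
  have \<beta>: "\<forall>B\<in>EN. \<forall>K\<in>KR. power_series_converges R m \<iota> {N+1..d} x (b B K) (\<beta> B K)"
  proof (intro ballI)
    fix B K assume "B \<in> EN" "K \<in> KR"
    let ?c = "b B K"
    \<comment> \<open>Consecutive truncations agree modulo \<open>mpow n\<close>, so they define an
      element of the completion: every power series converges.\<close>
    have "mpow n +> ser ?c n = mpow n +> ser ?c (Suc n)" for n
    proof -
      define rest where "rest = (\<Oplus>L\<in>ser_deg (Suc n) - ser_deg n. \<iota> (?c L) \<otimes> xm L)"
      have rest: "rest \<in> mpow n"
        unfolding rest_def
      proof (rule ideal_finsum_closed[OF mpow_ideal])
        fix L assume "L \<in> ser_deg (Suc n) - ser_deg n"
        then have "n \<le> mdeg d L" by auto
        then have "xm L \<in> mpow n" by (rule subsetD[OF ideal_pow_antimono[OF m_ideal] xm_in_mpow])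
        then show "\<iota> (?c L) \<otimes> xm L \<in> mpow n" by (rule ideal.I_l_closed[OF mpow_ideal _ \<iota>_closed])
      qed
      have "ser_deg (Suc n) = ser_deg n \<union> (ser_deg (Suc n) - ser_deg n)" by auto
      then have "ser ?c (Suc n) = (\<Oplus>L\<in>ser_deg n \<union> (ser_deg (Suc n) - ser_deg n). \<iota> (?c L) \<otimes> xm L)"
        unfolding ser_def by (rule arg_cong)
      also have "\<dots> = ser ?c n \<oplus> rest"
        unfolding ser_def rest_def
        by (rule finsum_Un_disjoint) (auto intro: finite_ser_deg)
      finally have eq: "ser ?c (Suc n) = ser ?c n \<oplus> rest" .
      have "s \<ominus> (s \<oplus> r) = \<ominus> r" if "s \<in> carrier R" "r \<in> carrier R" for s r using that by algebra
      from this[OF ser_closed ideal_subset_carrier[OF mpow_ideal rest]]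
      have "ser ?c n \<ominus> ser ?c (Suc n) = \<ominus> rest" unfolding eq .
      then have "ser ?c n \<ominus> ser ?c (Suc n) \<in> mpow n"
        using additive_subgroup.a_inv_closed[OF ideal.axioms(1)[OF mpow_ideal] rest] by simp
      then show ?thesis using coset_eq_iff[OF mpow_ideal ser_closed ser_closed] by blast
    qed
    note step = this
    have "\<beta> B K \<in> carrier T"
      unfolding carrier_T_iff \<beta>_def
    proof
      fix n
      show "\<exists>r\<in>carrier R. mpow n +> ser ?c n = mpow n +> r \<and> mpow (Suc n) +> ser ?c (Suc n) = mpow (Suc n) +> r"
        by (rule bexI[of _ "ser ?c (Suc n)"], rule conjI[OF step refl], rule ser_closed)
    qed
    then show "power_series_converges R m \<iota> {N+1..d} x (b B K) (\<beta> B K)"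
      unfolding power_series_converges_iff by (simp add: \<beta>_def)
  qed
  have a: "\<forall>B\<in>EN. a B = (\<Oplus>\<^bsub>T\<^esub>K\<in>KR. \<beta> B K \<otimes>\<^bsub>T\<^esub> ?X K)" by (simp add: a_def)
  have "is_expansion R m \<iota> d N q h x f b \<longleftrightarrow> (\<forall>n. f n = mpow n +> total b n)"
    unfolding is_expansion_def using sum_iff sum_iff[OF \<beta> a] \<beta> a by blast
  then show ?thesis unfolding total_Gsum .
qed

theorem exists_unique_expansion:
  assumes f: "f \<in> carrier T"
  shows "\<exists>!b. b \<in> coefficient_families d N q \<and> is_expansion R m \<iota> d N q h x f b"
proof (rule ex_ex1I)
  obtain c where c: "\<forall>n. f n = mpow n +> Gsum c n" using expansion_exists_unique(1)[OF f] by (rule exE)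
  \<comment> \<open>Restriction to the three index sets makes \<open>b\<close> extensional, so that
    uniqueness can be asserted for \<open>b\<close> as a function.\<close>
  define b where "b = (\<lambda>B\<in>EN. \<lambda>K\<in>KR. \<lambda>L\<in>EM. c (enc B K L))"
  have "b \<in> coefficient_families d N q"
    unfolding coefficient_families_def power_series_def b_def by (intro restrict_PiE_iff[THEN iffD2] ballI) auto
  moreover have "Gsum (\<lambda>\<alpha>. b (decB \<alpha>) (decK \<alpha>) (decL \<alpha>)) n = Gsum c n" for n
  proof (rule finsum_cong'[OF refl])
    fix \<alpha> assume "\<alpha> \<in> Edeg n"
    then have "\<alpha> \<in> E" by simp
    then have "b (decB \<alpha>) (decK \<alpha>) (decL \<alpha>) = c \<alpha>"
      unfolding b_def by (simp add: dec_in enc_dec)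
    then show "\<iota> (b (decB \<alpha>) (decK \<alpha>) (decL \<alpha>)) \<otimes> G \<alpha> = \<iota> (c \<alpha>) \<otimes> G \<alpha>" by simp
  qed auto
  then have "is_expansion R m \<iota> d N q h x f b" unfolding is_expansion_iff[OF f] using c by simp
  ultimately show "\<exists>b. b \<in> coefficient_families d N q \<and> is_expansion R m \<iota> d N q h x f b" by blast
next
  fix b b'
  assume b: "b \<in> coefficient_families d N q \<and> is_expansion R m \<iota> d N q h x f b"
    and b': "b' \<in> coefficient_families d N q \<and> is_expansion R m \<iota> d N q h x f b'"
  \<comment> \<open>Each coefficient is recovered at the exponent \<open>enc B K L\<close>, where
    decoding returns \<open>B\<close>, \<open>K\<close> and \<open>L\<close>.\<close>
  have "b B K L = b' B K L" if BKL: "B \<in> EN" "K \<in> KR" "L \<in> EM" for B K L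
    using expansion_exists_unique(2)[OF f, of "\<lambda>\<alpha>. b (decB \<alpha>) (decK \<alpha>) (decL \<alpha>)"
        "\<lambda>\<alpha>. b' (decB \<alpha>) (decK \<alpha>) (decL \<alpha>)" "enc B K L"] b b' enc_E[OF BKL]
    unfolding is_expansion_iff[OF f] dec_enc[OF BKL] by blast
  note eq = this
  have fam: "b \<in> EN \<rightarrow>\<^sub>E KR \<rightarrow>\<^sub>E EM \<rightarrow>\<^sub>E UNIV" "b' \<in> EN \<rightarrow>\<^sub>E KR \<rightarrow>\<^sub>E EM \<rightarrow>\<^sub>E UNIV"
    using b b' unfolding coefficient_families_def power_series_def by simp_all
  show "b = b'"
  proof (rule PiE_ext[OF fam])
    fix B assume B: "B \<in> EN"
    show "b B = b' B"
    proof (rule PiE_ext[OF PiE_mem[OF fam(1) B] PiE_mem[OF fam(2) B]])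
      fix K assume K: "K \<in> KR"
      show "b B K = b' B K"
        by (rule PiE_ext[OF PiE_mem[OF PiE_mem[OF fam(1) B] K] PiE_mem[OF PiE_mem[OF fam(2) B] K]])
          (rule eq[OF B K])
    qed
  qed
qed

end

section \<open>The stalk of a variety\<close>

text \<open>The product in the associated graded ring is a union over all pairs of representatives.
  By \<open>mult_cong_ideal_pow\<close> each pair contributes the same coset, so the union
  collapses.\<close>

lemma (in cring) gr_pow_gr_class:
  assumes I: "ideal I R" and y: "y \<in> I"
  shows "gr_pow R I (gr_class R I 1 y) n = gr_class R I n (y [^] n)"
proof (induction n)
  case (Suc n)
  let ?p = "ideal_pow R I"
  note pi = ideal_pow_ideal[OF I]
  have yc: "y \<in> carrier R" by (rule ideal_subset_carrier[OF I y])
  have y1: "y \<in> ?p 1" using y by (simp only: One_nat_def ideal_pow_1[OF I])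
  have yn: "y [^] n \<in> ?p n" by (rule ideal_pow_nat_pow[OF I y])
  have ync: "y [^] n \<in> carrier R" using yc by simp
  have coset: "a \<in> carrier R \<and> a \<ominus> b \<in> ?p (Suc k) \<and> a \<in> ?p k"
    if "a \<in> ?p (Suc k) +> b" "b \<in> ?p k" for a b k
  proof -
    have bc: "b \<in> carrier R" by (rule ideal_subset_carrier[OF pi that(2)])
    have ac: "a \<in> carrier R" using coset_subset_carrier[OF pi bc] that(1) by blast
    have "a \<ominus> b \<in> ?p (Suc k)" using that(1) mem_coset_iff[OF pi ac bc] by blast
    moreover from this have "a \<ominus> b \<in> ?p k" using ideal_pow_Suc_subset[OF I] by blast
    then have "a \<in> ?p k" by (rule ideal_of_diff[OF pi _ that(2) ac])
    ultimately show ?thesis using ac by blast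
  qed
  have prod: "?p (Suc (n + 1)) +> a \<otimes> b = ?p (Suc (n + 1)) +> y [^] n \<otimes> y"
    if "a \<in> ?p (Suc n) +> y [^] n" "b \<in> ?p (Suc 1) +> y" for a b
  proof -
    from coset[OF that(1) yn] coset[OF that(2) y1]
    have ab: "a \<in> carrier R" "a \<ominus> y [^] n \<in> ?p (Suc n)" "a \<in> ?p n"
      "b \<in> carrier R" "b \<ominus> y \<in> ?p (Suc 1)" "b \<in> ?p 1" by blast+
    show ?thesis
      unfolding coset_eq_iff[OF pi m_closed[OF ab(1,4)] m_closed[OF ync yc]]
      by (rule mult_cong_ideal_pow[OF I ab(3) yn ab(2) ab(6) y1 ab(5)])
  qed
  have self: "a \<in> ?p k +> a" if "a \<in> carrier R" for a k
  proof -
    have "a \<ominus> a = \<zero>" using that by algebra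
    then show ?thesis using mem_coset_iff[OF pi that that] ideal_zero_closed[OF pi] by metis
  qed
  have "gr_pow R I (gr_class R I 1 y) (Suc n)
      = (\<Union>a\<in>?p (Suc n) +> y [^] n. \<Union>b\<in>?p (Suc 1) +> y. ?p (Suc (n + 1)) +> a \<otimes> b)"
    unfolding gr_pow.simps Suc.IH unfolding gr_mult_def rcoset_mult_def gr_class_def ..
  also have "\<dots> = (\<Union>a\<in>?p (Suc n) +> y [^] n. \<Union>b\<in>?p (Suc 1) +> y. ?p (Suc (n + 1)) +> y [^] n \<otimes> y)"
    by (intro SUP_cong refl prod)
  also have "\<dots> = ?p (Suc (n + 1)) +> y [^] n \<otimes> y"
    using self[OF ync, of "Suc n"] self[OF yc, of "Suc 1"] by blast
  finally show ?case by (simp only: gr_class_def nat_pow_Suc add_0_right add_Suc_right One_nat_def)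
qed (simp add: gr_class_def)

section \<open>The maximal ideal of a local ring\<close>

lemma max_ideal_maximal:
  assumes "local_ring R" shows "maximalideal (max_ideal R) R"
  using assms theI'[of "\<lambda>M. maximalideal M R"] unfolding local_ring_def max_ideal_def by blast

lemma max_ideal_eqI:
  assumes "local_ring R" "maximalideal M R" shows "M = max_ideal R"
  using assms max_ideal_maximal[OF assms(1)] unfolding local_ring_def by blast

text \<open>If the principal ideal of \<open>a\<close> were proper, the maximum condition would
  place it in a maximal ideal, and the only one does not contain \<open>a\<close>.\<close>

lemma unit_outside_max_ideal:
  assumes loc: "local_ring R" and noeth: "noetherian_ring R"
    and a: "a \<in> carrier R" "a \<notin> max_ideal R"
  shows "a \<in> Units R"
proof -
  interpret cring R using loc unfolding local_ring_def by blast
  have Pa: "ideal (PIdl\<^bsub>R\<^esub> a) R" by (rule cgenideal_ideal[OF a(1)])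
  have "PIdl\<^bsub>R\<^esub> a = carrier R"
  proof (rule ccontr)
    assume proper: "PIdl\<^bsub>R\<^esub> a \<noteq> carrier R"
    define F where "F = {J. ideal J R \<and> PIdl\<^bsub>R\<^esub> a \<subseteq> J \<and> J \<noteq> carrier R}"
    have "PIdl\<^bsub>R\<^esub> a \<in> F" unfolding F_def using Pa proper by blast
    then have "F \<noteq> {}" by blast
    moreover have "ideal J R" if "J \<in> F" for J using that by (simp add: F_def)
    ultimately have "\<exists>M\<in>F. \<forall>J\<in>F. M \<subseteq> J \<longrightarrow> J = M"
      by (rule noetherian_ring.maximal_ideal_of_family[OF noeth])
    then obtain M where M: "M \<in> F" "\<forall>J\<in>F. M \<subseteq> J \<longrightarrow> J = M" by (rule bexE)
    have M': "ideal M R" "PIdl\<^bsub>R\<^esub> a \<subseteq> M" "M \<noteq> carrier R" using M(1) by (simp_all add: F_def)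
    have "maximalideal M R"
    proof (rule maximalidealI[OF M'(1)])
      show "carrier R \<noteq> M" using M'(3) by simp
      fix J assume J: "ideal J R" "M \<subseteq> J" "J \<subseteq> carrier R"
      show "J = M \<or> J = carrier R"
      proof (cases "J = carrier R")
        case False
        then have "J \<in> F" using J M'(2) unfolding F_def by blast
        then show ?thesis using M(2) J(2) by blast
      qed simp
    qed
    then have "M = max_ideal R" by (rule max_ideal_eqI[OF loc])
    then show False using M'(2) cgenideal_self[OF a(1)] a(2) by blast
  qed
  then have "\<one>\<^bsub>R\<^esub> \<in> PIdl\<^bsub>R\<^esub> a" by simp
  then obtain t where t: "t \<in> carrier R" "\<one>\<^bsub>R\<^esub> = t \<otimes>\<^bsub>R\<^esub> a" unfolding cgenideal_def by blast
  then have "a \<otimes>\<^bsub>R\<^esub> t = \<one>\<^bsub>R\<^esub>" using a(1) by (simp add: m_comm)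
  then show ?thesis using t a(1) unfolding Units_def by auto
qed

section \<open>Germs and their values\<close>

lemma germ_cong:
  assumes "openin W U'" "P \<in> U'" "U' \<subseteq> U \<inter> V" "\<And>y. y \<in> U' \<Longrightarrow> f y = g y"
  shows "germ W \<O> P U f = germ W \<O> P V g"
proof -
  have "germ W \<O> P U f \<subseteq> germ W \<O> P V g"
    if "U' \<subseteq> U \<inter> V" "\<And>y. y \<in> U' \<Longrightarrow> f y = g y" for U V f g
  proof (rule subsetI)
    fix p assume "p \<in> germ W \<O> P U f"
    then obtain A k U'' where p: "p = (A, k)" "openin W A" "P \<in> A" "k \<in> \<O> A"
      "openin W U''" "P \<in> U''" "U'' \<subseteq> U \<inter> A" "\<forall>y\<in>U''. f y = k y"
      unfolding germ_def by blast
    have "openin W (U' \<inter> U'')" "P \<in> U' \<inter> U''" using assms(1,2) p(5,6) by (auto intro: openin_Int)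
    moreover have "U' \<inter> U'' \<subseteq> V \<inter> A" using that(1) p(7) by blast
    moreover have "\<forall>y\<in>U' \<inter> U''. g y = k y" using that(2)[symmetric] p(8) by simp
    ultimately show "p \<in> germ W \<O> P V g"
      unfolding germ_def p(1) using p(2,3,4) by blast
  qed
  note sub = this
  have "U' \<subseteq> V \<inter> U" using assms(3) by blast
  then show ?thesis
    by (intro equalityI sub[OF assms(3,4)] sub[OF _ assms(4)[symmetric]])
qed

locale stalk_at =
  fixes W :: "'w topology" and \<O> :: "('w, 'k::field) fun_sheaf" and P :: 'w
  assumes space: "space_with_functions W \<O>" and P: "P \<in> topspace W"
begin

abbreviation R where "R \<equiv> stalk W \<O> P"
abbreviation gm where "gm \<equiv> germ W \<O> P"
abbreviation section_at where "section_at U f \<equiv> openin W U \<and> P \<in> U \<and> f \<in> \<O> U"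

lemma section_add: "section_at U f \<Longrightarrow> section_at V g \<Longrightarrow> section_at (U \<inter> V) (\<lambda>x\<in>U \<inter> V. f x + g x)"
  and section_mult: "section_at U f \<Longrightarrow> section_at V g \<Longrightarrow> section_at (U \<inter> V) (\<lambda>x\<in>U \<inter> V. f x * g x)"
proof -
  assume f: "section_at U f" and g: "section_at V g"
  have o: "openin W (U \<inter> V)" using f g by (auto intro: openin_Int)
  have fO: "restrict f (U \<inter> V) \<in> \<O> (U \<inter> V)" and gO: "restrict g (U \<inter> V) \<in> \<O> (U \<inter> V)"
    using space f g o unfolding space_with_functions_def by blast+
  have "(\<lambda>x\<in>U \<inter> V. restrict f (U \<inter> V) x + restrict g (U \<inter> V) x) \<in> \<O> (U \<inter> V)"
    "(\<lambda>x\<in>U \<inter> V. restrict f (U \<inter> V) x * restrict g (U \<inter> V) x) \<in> \<O> (U \<inter> V)"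
    using space o fO gO unfolding space_with_functions_def by blast+
  moreover have "(\<lambda>x\<in>U \<inter> V. restrict f (U \<inter> V) x + restrict g (U \<inter> V) x) = (\<lambda>x\<in>U \<inter> V. f x + g x)"
    "(\<lambda>x\<in>U \<inter> V. restrict f (U \<inter> V) x * restrict g (U \<inter> V) x) = (\<lambda>x\<in>U \<inter> V. f x * g x)"
    by (auto simp: restrict_def fun_eq_iff)
  ultimately show "section_at (U \<inter> V) (\<lambda>x\<in>U \<inter> V. f x + g x)"
    "section_at (U \<inter> V) (\<lambda>x\<in>U \<inter> V. f x * g x)" using o f g by auto
qed

lemma section_const: "section_at (topspace W) (\<lambda>x\<in>topspace W. c)"
  using space P unfolding space_with_functions_def by auto

lemma carrier_stalk: "a \<in> carrier R \<longleftrightarrow> (\<exists>U f. section_at U f \<and> a = gm U f)"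
  by (auto simp: stalk_def)

lemma germ_self: "section_at U f \<Longrightarrow> (U, f) \<in> gm U f"
  unfolding germ_def by auto

text \<open>The operations of the stalk are unions over all pairs of representatives. If the result
  depends on the functions near \<open>P\<close> alone, all members of the union are equal, and
  \<open>germ_self\<close> shows that there is at least one.\<close>

lemma germ_UNION:
  assumes f: "section_at U f" and g: "section_at V g"
    and op: "\<And>A k B l U'. openin W U' \<Longrightarrow> P \<in> U' \<Longrightarrow> U' \<subseteq> U \<inter> V \<inter> A \<inter> B \<Longrightarrow>
      (\<And>y. y \<in> U' \<Longrightarrow> f y = k y \<and> g y = l y) \<Longrightarrow> F (A, k) (B, l) = F (U, f) (V, g)"
  shows "(\<Union>p\<in>gm U f. \<Union>r\<in>gm V g. F p r) = F (U, f) (V, g)"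
proof -
  have "F p r = F (U, f) (V, g)" if p: "p \<in> gm U f" and r: "r \<in> gm V g" for p r
  proof -
    obtain A k U1 where p': "p = (A, k)" "openin W U1" "P \<in> U1" "U1 \<subseteq> U \<inter> A" "\<forall>y\<in>U1. f y = k y"
      using p unfolding germ_def by blast
    obtain B l U2 where r': "r = (B, l)" "openin W U2" "P \<in> U2" "U2 \<subseteq> V \<inter> B" "\<forall>y\<in>U2. g y = l y"
      using r unfolding germ_def by blast
    show ?thesis unfolding p'(1) r'(1)
    proof (rule op)
      show "openin W (U1 \<inter> U2)" by (rule openin_Int[OF p'(2) r'(2)])
      show "P \<in> U1 \<inter> U2" using p'(3) r'(3) by blast
      show "U1 \<inter> U2 \<subseteq> U \<inter> V \<inter> A \<inter> B" using p'(4) r'(4) by blast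
      show "f y = k y \<and> g y = l y" if "y \<in> U1 \<inter> U2" for y using p'(5) r'(5) that by blast
    qed
  qed
  then have "(\<Union>p\<in>gm U f. \<Union>r\<in>gm V g. F p r) = (\<Union>p\<in>gm U f. \<Union>r\<in>gm V g. F (U, f) (V, g))"
    by (intro SUP_cong refl)
  also have "\<dots> = F (U, f) (V, g)" using germ_self[OF f] germ_self[OF g] by blast
  finally show ?thesis .
qed

lemma germ_add:
  assumes f: "section_at U f" and g: "section_at V g"
  shows "gm U f \<oplus>\<^bsub>R\<^esub> gm V g = gm (U \<inter> V) (\<lambda>x\<in>U \<inter> V. f x + g x)"
proof -
  let ?F = "\<lambda>p r. gm (fst p \<inter> fst r) (\<lambda>x\<in>fst p \<inter> fst r. snd p x + snd r x)"
  have "(\<Union>p\<in>gm U f. \<Union>r\<in>gm V g. ?F p r) = ?F (U, f) (V, g)"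
  proof (rule germ_UNION[OF f g])
    fix A k B l U'
    assume U': "openin W U'" "P \<in> U'" "U' \<subseteq> U \<inter> V \<inter> A \<inter> B"
      and eq: "\<And>y. y \<in> U' \<Longrightarrow> f y = k y \<and> g y = l y"
    show "?F (A, k) (B, l) = ?F (U, f) (V, g)"
    proof (rule germ_cong[OF U'(1,2)])
      show "U' \<subseteq> fst (A, k) \<inter> fst (B, l) \<inter> (fst (U, f) \<inter> fst (V, g))" using U'(3) by auto
      fix y assume y: "y \<in> U'"
      then have "y \<in> A \<inter> B" "y \<in> U \<inter> V" using U'(3) by blast+
      then show "(\<lambda>x\<in>fst (A, k) \<inter> fst (B, l). snd (A, k) x + snd (B, l) x) y
          = (\<lambda>x\<in>fst (U, f) \<inter> fst (V, g). snd (U, f) x + snd (V, g) x) y"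
        using eq[OF y] by simp
    qed
  qed
  then show ?thesis by (simp add: stalk_def case_prod_beta')
qed

lemma germ_mult:
  assumes f: "section_at U f" and g: "section_at V g"
  shows "gm U f \<otimes>\<^bsub>R\<^esub> gm V g = gm (U \<inter> V) (\<lambda>x\<in>U \<inter> V. f x * g x)"
proof -
  let ?F = "\<lambda>p r. gm (fst p \<inter> fst r) (\<lambda>x\<in>fst p \<inter> fst r. snd p x * snd r x)"
  have "(\<Union>p\<in>gm U f. \<Union>r\<in>gm V g. ?F p r) = ?F (U, f) (V, g)"
  proof (rule germ_UNION[OF f g])
    fix A k B l U'
    assume U': "openin W U'" "P \<in> U'" "U' \<subseteq> U \<inter> V \<inter> A \<inter> B"
      and eq: "\<And>y. y \<in> U' \<Longrightarrow> f y = k y \<and> g y = l y"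
    show "?F (A, k) (B, l) = ?F (U, f) (V, g)"
    proof (rule germ_cong[OF U'(1,2)])
      show "U' \<subseteq> fst (A, k) \<inter> fst (B, l) \<inter> (fst (U, f) \<inter> fst (V, g))" using U'(3) by auto
      fix y assume y: "y \<in> U'"
      then have "y \<in> A \<inter> B" "y \<in> U \<inter> V" using U'(3) by blast+
      then show "(\<lambda>x\<in>fst (A, k) \<inter> fst (B, l). snd (A, k) x * snd (B, l) x) y
          = (\<lambda>x\<in>fst (U, f) \<inter> fst (V, g). snd (U, f) x * snd (V, g) x) y"
        using eq[OF y] by simp
    qed
  qed
  then show ?thesis by (simp add: stalk_def case_prod_beta')
qed

text \<open>The value at \<open>P\<close>. Representatives of a germ agree near \<open>P\<close>, so
  the choice is immaterial.\<close>

definition ev where "ev a = snd (SOME p. p \<in> a) P"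

lemma ev_germ:
  assumes "section_at U f" shows "ev (gm U f) = f P"
proof -
  have "(SOME p. p \<in> gm U f) \<in> gm U f" by (rule someI[of "\<lambda>p. p \<in> gm U f", OF germ_self[OF assms]])
  then show ?thesis unfolding ev_def germ_def by auto
qed

lemma ev_add: "a \<in> carrier R \<Longrightarrow> b \<in> carrier R \<Longrightarrow> ev (a \<oplus>\<^bsub>R\<^esub> b) = ev a + ev b"
proof -
  assume "a \<in> carrier R" "b \<in> carrier R"
  then obtain U f V g where s: "section_at U f" "a = gm U f" "section_at V g" "b = gm V g"
    unfolding carrier_stalk by blast
  show ?thesis
    unfolding s(2,4) germ_add[OF s(1,3)] ev_germ[OF s(1)] ev_germ[OF s(3)]
      ev_germ[OF section_add[OF s(1,3)]] using s(1,3) by simp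
qed

lemma ev_mult: "a \<in> carrier R \<Longrightarrow> b \<in> carrier R \<Longrightarrow> ev (a \<otimes>\<^bsub>R\<^esub> b) = ev a * ev b"
proof -
  assume "a \<in> carrier R" "b \<in> carrier R"
  then obtain U f V g where s: "section_at U f" "a = gm U f" "section_at V g" "b = gm V g"
    unfolding carrier_stalk by blast
  show ?thesis
    unfolding s(2,4) germ_mult[OF s(1,3)] ev_germ[OF s(1)] ev_germ[OF s(3)]
      ev_germ[OF section_mult[OF s(1,3)]] using s(1,3) by simp
qed

lemma const_germ_closed: "const_germ W \<O> P c \<in> carrier R"
  unfolding const_germ_def carrier_stalk using section_const by blast

lemma ev_const: "ev (const_germ W \<O> P c) = c"
  unfolding const_germ_def ev_germ[OF section_const] using P by simp

lemma const_germ_add: "const_germ W \<O> P (a + b) = const_germ W \<O> P a \<oplus>\<^bsub>R\<^esub> const_germ W \<O> P b"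
  unfolding const_germ_def germ_add[OF section_const section_const]
  by (rule germ_cong[of _ "topspace W"]) (use P in auto)

lemma const_germ_mult: "const_germ W \<O> P (a * b) = const_germ W \<O> P a \<otimes>\<^bsub>R\<^esub> const_germ W \<O> P b"
  unfolding const_germ_def germ_mult[OF section_const section_const]
  by (rule germ_cong[of _ "topspace W"]) (use P in auto)

lemma const_germ_1: "const_germ W \<O> P 1 = \<one>\<^bsub>R\<^esub>"
  by (simp add: stalk_def)

lemma const_germ_0: "const_germ W \<O> P 0 = \<zero>\<^bsub>R\<^esub>"
  by (simp add: stalk_def)

lemma residue_in_kernel:
  assumes "cring R" and a: "a \<in> carrier R"
  shows "ev (a \<ominus>\<^bsub>R\<^esub> const_germ W \<O> P (ev a)) = 0"
proof -
  interpret cring R by fact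
  let ?c = "const_germ W \<O> P (ev a)"
  have "ev (a \<ominus>\<^bsub>R\<^esub> ?c) + ev ?c = ev ((a \<ominus>\<^bsub>R\<^esub> ?c) \<oplus>\<^bsub>R\<^esub> ?c)"
    using a const_germ_closed by (intro ev_add[symmetric]) auto
  also have "(a \<ominus>\<^bsub>R\<^esub> ?c) \<oplus>\<^bsub>R\<^esub> ?c = a" using a const_germ_closed[of "ev a"] by algebra
  finally show ?thesis by (simp add: ev_const)
qed

text \<open>The kernel of evaluation at \<open>P\<close> is a maximal ideal, because constant germs
  realise all values in the field \<open>k\<close>; a local ring has no other.\<close>

lemma max_ideal_eq:
  assumes loc: "local_ring R"
  shows "max_ideal R = {a \<in> carrier R. ev a = 0}" (is "_ = ?K")
proof -
  have cr: "cring R" using loc unfolding local_ring_def by blast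
  interpret cring R by (rule cr)
  have ev0: "ev \<zero>\<^bsub>R\<^esub> = 0" using ev_const[of 0] unfolding const_germ_0 .
  have ev1: "ev \<one>\<^bsub>R\<^esub> = 1" using ev_const[of 1] unfolding const_germ_1 .
  have K: "ideal ?K R"
  proof (rule idealI[OF ring_axioms])
    show "subgroup ?K (add_monoid R)"
    proof (rule add.subgroupI)
      show "?K \<noteq> {}" using ev0 by blast
    next
      fix a assume a: "a \<in> ?K"
      have "ev (\<ominus>\<^bsub>R\<^esub> a) + ev a = ev (\<ominus>\<^bsub>R\<^esub> a \<oplus>\<^bsub>R\<^esub> a)" using a by (intro ev_add[symmetric]) auto
      also have "\<dots> = 0" using a ev0 by (simp add: l_neg)
      finally show "\<ominus>\<^bsub>R\<^esub> a \<in> ?K" using a by simp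
    next
      fix a b assume "a \<in> ?K" "b \<in> ?K"
      then show "a \<oplus>\<^bsub>R\<^esub> b \<in> ?K" by (simp add: ev_add)
    qed auto
    fix a t assume "a \<in> ?K" "t \<in> carrier R"
    then show "t \<otimes>\<^bsub>R\<^esub> a \<in> ?K" "a \<otimes>\<^bsub>R\<^esub> t \<in> ?K" by (simp_all add: ev_mult)
  qed
  have "maximalideal ?K R"
  proof (rule maximalidealI[OF K])
    have "\<one>\<^bsub>R\<^esub> \<notin> ?K" using ev1 by simp
    then show "carrier R \<noteq> ?K" using one_closed by blast
    fix J assume J: "ideal J R" "?K \<subseteq> J" "J \<subseteq> carrier R"
    show "J = ?K \<or> J = carrier R"
    proof (cases "J = ?K")
      case False
      then obtain a where a: "a \<in> J" "a \<in> carrier R" "ev a \<noteq> 0" using J(2,3) by blast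
      have "b \<in> J" if b: "b \<in> carrier R" for b
      proof -
        \<comment> \<open>This multiple of \<open>a\<close> has the same value at \<open>P\<close>
          as \<open>b\<close>, so the difference is in the kernel and hence in
          \<open>J\<close>.\<close>
        let ?c = "const_germ W \<O> P (ev b / ev a)"
        have ca: "?c \<otimes>\<^bsub>R\<^esub> a \<in> J" by (rule ideal.I_l_closed[OF J(1) a(1) const_germ_closed])
        have cac: "?c \<otimes>\<^bsub>R\<^esub> a \<in> carrier R" using a(2) const_germ_closed by simp
        have dc: "b \<ominus>\<^bsub>R\<^esub> ?c \<otimes>\<^bsub>R\<^esub> a \<in> carrier R" using b cac by simp
        have "ev (b \<ominus>\<^bsub>R\<^esub> ?c \<otimes>\<^bsub>R\<^esub> a) + ev (?c \<otimes>\<^bsub>R\<^esub> a) = ev ((b \<ominus>\<^bsub>R\<^esub> ?c \<otimes>\<^bsub>R\<^esub> a) \<oplus>\<^bsub>R\<^esub> ?c \<otimes>\<^bsub>R\<^esub> a)"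
          by (rule ev_add[OF dc cac, symmetric])
        also have "(b \<ominus>\<^bsub>R\<^esub> ?c \<otimes>\<^bsub>R\<^esub> a) \<oplus>\<^bsub>R\<^esub> ?c \<otimes>\<^bsub>R\<^esub> a = b"
          using b a(2) const_germ_closed[of "ev b / ev a"] by algebra
        finally have "ev (b \<ominus>\<^bsub>R\<^esub> ?c \<otimes>\<^bsub>R\<^esub> a) = 0"
          using a(3) by (simp add: ev_mult[OF const_germ_closed a(2)] ev_const)
        then have "b \<ominus>\<^bsub>R\<^esub> ?c \<otimes>\<^bsub>R\<^esub> a \<in> J" using J(2) dc by blast
        then show ?thesis by (rule ideal_of_diff[OF J(1) _ ca b])
      qed
      then show ?thesis using J(3) by blast
    qed simp
  qed
  then show ?thesis by (rule max_ideal_eqI[OF loc, symmetric])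
qed

lemma residually_rational:
  assumes x: "regular_system_of_parameters R d x"
  shows "residually_rational_local_ring R (max_ideal R) (const_germ W \<O> P) d x"
proof -
  have loc: "local_ring R" and noeth: "noetherian_ring R" and x': "x ` {1..d} \<subseteq> carrier R"
    and gen: "max_ideal R = Idl\<^bsub>R\<^esub> (x ` {1..d})"
    using x unfolding regular_system_of_parameters_def regular_local_ring_def by blast+
  have cr: "cring R" using loc unfolding local_ring_def by blast
  interpret cring R by (rule cr)
  have ev1: "ev \<one>\<^bsub>R\<^esub> = 1" using ev_const[of 1] unfolding const_germ_1 .
  show ?thesis
  proof (intro residually_rational_local_ring.intro residually_rational_local_ring_axioms.intro)
    show "ideal (max_ideal R) R" using max_ideal_maximal[OF loc] by (rule maximalideal.axioms(1))
    show "\<one>\<^bsub>R\<^esub> \<notin> max_ideal R" unfolding max_ideal_eq[OF loc] using ev1 by simp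
    show "\<exists>c. a \<ominus>\<^bsub>R\<^esub> const_germ W \<O> P c \<in> max_ideal R" if "a \<in> carrier R" for a
      unfolding max_ideal_eq[OF loc]
      using residue_in_kernel[OF cr that] that const_germ_closed by blast
    show "x \<in> {1..d} \<rightarrow> carrier R" using x' by blast
  qed (fact cr noeth gen const_germ_closed const_germ_add const_germ_mult const_germ_1
      unit_outside_max_ideal[OF loc noeth])+
qed

end

theorem lemma2p1p2p1:
  fixes W :: "'w topology"
    and \<O> :: "('w, 'k::alg_closed_field) fun_sheaf"
    and P :: 'w
    and d N :: nat
    and e :: "nat \<Rightarrow> nat"
    and h x :: "nat \<Rightarrow> ('w set \<times> ('w \<Rightarrow> 'k)) set"
    and v :: "nat \<Rightarrow> ('w set \<times> ('w \<Rightarrow> 'k)) set set"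
    and f :: "nat \<Rightarrow> ('w set \<times> ('w \<Rightarrow> 'k)) set set"
  defines "R \<equiv> stalk W \<O> P"
    and "\<iota> \<equiv> const_germ W \<O> P"
    and "\<mm> \<equiv> max_ideal (stalk W \<O> P)"
    and "q \<equiv> \<lambda>l. CHAR('k) ^ e l"
  assumes "variety W \<O>" and "nonsingular W \<O>" and "variety_dim W d"
    and "P \<in> topspace W"
    and "CHAR('k) = 0 \<Longrightarrow> \<forall>l\<in>{1..N}. e l = 0"
    and "mono_on {1..N} e"
    and "h ` {1..N} \<subseteq> carrier R" and "inj_on h {1..N}"
    and "\<forall>l\<in>{1..N}. v l \<in> gr_component R \<mm> 1 \<and> h l \<in> ideal_pow R \<mm> (q l) \<and>
           gr_class R \<mm> (q l) (h l) = gr_pow R \<mm> (v l) (q l)"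
    and "inj_on v {1..N}"
    and "ring.independent (R Quot ideal_pow R \<mm> 2)
           (range (\<lambda>c. ideal_pow R \<mm> 2 +>\<^bsub>R\<^esub> \<iota> c)) (map v [1..<Suc N])"
    and "regular_system_of_parameters R d x"
    and "N \<le> d" and "\<forall>l\<in>{1..N}. v l = gr_class R \<mm> 1 (x l)"
    and "f \<in> carrier (completion R \<mm>)"
  shows "\<exists>!b. b \<in> coefficient_families d N q \<and> is_expansion R \<mm> \<iota> d N q h x f b"
proof -
  interpret st: stalk_at W \<O> P
    using assms(5,8) unfolding variety_def by (intro stalk_at.intro) blast+
  interpret rr: residually_rational_local_ring R \<mm> \<iota> d x
    unfolding R_def \<mm>_def \<iota>_def
    by (rule st.residually_rational) (use assms(16) in \<open>simp only: R_def\<close>)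
  have "has_chain {\<pp>. primeideal \<pp> R} d"
    using assms(16) unfolding regular_system_of_parameters_def krull_dim_def chain_dim_def by blast
  note lead = rr.lead_zero_empty[OF this]
  \<comment> \<open>In characteristic 0 the convention on exponents appears as
    \<open>0 ^ 0 = 1\<close>.\<close>
  have q: "q l > 0" if "l \<in> {1..N}" for l
    using assms(9) that unfolding q_def by (cases "CHAR('k) = 0") auto
  have hc: "h \<in> {1..N} \<rightarrow> carrier R" using assms(11) by blast
  \<comment> \<open>Both elements have the initial form \<open>v l\<close> to the power
    \<open>q l\<close>; equality of their cosets modulo the next power of the maximal ideal is this
    congruence.\<close>
  have hx: "h l \<ominus>\<^bsub>R\<^esub> x l [^]\<^bsub>R\<^esub> q l \<in> ideal_pow R \<mm> (Suc (q l))" if l: "l \<in> {1..N}" for l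
  proof -
    have ld: "l \<in> {1..d}" using l assms(17) by simp
    have xm: "x l \<in> \<mm>" using rr.x_in_m ld by (rule funcset_mem)
    have xc: "x l [^]\<^bsub>R\<^esub> q l \<in> carrier R"
      using ideal.Icarr[OF rr.m_ideal xm] by (rule rr.nat_pow_closed)
    have hl: "h l \<in> carrier R" using hc l by (rule funcset_mem)
    have "gr_class R \<mm> (q l) (h l) = gr_pow R \<mm> (v l) (q l)" using assms(13) l by blast
    also have "\<dots> = gr_class R \<mm> (q l) (x l [^]\<^bsub>R\<^esub> q l)"
      using assms(18) l rr.gr_pow_gr_class[OF rr.m_ideal xm] by simp
    finally show ?thesis
      unfolding gr_class_def rr.coset_eq_iff[OF rr.mpow_ideal hl xc] .
  qed
  interpret pe: parameter_expansion R \<mm> \<iota> d x N q h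
    by (intro parameter_expansion.intro parameter_expansion_axioms.intro)
      (fact rr.residually_rational_local_ring_axioms lead assms(17) q hc hx)+
  show ?thesis by (rule pe.exists_unique_expansion[OF assms(19)])
qed

end
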